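(* Let $N\ge2$, $1<p<\infty$, and $R>0$. Let $B_R=B_R(0)\subset\mathbb R^N$ and $I=(-R,R)$, with $X_B$, $Q_B$, $Q_I$ as defined in the context. Then, for every distinct $x,y\in B_R$, \[ \left\langle X_B(y)-X_B(x),\frac{y-x}{|y-x|}\right\rangle\le -2Q_B\!\left(\frac{|x-y|}{2}\right), \] with equality if and only if $y=-x$. Moreover, \[ Q_B(r)>Q_I(r)\qquad\text{for every }0<r<R. \]
   Context: For a bounded domain $\Omega\subset\mathbb R^N$ and $1<p<\infty$, the first Dirichlet eigenvalue of the $p$-Laplacian is \[ \lambda_{1,p}(\Omega)=\inf_{u\in W_0^{1,p}(\Omega)\setminus\{0\}}\frac{\int_\Omega|\nabla u|^p\,dx}{\int_\Omega|u|^p\,dx}, \] and a first eigenfunction is a positive minimizer $u>0$ (unique up to a positive multiplicative constant); it solves $-\operatorname{div}(|\nabla u|^{p-2}\nabla u)=\lambda_{1,p}(\Omega)u^{p-1}$ weakly in $\Omega$, $u=0$ on $\partial\Omega$. Ball model: $B_R=B_R(0)\subset\mathbb R^N$; $u_B>0$ is the first eigenfunction on $B_R$ with $u_B(0)=1$. It is radial: $u_B(x)=U_B(|x|)$ with $U_B(0)=1$, $U_B'(0)=0$, $U_B(R)=0$, $U_B'(r)<0$ for $0<r<R$. Define \[ q_B(r):=-\frac{U_B'(r)}{U_B(r)},\qquad Q_B(r):=q_B(r)^{p-1},\qquad 0\le r<R, \] so $q_B(0)=Q_B(0)=0$. The logarithmic $p$-flux is \[ X_B(x):=|\nabla\log u_B(x)|^{p-2}\nabla\log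 u_B(x)=-Q_B(|x|)\frac{x}{|x|}\ \ (x\neq0),\qquad X_B(0)=0. \] One-dimensional model: $I=(-R,R)$ (same $R$), $u_I>0$ is the first eigenfunction on $I$ normalized by $u_I(0)=1$; it is even and strictly decreasing on $(0,R)$. Write $u_I(x)=U_I(|x|)$ and define $q_I(r):=-U_I'(r)/U_I(r)$, $Q_I(r):=q_I(r)^{p-1}$ for $0\le r<R$. *)

theory Defs
  imports "HOL-Analysis.Analysis"
begin

definition gradient :: "('a::euclidean_space \<Rightarrow> real) \<Rightarrow> 'a \<Rightarrow> 'a" where
  "gradient f x = (THE D. GDERIV f x :> D)"

text \<open>\<open>C_diff k f\<close>: \<open>f\<close> is of class $C^k$ on the whole space, via iterated directional derivatives
  (on a Euclidean space these are just linear combinations of iterated partial derivatives).\<close>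

primrec C_diff :: "nat \<Rightarrow> ('a::euclidean_space \<Rightarrow> real) \<Rightarrow> bool" where
  "C_diff 0 f \<longleftrightarrow> continuous_on UNIV f"
| "C_diff (Suc k) f \<longleftrightarrow>
     (\<forall>x. f differentiable (at x)) \<and> (\<forall>v. C_diff k (\<lambda>x. frechet_derivative f (at x) v))"

text \<open>The space $C_c^\infty(\Omega)$, each function being extended by zero to the whole space.\<close>

definition test_function :: "'a::euclidean_space set \<Rightarrow> ('a \<Rightarrow> real) \<Rightarrow> bool" where
  "test_function \<Omega> \<phi> \<longleftrightarrow>
     (\<forall>k. C_diff k \<phi>) \<and> compact (closure {x. \<phi> x \<noteq> 0}) \<and> closure {x. \<phi> x \<noteq> 0} \<subseteq> \<Omega>"

definition in_Lp :: "real \<Rightarrow> 'a::euclidean_space set \<Rightarrow> ('a \<Rightarrow> 'b::euclidean_space) \<Rightarrow> bool" where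
  "in_Lp p \<Omega> f \<longleftrightarrow>
     f \<in> borel_measurable (lebesgue_on \<Omega>) \<and> integrable (lebesgue_on \<Omega>) (\<lambda>x. norm (f x) powr p)"

text \<open>The \<open>p\<close>-th power of the $L^p$ norm.\<close>

definition Lp_energy :: "real \<Rightarrow> 'a::euclidean_space set \<Rightarrow> ('a \<Rightarrow> 'b::euclidean_space) \<Rightarrow> real" where
  "Lp_energy p \<Omega> f = (\<integral>x. norm (f x) powr p \<partial>lebesgue_on \<Omega>)"

text \<open>Sobolev functions are handled together with their weak gradient \<open>G\<close>, which is determined
  by \<open>u\<close> up to a null set.  Membership in $W_0^{1,p}(\Omega)$ means being a limit of test functions
  in the $W^{1,p}$ norm.\<close>

definition W1p :: "real \<Rightarrow> 'a::euclidean_space set \<Rightarrow> ('a \<Rightarrow> real) \<Rightarrow> ('a \<Rightarrow> 'a) \<Rightarrow> bool" where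
  "W1p p \<Omega> u G \<longleftrightarrow> in_Lp p \<Omega> u \<and> in_Lp p \<Omega> G \<and>
     (\<forall>\<phi>. test_function \<Omega> \<phi> \<longrightarrow> (\<forall>b\<in>Basis.
        (\<integral>x. u x * (gradient \<phi> x \<bullet> b) \<partial>lebesgue_on \<Omega>) =
        - (\<integral>x. (G x \<bullet> b) * \<phi> x \<partial>lebesgue_on \<Omega>)))"

definition W1p_0 :: "real \<Rightarrow> 'a::euclidean_space set \<Rightarrow> ('a \<Rightarrow> real) \<Rightarrow> ('a \<Rightarrow> 'a) \<Rightarrow> bool" where
  "W1p_0 p \<Omega> u G \<longleftrightarrow> W1p p \<Omega> u G \<and>
     (\<exists>\<phi>::nat \<Rightarrow> 'a \<Rightarrow> real. (\<forall>n. test_function \<Omega> (\<phi> n)) \<and>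
        (\<lambda>n. Lp_energy p \<Omega> (\<lambda>x. \<phi> n x - u x)) \<longlonglongrightarrow> 0 \<and>
        (\<lambda>n. Lp_energy p \<Omega> (\<lambda>x. gradient (\<phi> n) x - G x)) \<longlonglongrightarrow> 0)"

definition first_eigenvalue :: "real \<Rightarrow> 'a::euclidean_space set \<Rightarrow> real" where
  "first_eigenvalue p \<Omega> =
     Inf {Lp_energy p \<Omega> G / Lp_energy p \<Omega> u | u G.
            W1p_0 p \<Omega> u G \<and> \<not> (AE x in lebesgue_on \<Omega>. u x = 0)}"

definition first_eigenfunction :: "real \<Rightarrow> 'a::euclidean_space set \<Rightarrow> ('a \<Rightarrow> real) \<Rightarrow> bool" where
  "first_eigenfunction p \<Omega> u \<longleftrightarrow> (\<forall>x\<in>\<Omega>. 0 < u x) \<and>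
     (\<exists>G. W1p_0 p \<Omega> u G \<and> Lp_energy p \<Omega> G / Lp_energy p \<Omega> u = first_eigenvalue p \<Omega>)"

text \<open>An element of $W_0^{1,p}(\Omega)$ is only a class of functions modulo null sets.  Pointwise
  statements refer to its classical representative, which on balls exists by elliptic regularity.\<close>

definition classical_first_eigenfunction ::
  "real \<Rightarrow> 'a::euclidean_space set \<Rightarrow> ('a \<Rightarrow> real) \<Rightarrow> bool" where
  "classical_first_eigenfunction p \<Omega> u \<longleftrightarrow> first_eigenfunction p \<Omega> u \<and>
     (\<forall>x\<in>\<Omega>. u differentiable (at x)) \<and> continuous_on \<Omega> (gradient u) \<and>
     continuous_on (closure \<Omega>) u \<and> (\<forall>x\<in>frontier \<Omega>. u x = 0)"

text \<open>For radial \<open>u\<close> this is the profile \<open>U\<close> with \<open>u x = U (norm x)\<close>, extended evenly to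
  negative arguments; the choice of the unit vector is then immaterial.\<close>

definition profile :: "('a::euclidean_space \<Rightarrow> real) \<Rightarrow> real \<Rightarrow> real" where
  "profile u r = u (r *\<^sub>R (SOME b. b \<in> Basis))"

definition q_of :: "('a::euclidean_space \<Rightarrow> real) \<Rightarrow> real \<Rightarrow> real" where
  "q_of u r = - deriv (profile u) r / profile u r"

definition Q_of :: "real \<Rightarrow> ('a::euclidean_space \<Rightarrow> real) \<Rightarrow> real \<Rightarrow> real" where
  "Q_of p u r = q_of u r powr (p - 1)"

text \<open>Where the gradient vanishes (as at the origin of a ball) the value is 0 for every \<open>p\<close>,
  since \<open>0 powr a = 0\<close>.\<close>

definition log_flux :: "real \<Rightarrow> ('a::euclidean_space \<Rightarrow> real) \<Rightarrow> 'a \<Rightarrow> 'a" where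
  "log_flux p u x =
     (let g = gradient (\<lambda>z. ln (u z)) x in (norm g powr (p - 2)) *\<^sub>R g)"

end

theory Submission
  imports Defs
begin

text \<open>
  The minimizing property gives the Euler--Lagrange equation for smooth test functions and, by
  mollification, for $C^1$ test functions with compact support.  If $S$ is a reflection then
  $v = u \circ S$ solves the same equation; Picone's identity with test functions $|\phi_n|^p / v^{p-1}$,
  where $\phi_n \to u$ in $W^{1,p}$, yields $\nabla \log u = \nabla \log v$, so $u$ is radial.
  Testing with radial functions gives $r^{N-1} |U'|^{p-2} U' = - \lambda \int_0^r s^{N-1} U^{p-1}$, that is
  $Q' = \lambda + (p-1) Q^{p/(p-1)} - (N-1) Q/r$.  With the integrating factor $U^p$ this shows first that
  $m = Q/r$ is strictly increasing and then that $Q$ is strictly convex.  The two-point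
  inequality follows from these two facts.  For the comparison let $T$ be the inverse of $Q_I$: the derivative of
  $T(Q_B(r)) - r$ has the sign of $\lambda_B - \lambda_I - (N-1) m(r)$, which is strictly decreasing,
  and the function vanishes at both ends of $(0,R)$, hence is positive in between.
\<close>

section \<open>Functions of class $C^k$ and smooth bumps\<close>

text \<open>The hypotheses supply a C^1 representative and nothing about second derivatives, and the
  p-Laplacian degenerates at the centre, where the gradient vanishes. So the second-order equation
  is never differentiated: the radial weak equation is integrated once, which writes
  \<open>Q\<close> as a quotient of functions with known derivatives, and from there on only a
  first-order Riccati equation is used.

  Radial symmetry is derived, and simplicity of the eigenvalue is never invoked. Picone's identity
  is applied to test functions because u^p / v^(p-1) need not be compactly supported; since
  |\<phi>|^p is in general only C^1, the weak equation has to be extended beyond smooth test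
  functions.

  The two eigenvalues are not compared in advance. Monotonicity of Q/r shows that the decisive sign
  changes at most once, from plus to minus, and the behaviour at 0 and R does the rest. In dimension
  one every term with N-1 vanishes, so a single locale covers the ball and the interval.\<close>

lemma C_diff_SucI:
  assumes "\<And>x. (f has_derivative f' x) (at x)" "\<And>v. C_diff k (\<lambda>x. f' x v)"
  shows "C_diff (Suc k) f"
proof -
  have "frechet_derivative f (at x) = f' x" for x
    using frechet_derivative_at[OF assms(1)] by simp
  moreover have "f differentiable (at x)" for x
    using assms(1) differentiable_def by blast
  ultimately show ?thesis using assms(2) by simp
qed

lemma C_diff_SucD:
  assumes "C_diff (Suc k) f"
  shows "(f has_derivative frechet_derivative f (at x)) (at x)"
    and "C_diff k (\<lambda>x. frechet_derivative f (at x) v)"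
  using assms by (auto simp: frechet_derivative_works[symmetric])

lemma C_diff_Suc_imp: "C_diff (Suc k) f \<Longrightarrow> C_diff k f"
proof (induction k arbitrary: f)
  case 0
  then show ?case
    by (auto intro!: differentiable_imp_continuous_on simp: differentiable_on_def)
next
  case (Suc k)
  show ?case
    by (rule C_diff_SucI[OF C_diff_SucD(1)[OF Suc.prems]]) (use Suc in auto)
qed

lemma C_diff_const: "C_diff k (\<lambda>x. c)"
proof (induction k arbitrary: c)
  case (Suc k)
  show ?case
    by (rule C_diff_SucI[of _ "\<lambda>x h. 0"]) (auto intro: Suc)
qed simp

lemma C_diff_linear: "bounded_linear f \<Longrightarrow> C_diff k f"
proof (cases k)
  case 0
  then show "bounded_linear f \<Longrightarrow> ?thesis"
    by (simp add: linear_continuous_on)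
next
  case (Suc j)
  show "bounded_linear f \<Longrightarrow> ?thesis"
    unfolding Suc by (rule C_diff_SucI[of _ "\<lambda>x h. f h"])
      (auto intro: bounded_linear_imp_has_derivative C_diff_const)
qed

lemma C_diff_add: "C_diff k f \<Longrightarrow> C_diff k g \<Longrightarrow> C_diff k (\<lambda>x. f x + g x)"
proof (induction k arbitrary: f g)
  case (Suc k)
  show ?case
    by (rule C_diff_SucI[OF has_derivative_add[OF C_diff_SucD(1)[OF Suc.prems(1)] C_diff_SucD(1)[OF Suc.prems(2)]]])
       (intro Suc.IH C_diff_SucD(2) Suc.prems)
qed (simp add: continuous_on_add)

lemma C_diff_mult: "C_diff k f \<Longrightarrow> C_diff k g \<Longrightarrow> C_diff k (\<lambda>x. f x * g x)"
proof (induction k arbitrary: f g)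
  case (Suc k)
  show ?case
    by (rule C_diff_SucI[OF has_derivative_mult[OF C_diff_SucD(1)[OF Suc.prems(1)] C_diff_SucD(1)[OF Suc.prems(2)]]])
       (intro C_diff_add Suc.IH C_diff_SucD(2) Suc.prems Suc.prems[THEN C_diff_Suc_imp])
qed (simp add: continuous_on_mult)

lemma C_diff_diff: "C_diff k f \<Longrightarrow> C_diff k g \<Longrightarrow> C_diff k (\<lambda>x. f x - g x)"
  using C_diff_add[OF _ C_diff_mult[OF C_diff_const[of k "-1"]], of f g] by simp

lemma C_diff_prod: "(\<And>i. i \<in> A \<Longrightarrow> C_diff k (f i)) \<Longrightarrow> C_diff k (\<lambda>x. \<Prod>i\<in>A. f i x)"
  by (induction A rule: infinite_finite_induct) (auto intro: C_diff_const C_diff_mult)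

text \<open>The induction replaces the outer function by its derivative, so it has to run over a
  family \<open>S\<close> closed under differentiation instead of one fixed
  \<open>F\<close>.\<close>

lemma C_diff_compose:
  assumes S: "\<And>F. F \<in> S \<Longrightarrow> \<exists>F'\<in>S. \<forall>t. (F has_real_derivative F' t) (at t)"
    and "F \<in> S" "C_diff k g"
  shows "C_diff k (\<lambda>x. F (g x))"
  using assms(2,3)
proof (induction k arbitrary: F g)
  case 0
  obtain F' where "\<forall>t. (F has_real_derivative F' t) (at t)" using S[OF 0(1)] by blast
  then have "continuous_on UNIV F"
    using DERIV_isCont continuous_at_imp_continuous_on by blast
  then show ?case using 0(2) continuous_on_compose2[of UNIV F UNIV g] by simp
next
  case (Suc k)
  obtain F' where F': "F' \<in> S" "\<And>t. (F has_real_derivative F' t) (at t)"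
    using S[OF Suc.prems(1)] by blast
  show ?case
  proof (rule C_diff_SucI[of _ "\<lambda>x h. F' (g x) * frechet_derivative g (at x) h"])
    show "((\<lambda>x. F (g x)) has_derivative (\<lambda>h. F' (g x) * frechet_derivative g (at x) h)) (at x)" for x
      using has_derivative_compose[OF C_diff_SucD(1)[OF Suc.prems(2)] F'(2)[unfolded has_field_derivative_def]] .
    show "C_diff k (\<lambda>x. F' (g x) * frechet_derivative g (at x) v)" for v
      by (rule C_diff_mult[OF Suc.IH[OF F'(1) C_diff_Suc_imp[OF Suc.prems(2)]] C_diff_SucD(2)[OF Suc.prems(2)]])
  qed
qed

section \<open>Exponentials and a smooth function flat at the origin\<close>

lemma C_diff_exp: "C_diff k g \<Longrightarrow> C_diff k (\<lambda>x. exp (g x))"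
  by (rule C_diff_compose[where S = "{exp}"]) (auto intro!: derivative_eq_intros)

text \<open>Allowing an arbitrary polynomial in 1/t makes the family closed under differentiation,
  as \<open>C_diff_compose\<close> requires; \<open>flat 1\<close> is the classical exp(-1/t)
  extended by zero.\<close>

definition flat :: "real poly \<Rightarrow> real \<Rightarrow> real" where
  "flat P t = (if t > 0 then poly P (inverse t) * exp (- inverse t) else 0)"

lemma poly_div_exp_tendsto_0: "((\<lambda>x. poly P x * exp (- x)) \<longlongrightarrow> (0::real)) at_top"
proof -
  have "(\<lambda>x. poly P x * exp (- x)) = (\<lambda>x. \<Sum>i\<le>degree P. coeff P i * (x ^ i / exp x))"
    by (simp add: poly_altdef sum_distrib_right exp_minus field_simps sum_divide_distrib)
  moreover have "((\<lambda>x. \<Sum>i\<le>degree P. coeff P i * (x ^ i / exp x)) \<longlongrightarrow> (\<Sum>i\<le>degree P. coeff P i * 0)) at_top"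
    by (intro tendsto_intros tendsto_power_div_exp_0)
  ultimately show ?thesis by simp
qed

lemma flat_tendsto_0: "(flat P \<longlongrightarrow> 0) (at 0)"
proof -
  have "((\<lambda>t. poly P (inverse t) * exp (- inverse t)) \<longlongrightarrow> 0) (at_right 0)"
    by (rule filterlim_compose[OF poly_div_exp_tendsto_0 filterlim_inverse_at_top_right])
  then have "(flat P \<longlongrightarrow> 0) (at_right 0)"
    by (rule Lim_transform_eventually) (auto simp: flat_def eventually_at_filter)
  moreover have "(flat P \<longlongrightarrow> 0) (at_left 0)"
    by (rule Lim_transform_eventually[OF tendsto_const]) (auto simp: flat_def eventually_at_filter)
  ultimately show ?thesis
    by (simp add: filterlim_split_at)
qed

lemma DERIV_flat: "(flat P has_real_derivative flat ([:0,0,1:] * (P - pderiv P)) t) (at t)"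
proof -
  consider "t > 0" | "t < 0" | "t = 0" by linarith
  then show ?thesis
  proof cases
    case 1
    have "((\<lambda>t. poly P (inverse t) * exp (- inverse t)) has_real_derivative
        flat ([:0,0,1:] * (P - pderiv P)) t) (at t)"
      using 1 by (auto intro!: derivative_eq_intros simp: flat_def field_simps power2_eq_square)
    then show ?thesis
      by (rule has_field_derivative_transform_within[where d = t]) (use 1 in \<open>auto simp: flat_def dist_real_def\<close>)
  next
    case 2
    have "DERIV (\<lambda>t. 0) t :> flat ([:0,0,1:] * (P - pderiv P)) t"
      using 2 by (auto simp: flat_def)
    then show ?thesis
      by (rule has_field_derivative_transform_within[where d = "-t"]) (use 2 in \<open>auto simp: flat_def dist_real_def\<close>)
  next
    case 3
    \<comment> \<open>Dividing by \<open>h\<close> multiplies the polynomial by its variable, so the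
      difference quotient at 0 is again in the family and tends to 0.\<close>
    have "(\<lambda>h. (flat P (0 + h) - flat P 0) / h) = flat ([:0,1:] * P)"
      by (auto simp: flat_def field_simps fun_eq_iff)
    then show ?thesis
      using flat_tendsto_0[of "[:0,1:] * P"] by (simp add: 3 DERIV_def flat_def)
  qed
qed

lemma C_diff_flat: "C_diff k g \<Longrightarrow> C_diff k (\<lambda>x. flat P (g x))"
  by (rule C_diff_compose[where S = "range flat"]) (use DERIV_flat in auto)

lemma flat_1_pos: "t > 0 \<Longrightarrow> flat 1 t > 0" and flat_1_zero: "t \<le> 0 \<Longrightarrow> flat P t = 0"
  and flat_1_nonneg: "flat 1 t \<ge> 0"
  by (auto simp: flat_def)

lemma C_diff_continuous: "C_diff k f \<Longrightarrow> continuous_on UNIV f"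
proof (induction k)
  case (Suc k)
  then show ?case using C_diff_Suc_imp by blast
qed simp

section \<open>Gradients as vectors representing the derivative\<close>

abbreviation has_gradient :: "('a::real_inner \<Rightarrow> real) \<Rightarrow> 'a \<Rightarrow> 'a \<Rightarrow> bool" where
  "has_gradient f D x \<equiv> (f has_derivative (\<lambda>h. D \<bullet> h)) (at x)"

lemma gradient_eqI:
  assumes "has_gradient f D x"
  shows "gradient f x = D"
  unfolding gradient_def
proof (rule the_equality)
  show "GDERIV f x :> D" using assms by (simp add: gderiv_def inner_commute)
next
  fix D' assume "GDERIV f x :> D'"
  then have "has_gradient f D' x" by (simp add: gderiv_def inner_commute)
  from has_derivative_unique[OF this assms] have "\<And>h. D' \<bullet> h = D \<bullet> h" by metis
  then show "D' = D" using vector_eq_rdot by blast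
qed

text \<open>\<open>gradient\<close> is a definite description, so a representing vector must be
  exhibited: its coordinates are the values of the derivative on the basis.\<close>

lemma has_derivative_gradient:
  assumes "f differentiable (at x)"
  shows "has_gradient f (gradient f x) x"
proof -
  obtain f' where f': "(f has_derivative f') (at x)" using assms differentiable_def by blast
  then interpret bounded_linear f' by (rule has_derivative_bounded_linear)
  have "f' = (\<lambda>h. (\<Sum>b\<in>Basis. f' b *\<^sub>R b) \<bullet> h)"
  proof
    fix h
    have "f' h = f' (\<Sum>b\<in>Basis. (h \<bullet> b) *\<^sub>R b)" by (simp add: euclidean_representation)
    also have "\<dots> = (\<Sum>b\<in>Basis. f' b *\<^sub>R b) \<bullet> h"
      by (simp add: sum scale inner_sum_left inner_sum_right mult.commute inner_commute)
    finally show "f' h = (\<Sum>b\<in>Basis. f' b *\<^sub>R b) \<bullet> h" .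
  qed
  then show ?thesis using f' gradient_eqI by metis
qed

lemma C_diff_gradient:
  assumes "C_diff (Suc k) f"
  shows "has_gradient f (gradient f x) x"
    and "C_diff k (\<lambda>x. gradient f x \<bullet> v)"
proof -
  show *: "has_gradient f (gradient f x) x" for x
    using assms by (intro has_derivative_gradient) simp
  have "(\<lambda>x. gradient f x \<bullet> v) = (\<lambda>x. frechet_derivative f (at x) v)"
    using frechet_derivative_at[OF *] by (auto simp: fun_eq_iff)
  then show "C_diff k (\<lambda>x. gradient f x \<bullet> v)"
    using assms by simp
qed

lemma C_diff_gradient_continuous:
  assumes "C_diff (Suc k) f"
  shows "continuous_on UNIV (gradient f)"
proof -
  have "continuous_on UNIV (\<lambda>x. gradient f x \<bullet> b)" for b
    using C_diff_gradient(2)[OF assms] by (rule C_diff_continuous)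
  then show ?thesis by (intro continuous_on_componentwise[THEN iffD2]) auto
qed

text \<open>A product of one-dimensional bumps. It serves twice: normalized as the mollification
  kernel, and as the exponent of test functions increasing to the indicator of a box.\<close>

lemma box_bump_exists:
  fixes a c :: "'a::euclidean_space"
  obtains T where "\<And>k. C_diff k T" "\<And>x. x \<in> box a c \<Longrightarrow> T x > (0::real)"
    "\<And>x. x \<notin> box a c \<Longrightarrow> T x = 0" "\<And>x. T x \<ge> 0"
proof -
  define T where "T = (\<lambda>x::'a. \<Prod>b\<in>Basis. flat 1 (x \<bullet> b - a \<bullet> b) * flat 1 (c \<bullet> b - x \<bullet> b))"
  have "C_diff k T" for k
    unfolding T_def by (intro C_diff_prod C_diff_mult C_diff_flat C_diff_diff C_diff_const C_diff_linear bounded_linear_inner_left)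
  moreover have "T x > 0" if "x \<in> box a c" for x
    using that by (auto simp: T_def mem_box intro!: prod_pos mult_pos_pos flat_1_pos)
  moreover have "T x = 0" if x: "x \<notin> box a c" for x
  proof -
    obtain b where "b \<in> Basis" "x \<bullet> b - a \<bullet> b \<le> 0 \<or> c \<bullet> b - x \<bullet> b \<le> 0"
      using x by (auto simp: mem_box not_less)
    then show ?thesis unfolding T_def by (intro prod_zero) (auto intro!: bexI[of _ b] simp: flat_1_zero)
  qed
  moreover have "T x \<ge> 0" for x
    unfolding T_def by (intro prod_nonneg mult_nonneg_nonneg flat_1_nonneg)
  ultimately show ?thesis using that by blast
qed

section \<open>Isometries and polar coordinates for Lebesgue measure\<close>

lemma nn_integral_lborel_translate:
  fixes c :: "'a::euclidean_space"
  assumes [measurable]: "f \<in> borel_measurable borel"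
  shows "(\<integral>\<^sup>+x. f (c + x) \<partial>lborel) = (\<integral>\<^sup>+x. f x \<partial>lborel)"
  using nn_integral_distr[of "(+) c" lborel borel f] by (simp add: lborel_distr_plus)

text \<open>Fubini turns translation invariance into invariance under linear isometries: both sides
  are compared with the volume of the unit ball, which the isometry preserves.\<close>

lemma distr_lborel_isometry:
  fixes S :: "'a::euclidean_space \<Rightarrow> 'a"
  assumes lin: "linear S" and norm: "\<And>x. norm (S x) = norm x" and inv: "\<And>x. S (S x) = x"
  shows "distr lborel borel S = lborel"
proof (rule measure_eqI)
  have [measurable]: "S \<in> borel_measurable borel"
    using lin by (simp add: borel_measurable_continuous_onI linear_continuous_on linear_conv_bounded_linear)
  fix A :: "'a set" assume "A \<in> sets (distr lborel borel S)"
  then have [measurable]: "A \<in> sets borel" by simp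
  define g :: "'a \<Rightarrow> ennreal" where "g = indicator (ball 0 1)"
  have [measurable]: "g \<in> borel_measurable borel" unfolding g_def by (intro borel_measurable_indicator) simp
  define c where "c = (\<integral>\<^sup>+x. g x \<partial>lborel)"
  have c: "c = emeasure lborel (ball (0::'a) 1)" by (simp add: c_def g_def)
  have c0: "c \<noteq> 0" "c < \<infinity>"
    using emeasure_lborel_ball_finite[of "0::'a" 1] content_ball_pos[of 1 "0::'a"]
    by (auto simp: c emeasure_eq_ennreal_measure)
  have gS: "g (- S x) = g x" for x by (simp add: g_def norm split: split_indicator)
  have "(\<integral>\<^sup>+x. indicator A (S x) \<partial>lborel) * c = (\<integral>\<^sup>+x. (\<integral>\<^sup>+y. indicator A (S x) * g y \<partial>lborel) \<partial>lborel)"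
    by (simp add: c_def nn_integral_cmult nn_integral_multc)
  also have "\<dots> = (\<integral>\<^sup>+x. (\<integral>\<^sup>+y. indicator A (S x) * g (- S x + y) \<partial>lborel) \<partial>lborel)"
    by (intro nn_integral_cong nn_integral_lborel_translate[symmetric]) simp
  also have "\<dots> = (\<integral>\<^sup>+y. (\<integral>\<^sup>+x. indicator A (S x) * g (- S x + y) \<partial>lborel) \<partial>lborel)"
    by (rule lborel_pair.Fubini') simp
  \<comment> \<open>Since \<open>S\<close> is an involution, shifting \<open>x\<close> by
    \<open>S y\<close> shifts \<open>S x\<close> by \<open>y\<close>; the shift thereby moves from
    the weight \<open>g\<close> to the set \<open>A\<close>.\<close>
  also have "\<dots> = (\<integral>\<^sup>+y. (\<integral>\<^sup>+x. indicator A (S x + y) * g (- S x) \<partial>lborel) \<partial>lborel)"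
  proof (rule nn_integral_cong)
    fix y
    have "(\<integral>\<^sup>+x. indicator A (S x) * g (- S x + y) \<partial>lborel)
        = (\<integral>\<^sup>+x. indicator A (S (S y + x)) * g (- S (S y + x) + y) \<partial>lborel)"
      by (rule nn_integral_lborel_translate[symmetric]) simp
    then show "(\<integral>\<^sup>+x. indicator A (S x) * g (- S x + y) \<partial>lborel) =
      (\<integral>\<^sup>+x. indicator A (S x + y) * g (- S x) \<partial>lborel)"
      by (simp add: linear_add[OF lin] inv add.commute)
  qed
  also have "\<dots> = (\<integral>\<^sup>+x. (\<integral>\<^sup>+y. indicator A (S x + y) * g (- S x) \<partial>lborel) \<partial>lborel)"
    by (rule lborel_pair.Fubini') simp
  also have "\<dots> = (\<integral>\<^sup>+x. emeasure lborel A * g x \<partial>lborel)"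
  proof (rule nn_integral_cong)
    fix x
    have "(\<integral>\<^sup>+y. indicator A (S x + y) * g (- S x) \<partial>lborel) = (\<integral>\<^sup>+y. indicator A (S x + y) \<partial>lborel) * g (- S x)"
      by (rule nn_integral_multc) simp
    also have "(\<integral>\<^sup>+y. indicator A (S x + y) \<partial>lborel) = emeasure lborel A"
      by (subst nn_integral_lborel_translate) auto
    finally show "(\<integral>\<^sup>+y. indicator A (S x + y) * g (- S x) \<partial>lborel) = emeasure lborel A * g x"
      by (simp add: gS)
  qed
  also have "\<dots> = emeasure lborel A * c" by (simp add: c_def nn_integral_cmult)
  finally have "(\<integral>\<^sup>+x. indicator A (S x) \<partial>lborel) = emeasure lborel A"
    using c0 ennreal_mult_cancel_left[of c] by (auto simp: mult.commute)
  moreover have "emeasure (distr lborel borel S) A = (\<integral>\<^sup>+x. indicator A (S x) \<partial>lborel)"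
    by (subst nn_integral_distr[symmetric, of S lborel borel "indicator A"]) auto
  ultimately show "emeasure (distr lborel borel S) A = emeasure lborel A" by simp
qed simp

text \<open>It suffices to compare both measures on the half-lines \<open>{..a}\<close>, where the
  left one gives the volume of a ball of radius \<open>a\<close>. The density on the right is the
  derivative of that volume.\<close>

lemma distr_lborel_norm:
  "distr lborel borel (norm :: 'a::euclidean_space \<Rightarrow> real) =
    density lborel (\<lambda>r. ennreal (indicator {0..} r * (DIM('a) * unit_ball_vol (DIM('a)) * r ^ (DIM('a) - 1))))"
  (is "?M = ?N")
proof (rule measure_eqI_generator_eq[where E = "range atMost" and \<Omega> = UNIV and A = "\<lambda>n::nat. {..real n}"])
  show "Int_stable (range atMost :: real set set)"
    by (auto simp: Int_stable_def)
  show "sets ?M = sigma_sets UNIV (range atMost)" "sets ?N = sigma_sets UNIV (range atMost)"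
    by (simp_all add: borel_eq_atMost)
  show "(\<Union>i::nat. {..real i}) = UNIV" using real_arch_simple by auto
  have M: "emeasure ?M {..a} = (if a < 0 then 0 else unit_ball_vol (DIM('a)) * a ^ DIM('a))" for a
  proof -
    have "norm -` {..a} = cball (0::'a) a" by auto
    then show ?thesis by (auto simp: emeasure_distr emeasure_cball not_less)
  qed
  show "emeasure ?M {..real i} \<noteq> \<infinity>" for i :: nat by (simp add: M)
  fix X :: "real set" assume "X \<in> range atMost"
  then obtain a where X: "X = {..a}" by auto
  have "emeasure ?N {..a} = (\<integral>\<^sup>+r. ennreal (indicator {0..} r * (DIM('a) * unit_ball_vol (DIM('a)) * r ^ (DIM('a) - 1))) * indicator {..a} r \<partial>lborel)"
    by (rule emeasure_density) auto
  also have "\<dots> = (\<integral>\<^sup>+r. ennreal (DIM('a) * unit_ball_vol (DIM('a)) * r ^ (DIM('a) - 1)) * indicator {0..a} r \<partial>lborel)"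
    by (intro nn_integral_cong) (auto split: split_indicator)
  also have "\<dots> = (if a < 0 then 0 else unit_ball_vol (DIM('a)) * a ^ DIM('a))"
  proof (cases "a < 0")
    case False
    have "(\<integral>\<^sup>+r. ennreal (DIM('a) * unit_ball_vol (DIM('a)) * r ^ (DIM('a) - 1)) * indicator {0..a} r \<partial>lborel)
      = ennreal (unit_ball_vol (DIM('a)) * a ^ DIM('a) - unit_ball_vol (DIM('a)) * 0 ^ DIM('a))"
      using False by (intro nn_integral_FTC_Icc) (auto intro!: derivative_eq_intros)
    then show ?thesis using False by simp
  qed auto
  finally show "emeasure ?M X = emeasure ?N X" by (simp add: X M)
qed auto

lemma integral_radial:
  assumes [measurable]: "f \<in> borel_measurable borel"
  shows "(LBINT x. f (norm (x::'a::euclidean_space))) =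
    DIM('a) * unit_ball_vol (DIM('a)) * (LBINT r. indicator {0..} r * (r ^ (DIM('a) - 1) * (f r :: real)))"
proof -
  have "(LBINT x. f (norm (x::'a))) = integral\<^sup>L (distr lborel borel (norm :: 'a \<Rightarrow> real)) f"
    by (rule integral_distr[symmetric]) auto
  also have "\<dots> = (LBINT r. (indicator {0..} r * (DIM('a) * unit_ball_vol (DIM('a)) * r ^ (DIM('a) - 1))) * f r)"
    unfolding distr_lborel_norm by (subst integral_density) (auto split: split_indicator)
  also have "\<dots> = (LBINT r. (DIM('a) * unit_ball_vol (DIM('a))) * (indicator {0..} r * (r ^ (DIM('a) - 1) * f r)))"
    by (intro Bochner_Integration.integral_cong) auto
  finally show ?thesis by simp
qed

section \<open>Compactly supported functions and integrals of their derivatives\<close>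

lemma continuous_on_zero_extend:
  fixes f :: "'a::topological_space \<Rightarrow> 'b::real_normed_vector"
  assumes "continuous_on S f" "open S" "closed K" "K \<subseteq> S" "\<And>x. x \<notin> K \<Longrightarrow> f x = 0"
  shows "continuous_on UNIV f"
proof -
  have "continuous_on (- K) f"
    using assms(5) by (subst continuous_on_cong[OF refl, of _ _ "\<lambda>_. 0"]) auto
  then have "continuous_on (S \<union> - K) f"
    using assms by (intro continuous_on_open_Un) auto
  moreover have "S \<union> - K = UNIV" using assms(4) by auto
  ultimately show ?thesis by simp
qed

lemma integrable_compact_support:
  fixes f :: "'a::euclidean_space \<Rightarrow> 'b::euclidean_space"
  assumes "continuous_on UNIV f" "bounded K" "\<And>x. x \<notin> K \<Longrightarrow> f x = 0"
  shows "integrable lborel f" "f \<in> borel_measurable borel"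
proof -
  obtain a where a: "K \<subseteq> cbox (-a) a"
    using bounded_subset_cbox_symmetric[OF assms(2)] by blast
  have "set_integrable lborel (cbox (-a) a) f"
    unfolding set_integrable_def
    by (intro borel_integrable_compact continuous_on_subset[OF assms(1)]) auto
  moreover have "(\<lambda>x. indicator (cbox (-a) a) x *\<^sub>R f x) = f"
    using a assms(3) by (auto simp: fun_eq_iff split: split_indicator)
  ultimately show "integrable lborel f" by (simp add: set_integrable_def)
  then show "f \<in> borel_measurable borel" by auto
qed

lemma bounded_compact_support:
  fixes f :: "'a::euclidean_space \<Rightarrow> 'b::euclidean_space"
  assumes "continuous_on UNIV f" "bounded K" "\<And>x. x \<notin> K \<Longrightarrow> f x = 0"
  obtains M where "M > 0" "\<And>x. norm (f x) \<le> M"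
proof -
  have "compact (f ` closure K)"
    using assms by (intro compact_continuous_image continuous_on_subset[OF assms(1)]) auto
  then obtain M where M: "M > 0" "\<And>x. x \<in> closure K \<Longrightarrow> norm (f x) \<le> M"
    by (metis bounded_pos compact_imp_bounded imageI)
  show ?thesis
    by (rule that[of M]) (use M assms(3) closure_subset[of K] in \<open>auto intro: less_imp_le\<close>,
        metis M(1,2) assms(3) closure_subset less_imp_le norm_zero subset_iff)
qed

text \<open>By translation invariance every difference quotient in direction \<open>v\<close> has
  integral 0, and dominated convergence passes to the directional derivative.\<close>

lemma integral_gradient_zero:
  fixes f :: "'a::euclidean_space \<Rightarrow> real"
  assumes der: "\<And>x. has_gradient f (D x) x" and cont: "continuous_on UNIV D"
    and K: "bounded K" "\<And>x. x \<notin> K \<Longrightarrow> f x = 0" "\<And>x. x \<notin> K \<Longrightarrow> D x = 0"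
  shows "(LBINT x. D x \<bullet> v) = 0"
proof -
  have cf: "continuous_on UNIV f"
    using der by (intro has_derivative_continuous_on[where f' = "\<lambda>x h. D x \<bullet> h"]) (auto intro: has_derivative_at_withinI)
  note [measurable] = integrable_compact_support(2)[OF cf K(1,2)] integrable_compact_support(2)[OF cont K(1,3)]
  obtain M where M: "M > 0" "\<And>x. norm (D x) \<le> M"
    using bounded_compact_support[OF cont K(1,3)] by auto
  obtain r where r: "r > 0" "\<And>x. x \<in> K \<Longrightarrow> norm x \<le> r"
    using K(1) by (auto simp: bounded_pos)
  define s where "s n x = real (Suc n) * (f (v /\<^sub>R real (Suc n) + x) - f x)" for n x
  have int: "integrable lborel (\<lambda>x. f (w + x))" for w
    using integrable_distr[of "(+) w" lborel borel f] integrable_compact_support(1)[OF cf K(1,2)]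
    by (simp add: lborel_distr_plus)
  have eq: "(LBINT x. f (w + x)) = (LBINT x. f x)" for w
    using integral_distr[of "(+) w" lborel borel f] by (simp add: lborel_distr_plus)
  have s0: "(LBINT x. s n x) = 0" for n
    using int[of "v /\<^sub>R real (Suc n)"] int[of 0] eq[of "v /\<^sub>R real (Suc n)"]
    unfolding s_def by (simp add: Bochner_Integration.integral_diff)
  have "(\<lambda>n. (LBINT x. s n x)) \<longlonglongrightarrow> (LBINT x. D x \<bullet> v)"
  \<comment> \<open>All increments have length at most \<open>norm v\<close>. Inside the enlarged
    ball the mean value inequality gives the bound \<open>M * norm v\<close>; outside it both
    evaluation points miss \<open>K\<close>.\<close>
  proof (rule integral_dominated_convergence[where w = "\<lambda>x. M * norm v * indicator (cball 0 (r + norm v)) x"])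
    show "integrable lborel (\<lambda>x. M * norm v * indicator (cball (0::'a) (r + norm v)) x)"
      using emeasure_compact_finite[OF compact_cball, of "0::'a" "r + norm v"] by simp
    show "AE x in lborel. (\<lambda>i. s i x) \<longlonglongrightarrow> D x \<bullet> v"
    proof (rule AE_I2)
      fix x
      have "((\<lambda>t. f (x + t *\<^sub>R v)) has_derivative (\<lambda>t. D x \<bullet> (t *\<^sub>R v))) (at 0)"
        by (rule has_derivative_compose[of "\<lambda>t. x + t *\<^sub>R v" "\<lambda>t. t *\<^sub>R v", where g = f])
           (auto intro!: derivative_eq_intros der)
      then have "DERIV (\<lambda>t. f (x + t *\<^sub>R v)) 0 :> D x \<bullet> v"
        by (simp add: has_field_derivative_def mult.commute[of _ "D x \<bullet> v"] )
      then have lim: "((\<lambda>t. (f (x + t *\<^sub>R v) - f x) / t) \<longlongrightarrow> D x \<bullet> v) (at 0)"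
        by (simp add: DERIV_def)
      have "filterlim (\<lambda>n. inverse (real (Suc n))) (at 0) sequentially"
        unfolding filterlim_at using LIMSEQ_inverse_real_of_nat by auto
      from filterlim_compose[OF lim this]
      show "(\<lambda>i. s i x) \<longlonglongrightarrow> D x \<bullet> v" by (simp add: s_def field_simps add.commute)
    qed
    show "AE x in lborel. norm (s i x) \<le> M * norm v * indicator (cball 0 (r + norm v)) x" for i
    proof (rule AE_I2)
      fix x
      have small: "norm (v /\<^sub>R real (Suc i)) \<le> norm v"
        using mult_left_le[of "inverse (real (Suc i))" "norm v"] by (simp add: field_simps)
      show "norm (s i x) \<le> M * norm v * indicator (cball 0 (r + norm v)) x"
      proof (cases "x \<in> cball 0 (r + norm v)")
        case True
        have "norm (f (v /\<^sub>R real (Suc i) + x) - f x) \<le> M * norm (v /\<^sub>R real (Suc i) + x - x)"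
        proof (rule differentiable_bound[of UNIV f "\<lambda>x h. D x \<bullet> h"])
          fix z show "onorm (\<lambda>h. D z \<bullet> h) \<le> M"
          proof (rule onorm_le)
            fix h show "norm (D z \<bullet> h) \<le> M * norm h"
              using Cauchy_Schwarz_ineq2[of "D z" h] mult_right_mono[OF M(2)[of z] norm_ge_zero[of h]] by simp
          qed
        qed (auto intro: has_derivative_at_withinI der)
        then have "real (Suc i) * \<bar>f (v /\<^sub>R real (Suc i) + x) - f x\<bar> \<le> real (Suc i) * (M * (norm v / real (Suc i)))"
          by (intro mult_left_mono) (simp_all add: divide_inverse mult.commute)
        then show ?thesis using True by (simp add: s_def abs_mult del: of_nat_Suc)
      next
        case False
        then have "norm x > r + norm v" by simp
        moreover have "norm (v /\<^sub>R real (Suc i) + x) \<ge> norm x - norm (v /\<^sub>R real (Suc i))"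
          by (metis add.commute diff_minus_eq_add norm_minus_cancel norm_triangle_ineq2)
        ultimately have "x \<notin> K" "v /\<^sub>R real (Suc i) + x \<notin> K" using r(2) small
          by (smt (verit) norm_ge_zero)+
        then show ?thesis using False by (simp add: s_def K)
      qed
    qed
  qed (auto simp: s_def)
  then have "(\<lambda>n. 0) \<longlonglongrightarrow> (LBINT x. D x \<bullet> v)" by (simp add: s0)
  then show ?thesis using LIMSEQ_unique tendsto_const by blast
qed

section \<open>Mollification\<close>

lemma gradient_imp_continuous_on:
  "(\<And>x. x \<in> S \<Longrightarrow> has_gradient f (D x) x) \<Longrightarrow> continuous_on S f"
  by (intro continuous_at_imp_continuous_on ballI) (blast intro: has_derivative_continuous)

text \<open>The C^1 analogue of \<open>test_function\<close>. The gradient is an explicit argument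
  so that products and compositions carry their derivative formula along.\<close>

definition C1_compact_in :: "'a::euclidean_space set \<Rightarrow> 'a set \<Rightarrow> ('a \<Rightarrow> real) \<Rightarrow> ('a \<Rightarrow> 'a) \<Rightarrow> bool" where
  "C1_compact_in K S f D \<longleftrightarrow> compact K \<and> K \<subseteq> S \<and> (\<forall>x. x \<notin> K \<longrightarrow> f x = 0 \<and> D x = 0) \<and>
     (\<forall>x. has_gradient f (D x) x) \<and> continuous_on UNIV D"

definition C1_compact :: "'a::euclidean_space set \<Rightarrow> ('a \<Rightarrow> real) \<Rightarrow> ('a \<Rightarrow> 'a) \<Rightarrow> bool" where
  "C1_compact S f D \<longleftrightarrow> (\<exists>K. C1_compact_in K S f D)"

lemma C1_compact_inD:
  assumes "C1_compact_in K S f D"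
  shows "compact K" "K \<subseteq> S" "\<And>x. x \<notin> K \<Longrightarrow> f x = 0" "\<And>x. x \<notin> K \<Longrightarrow> D x = 0"
    "\<And>x. has_gradient f (D x) x" "continuous_on UNIV D" "continuous_on UNIV f"
  using assms gradient_imp_continuous_on[of UNIV f D] by (auto simp: C1_compact_in_def)

lemma C1_compact_outside: "C1_compact S f D \<Longrightarrow> x \<notin> S \<Longrightarrow> D x = 0 \<and> f x = 0"
  by (auto simp: C1_compact_def C1_compact_in_def)

text \<open>Regularity is only checked inside \<open>S\<close>: around a point outside
  \<open>S\<close> the function vanishes on the open complement of \<open>K\<close>.\<close>

lemma C1_compactI:
  assumes "open S" "compact K" "K \<subseteq> S" "\<And>x. x \<in> S \<Longrightarrow> has_gradient f (D x) x"
    "continuous_on S D" "\<And>x. x \<notin> K \<Longrightarrow> f x = 0" "\<And>x. x \<notin> K \<Longrightarrow> D x = 0"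
  shows "C1_compact S f D"
proof -
  have "has_gradient f (D x) x" for x
  proof (cases "x \<in> S")
    case False
    then have x: "x \<in> - K" using assms(3) by auto
    have "has_gradient (\<lambda>x. 0) (D x) x" using x assms(7)[of x] by simp
    then show ?thesis
      by (rule has_derivative_transform_within_open[of _ _ _ _ "- K"]) (use x assms in \<open>auto simp: compact_imp_closed open_Compl\<close>)
  qed (use assms in auto)
  moreover have "continuous_on UNIV D"
    by (rule continuous_on_zero_extend[OF assms(5,1) _ assms(3,7)]) (use assms(2) in \<open>auto simp: compact_imp_closed\<close>)
  ultimately show ?thesis unfolding C1_compact_def C1_compact_in_def using assms by blast
qed

lemma test_functionI:
  assumes "\<And>k. C_diff k f" "compact K" "K \<subseteq> S" "\<And>x. x \<notin> K \<Longrightarrow> f x = 0"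
  shows "test_function S f"
proof -
  have "closure {x. f x \<noteq> 0} \<subseteq> K"
    using assms by (intro closure_minimal) (auto simp: compact_imp_closed)
  moreover from this have "bounded {x. f x \<noteq> 0}"
    using bounded_subset[OF compact_imp_bounded[OF assms(2)]] closure_subset by blast
  ultimately show ?thesis unfolding test_function_def using assms(1,3) by (auto simp: compact_closure)
qed

lemma test_function_C1_compact:
  assumes "test_function S f"
  shows "C1_compact S f (gradient f)"
proof -
  have f: "C_diff (Suc 0) f" using assms by (simp add: test_function_def)
  define K where "K = closure {x. f x \<noteq> 0}"
  have K: "compact K" "K \<subseteq> S" "open (- K)"
    using assms by (auto simp: test_function_def K_def open_Compl)
  have 0: "f x = 0" if "x \<notin> K" for x using that unfolding K_def using subsetD[OF closure_subset, of x "{x. f x \<noteq> 0}"] by auto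
  have "gradient f x = 0" if "x \<notin> K" for x
  proof (rule gradient_eqI)
    have "has_gradient (\<lambda>x. 0) 0 x" by simp
    then show "has_gradient f 0 x"
      by (rule has_derivative_transform_within_open[OF _ K(3)]) (use that in \<open>simp_all add: 0\<close>)
  qed
  then show ?thesis unfolding C1_compact_def C1_compact_in_def
    using C_diff_gradient(1)[OF f] C_diff_gradient_continuous[OF f] 0 K(1,2) by blast
qed

text \<open>The compact support of \<open>g\<close> cuts off \<open>f\<close>, which may behave
  badly towards the boundary of \<open>S\<close>. Negative powers of a function vanishing on the
  boundary are the intended case.\<close>

lemma C1_compact_mult:
  assumes "open S" "\<And>x. x \<in> S \<Longrightarrow> has_gradient f (D x) x" "continuous_on S D"
    and "C1_compact S g E"
  shows "C1_compact S (\<lambda>x. f x * g x) (\<lambda>x. g x *\<^sub>R D x + f x *\<^sub>R E x)"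
proof -
  obtain K where "C1_compact_in K S g E" using assms(4) unfolding C1_compact_def by blast
  note K = C1_compact_inD[OF this]
  have cf: "continuous_on S f"
    using assms(2) by (rule gradient_imp_continuous_on)
  show ?thesis
  proof (rule C1_compactI[OF assms(1) K(1,2)])
    fix x assume x: "x \<in> S"
    show "has_gradient (\<lambda>x. f x * g x) (g x *\<^sub>R D x + f x *\<^sub>R E x) x"
      using has_derivative_mult[OF assms(2)[OF x] K(5)] by (simp add: inner_add_left algebra_simps)
  next
    show "continuous_on S (\<lambda>x. g x *\<^sub>R D x + f x *\<^sub>R E x)"
      by (intro continuous_intros cf assms(3) continuous_on_subset[OF K(6)] continuous_on_subset[OF K(7)]) auto
  qed (use K in auto)
qed

lemma C1_compact_integrable:
  assumes "open S" "continuous_on S F" "C1_compact S g E"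
  shows "integrable lborel (\<lambda>x. F x * g x)" "integrable lborel (\<lambda>x. F x * (E x \<bullet> v))"
proof -
  obtain K where "C1_compact_in K S g E" using assms(3) unfolding C1_compact_def by blast
  note K = C1_compact_inD[OF this]
  have K': "closed K" "bounded K" using K(1) by (auto simp: compact_imp_closed compact_imp_bounded)
  have "continuous_on S (\<lambda>x. F x * g x)" "continuous_on S (\<lambda>x. F x * (E x \<bullet> v))"
    by (intro continuous_intros assms(2) continuous_on_subset[OF K(6)] continuous_on_subset[OF K(7)]; simp)+
  note c = this
  have c': "continuous_on UNIV (\<lambda>x. F x * g x)" "continuous_on UNIV (\<lambda>x. F x * (E x \<bullet> v))"
    by (rule continuous_on_zero_extend[OF c(1) assms(1) K'(1) K(2)], simp add: K,
        rule continuous_on_zero_extend[OF c(2) assms(1) K'(1) K(2)], simp add: K)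
  show "integrable lborel (\<lambda>x. F x * g x)" "integrable lborel (\<lambda>x. F x * (E x \<bullet> v))"
    by (rule integrable_compact_support(1)[OF c'(1) K'(2)], simp add: K,
        rule integrable_compact_support(1)[OF c'(2) K'(2)], simp add: K)
qed

lemma integration_by_parts:
  assumes "open S" "\<And>x. x \<in> S \<Longrightarrow> has_gradient f (D x) x" "continuous_on S D"
    and g: "C1_compact S g E"
  shows "(LBINT x. f x * (E x \<bullet> v)) = - (LBINT x. (D x \<bullet> v) * g x)"
proof -
  have mult: "C1_compact S (\<lambda>x. f x * g x) (\<lambda>x. g x *\<^sub>R D x + f x *\<^sub>R E x)"
    by (rule C1_compact_mult[OF assms(1) _ assms(3) g]) (rule assms(2))
  obtain K where "C1_compact_in K S (\<lambda>x. f x * g x) (\<lambda>x. g x *\<^sub>R D x + f x *\<^sub>R E x)" using mult unfolding C1_compact_def by blast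
  note K = C1_compact_inD[OF this]
  have cf: "continuous_on S f"
    using assms(2) by (rule gradient_imp_continuous_on)
  have "(LBINT x. (D x \<bullet> v) * g x + f x * (E x \<bullet> v)) = 0"
    using integral_gradient_zero[OF K(5,6) compact_imp_bounded[OF K(1)] K(3,4), of v]
    by (simp add: inner_add_left algebra_simps)
  then show ?thesis
    using C1_compact_integrable(1)[OF assms(1) _ g, of "\<lambda>x. D x \<bullet> v"] C1_compact_integrable(2)[OF assms(1) cf g, of v] assms(3)
    by (simp add: Bochner_Integration.integral_add continuous_on_inner continuous_on_const)
qed

text \<open>The derivative falls on the kernel, so no regularity of \<open>f\<close> beyond
  continuity enters. Integrating over a box brings the Leibniz rule for parameter integrals into
  play.\<close>

lemma has_derivative_convolution:
  assumes "continuous_on UNIV f" "C_diff (Suc 0) \<rho>"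
  shows "((\<lambda>x. integral (cbox a c) (\<lambda>t. f t * \<rho> (x - t))) has_derivative
      (\<lambda>h. integral (cbox a c) (\<lambda>t. f t * (gradient \<rho> (x - t) \<bullet> h)))) (at x)"
proof -
  note cont = C_diff_gradient_continuous[OF assms(2)] C_diff_continuous[OF assms(2)]
  define F where "F x t = f t *\<^sub>R blinfun_inner_right (gradient \<rho> (x - t))" for x t
  have F: "blinfun_apply (F x t) h = f t * (gradient \<rho> (x - t) \<bullet> h)" for x t h
    by (simp add: F_def scaleR_blinfun.rep_eq)
  have cF: "continuous_on UNIV (\<lambda>(x, t). F x t)"
    unfolding F_def case_prod_beta
    by (intro continuous_intros bounded_linear.continuous_on[OF bounded_linear_blinfun_inner_right]
        continuous_on_compose2[OF assms(1)] continuous_on_compose2[OF cont(1)]) auto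
  have "((\<lambda>x. integral (cbox a c) (\<lambda>t. f t * \<rho> (x - t))) has_derivative
      blinfun_apply (integral (cbox a c) (F x))) (at x within UNIV)"
  proof (rule leibniz_rule)
    fix x t
    have "((\<lambda>x. f t * \<rho> (x - t)) has_derivative (\<lambda>h. f t * (gradient \<rho> (x - t) \<bullet> h))) (at x)"
      by (rule has_derivative_mult_right,
          rule has_derivative_compose[of "\<lambda>x. x - t" "\<lambda>h. h" x UNIV \<rho>, simplified])
         (auto intro!: derivative_eq_intros C_diff_gradient(1)[OF assms(2)])
    then show "((\<lambda>x. f t * \<rho> (x - t)) has_derivative blinfun_apply (F x t)) (at x within UNIV)"
      by (simp add: F[abs_def])
  next
    show "(\<lambda>t. f t * \<rho> (x - t)) integrable_on cbox a c" for x
      by (intro integrable_continuous continuous_intros continuous_on_compose2[OF assms(1)]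
          continuous_on_compose2[OF cont(2)]) auto
  qed (auto intro: continuous_on_subset[OF cF])
  moreover have "blinfun_apply (integral (cbox a c) (F x)) h = integral (cbox a c) (\<lambda>t. f t * (gradient \<rho> (x - t) \<bullet> h))" for h
  proof -
    have "F x integrable_on cbox a c"
      by (intro integrable_continuous continuous_on_compose2[OF cF, of _ "\<lambda>t. (x, t)", simplified]) (auto intro!: continuous_intros)
    then show ?thesis by (simp add: blinfun_apply_integral F)
  qed
  ultimately show ?thesis by (metis (no_types, lifting) ext has_derivative_eq_rhs)
qed

lemma C_diff_convolution:
  assumes "continuous_on UNIV f" "\<And>k. C_diff k \<rho>"
  shows "C_diff k (\<lambda>x. integral (cbox a c) (\<lambda>t. f t * \<rho> (x - t)))"
  using assms(2)
proof (induction k arbitrary: \<rho>)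
  case 0
  have "continuous_on UNIV (\<lambda>x. integral (cbox a c) (\<lambda>t. f t * \<rho> (x - t)))"
    by (intro has_derivative_continuous_on[OF has_derivative_at_withinI[OF has_derivative_convolution[OF assms(1) 0]]])
  then show ?case by simp
next
  case (Suc k)
  show ?case
    by (rule C_diff_SucI[OF has_derivative_convolution[OF assms(1) Suc.prems]],
        rule Suc.IH, rule C_diff_gradient(2), rule Suc.prems)
qed

section \<open>Uniform approximation by mollification\<close>

lemma integral_lborel_minus:
  fixes F :: "'a::euclidean_space \<Rightarrow> 'b::euclidean_space"
  assumes [measurable]: "F \<in> borel_measurable borel"
  shows "(LBINT t. F (x - t)) = (LBINT t. F t)"
    and "integrable lborel F \<Longrightarrow> integrable lborel (\<lambda>t. F (x - t))"
proof -
  have d: "distr lborel borel (\<lambda>t. x - t) = lborel"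
    using lborel_affine[of "-1" x] by (simp add: density_1)
  show "(LBINT t. F (x - t)) = (LBINT t. F t)"
    using integral_distr[of "\<lambda>t. x - t" lborel borel F] by (simp add: d)
  show "integrable lborel F \<Longrightarrow> integrable lborel (\<lambda>t. F (x - t))"
    using integrable_distr[of "\<lambda>t. x - t" lborel borel F] by (simp add: d)
qed

text \<open>The mollified value is an average, with respect to a probability density, of values
  \<open>F t\<close> at points closer than \<open>d\<close> to \<open>x\<close>. Vector values are
  allowed so that it applies to a function and to its gradient.\<close>

lemma mollify_close:
  fixes F :: "'a::euclidean_space \<Rightarrow> 'b::euclidean_space"
  assumes \<rho>: "continuous_on UNIV \<rho>" "\<And>x. norm x \<ge> d \<Longrightarrow> \<rho> x = 0" "\<And>x. \<rho> x \<ge> 0" "(LBINT x. \<rho> x) = (1::real)"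
    and F: "continuous_on UNIV F" "\<And>t x. norm (t - x) < d \<Longrightarrow> norm (F t - F x) \<le> e"
  shows "norm ((LBINT t. \<rho> (x - t) *\<^sub>R F t) - F x) \<le> e"
proof -
  have \<rho>0: "\<rho> x = 0" if "x \<notin> cball 0 d" for x using that \<rho>(2) by auto
  note \<rho>i = integrable_compact_support[OF \<rho>(1) bounded_cball[of "0::'a" d] \<rho>0]
  have one: "(LBINT t. \<rho> (x - t)) = 1" and int1: "integrable lborel (\<lambda>t. \<rho> (x - t))"
    using integral_lborel_minus[OF \<rho>i(2), of x] \<rho>i \<rho>(4) by auto
  have "continuous_on UNIV (\<lambda>t. \<rho> (x - t))"
    by (intro continuous_on_compose2[OF \<rho>(1)] continuous_intros) auto
  then have "continuous_on UNIV (\<lambda>t. \<rho> (x - t) *\<^sub>R F t)"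
    by (intro continuous_intros F(1))
  then have int2: "integrable lborel (\<lambda>t. \<rho> (x - t) *\<^sub>R F t)"
    by (rule integrable_compact_support(1)[where K = "cball x d"]) (auto simp: dist_norm \<rho>(2))
  have "(LBINT t. \<rho> (x - t) *\<^sub>R F t) - F x = (LBINT t. \<rho> (x - t) *\<^sub>R F t) - (LBINT t. \<rho> (x - t) *\<^sub>R F x)"
    using one int1 by simp
  also have "\<dots> = (LBINT t. \<rho> (x - t) *\<^sub>R (F t - F x))"
    using int1 int2 by (simp add: scaleR_diff_right)
  also have "norm \<dots> \<le> (LBINT t. e * \<rho> (x - t))"
  proof (rule Bochner_Integration.integral_norm_bound_integral)
    show "integrable lborel (\<lambda>t. \<rho> (x - t) *\<^sub>R (F t - F x))"
      using int1 int2 by (simp add: scaleR_diff_right)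
    show "integrable lborel (\<lambda>t. e * \<rho> (x - t))" using int1 by simp
    fix t
    show "norm (\<rho> (x - t) *\<^sub>R (F t - F x)) \<le> e * \<rho> (x - t)"
    proof (cases "norm (t - x) < d")
      case True
      then show ?thesis using F(2)[OF True] \<rho>(3)[of "x - t"] by (simp add: mult.commute[of e] mult_left_mono)
    next
      case False
      then show ?thesis using \<rho>(2)[of "x - t"] by (simp add: norm_minus_commute)
    qed
  qed
  also have "\<dots> = e" using one by simp
  finally show ?thesis .
qed

lemma uniformly_continuous_csupport:
  fixes F :: "'a::euclidean_space \<Rightarrow> 'b::euclidean_space"
  assumes "continuous_on UNIV F" "bounded K" "\<And>x. x \<notin> K \<Longrightarrow> F x = 0" "e > 0"
  obtains d where "d > 0" "\<And>t x. norm (t - x) < d \<Longrightarrow> norm (F t - F x) \<le> e"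
proof -
  obtain r where r: "\<And>x. x \<in> K \<Longrightarrow> norm x \<le> r" using assms(2) by (auto simp: bounded_pos)
  have "uniformly_continuous_on (cball 0 (r + 1)) F"
    by (intro compact_uniformly_continuous continuous_on_subset[OF assms(1)]) auto
  then obtain d where d: "d > 0"
    "\<And>x t. x \<in> cball 0 (r + 1) \<Longrightarrow> t \<in> cball 0 (r + 1) \<Longrightarrow> dist t x < d \<Longrightarrow> dist (F t) (F x) < e"
    using assms(4) unfolding uniformly_continuous_on_def by metis
  show ?thesis
  proof (rule that[of "min d 1"])
    fix t x :: 'a assume *: "norm (t - x) < min d 1"
    show "norm (F t - F x) \<le> e"
    proof (cases "x \<in> cball 0 (r + 1) \<and> t \<in> cball 0 (r + 1)")
      case True
      then show ?thesis using d(2)[of x t] * by (auto simp: dist_norm)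
    next
      case False
      \<comment> \<open>The two points are less than 1 apart, so if one of them leaves the ball of
        radius \<open>r + 1\<close>, neither lies in \<open>K\<close>.\<close>
      have "norm t \<le> norm x + norm (t - x)" "norm x \<le> norm t + norm (t - x)"
        using norm_triangle_sub[of t x] norm_triangle_sub[of x t] by (auto simp: norm_minus_commute)
      then have "t \<notin> K" "x \<notin> K" using False * r[of t] r[of x] by auto
      then show ?thesis using assms(3,4) by simp
    qed
  qed (use d in auto)
qed

text \<open>One compact set \<open>K\<close> contains the supports of \<open>f\<close> and of all
  approximants. This is what lets uniform closeness pass through integrals whose weights are only
  continuous in \<open>S\<close>.\<close>

lemma C1_compact_approx:
  assumes "open S" "C1_compact S f D"
  obtains K where "compact K" "K \<subseteq> S" "\<And>x. x \<notin> K \<Longrightarrow> f x = 0 \<and> D x = 0"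
    "\<And>e. e > 0 \<Longrightarrow> \<exists>\<phi>. test_function S \<phi> \<and> (\<forall>x. x \<notin> K \<longrightarrow> \<phi> x = 0 \<and> gradient \<phi> x = 0) \<and>
       (\<forall>x. \<bar>\<phi> x - f x\<bar> \<le> e \<and> norm (gradient \<phi> x - D x) \<le> e)"
proof -
  obtain K0 where "C1_compact_in K0 S f D" using assms(2) unfolding C1_compact_def by blast
  note K0 = C1_compact_inD[OF this]
  note der = K0(5) and cont = K0(6,7)
  have bd: "bounded K0" using K0(1) by (rule compact_imp_bounded)
  obtain d where d: "d > 0" "(\<Union>x\<in>K0. cball x d) \<subseteq> S"
    using compact_subset_open_imp_cball_epsilon_subset[OF K0(1) assms(1) K0(2)] by blast
  \<comment> \<open>The closed \<open>d\<close>-neighbourhood of the support; a kernel of radius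
    \<open>\<delta> \<le> d\<close> does not spread mass beyond it.\<close>
  define K where "K = {x + y | x y. x \<in> K0 \<and> y \<in> cball 0 d}"
  obtain a where a: "K0 \<subseteq> cbox (-a) a" using bounded_subset_cbox_symmetric[OF bd] by blast
  have K: "compact K" unfolding K_def by (intro compact_sums K0 compact_cball)
  have K0K: "K0 \<subseteq> K" unfolding K_def using d(1) by force
  have Kin: "x \<in> K" if "t \<in> K0" "norm (x - t) \<le> d" for x t
    unfolding K_def using that by (intro CollectI exI[of _ t] exI[of _ "x - t"]) auto
  have KO: "K \<subseteq> S" unfolding K_def using d(2) by (force simp: dist_norm)
  show ?thesis
  proof (rule that[OF K KO])
    show "x \<notin> K \<Longrightarrow> f x = 0 \<and> D x = 0" for x using K0(3,4)[of x] K0K by auto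
    fix e :: real assume e: "e > 0"
    obtain d1 where d1: "d1 > 0" "\<And>t x. norm (t - x) < d1 \<Longrightarrow> norm (f t - f x) \<le> e"
      using uniformly_continuous_csupport[OF cont(2) bd K0(3) e] by blast
    obtain d2 where d2: "d2 > 0" "\<And>t x. norm (t - x) < d2 \<Longrightarrow> norm (D t - D x) \<le> e"
      using uniformly_continuous_csupport[OF cont(1) bd K0(4) e] by blast
    define \<delta> where "\<delta> = min d (min d1 d2)"
    have \<delta>: "\<delta> > 0" "\<delta> \<le> d" "\<delta> \<le> d1" "\<delta> \<le> d2" using d d1 d2 by (auto simp: \<delta>_def)
    obtain l r where lr: "0 \<in> box l r" "box l r \<subseteq> ball (0::'a) \<delta>" using rational_boxes[OF \<delta>(1), of 0] by metis
    obtain T :: "'a \<Rightarrow> real" where T: "\<And>k. C_diff k T" "\<And>x. x \<in> box l r \<Longrightarrow> T x > 0"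
      "\<And>x. x \<notin> box l r \<Longrightarrow> T x = 0" "\<And>x. T x \<ge> 0"
      using box_bump_exists[of l r] by blast
    have T0: "T x = 0" if "x \<notin> ball 0 \<delta>" for x using that T(3)[of x] lr(2) by blast
    note Ti = integrable_compact_support[OF C_diff_continuous[OF T(1)] bounded_ball[of "0::'a" \<delta>] T0]
    have "(LBINT x. T x) \<noteq> 0"
    proof
      assume "(LBINT x. T x) = 0"
      then have "AE x in lborel. T x = 0"
        using integral_nonneg_eq_0_iff_AE[OF Ti(1)] T(4) by auto
      then have "AE x in lborel. x \<notin> box l r"
        by (rule AE_mp) (use T(2) in \<open>auto intro!: AE_I2 simp: less_le\<close>)
      then have "box l r \<in> null_sets lborel" by (simp add: AE_iff_null_sets)
      then have "negligible (box l r)" by (simp add: negligible_iff_null_sets null_sets_completionI)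
      then show False using open_not_negligible[OF open_box] lr(1) by blast
    qed
    moreover have "(LBINT x. T x) \<ge> 0" using T(4) by (intro integral_nonneg_AE) auto
    ultimately have c: "(LBINT x. T x) > 0" by simp
    define \<rho> where "\<rho> = (\<lambda>x. inverse (LBINT x. T x) * T x)"
    have \<rho>: "C_diff k \<rho>" for k unfolding \<rho>_def by (intro C_diff_mult C_diff_const T)
    have \<rho>0: "norm x \<ge> \<delta> \<Longrightarrow> \<rho> x = 0" "\<rho> x \<ge> 0" for x using T0[of x] T(4)[of x] c by (auto simp: \<rho>_def)
    have \<rho>1: "(LBINT x. \<rho> x) = 1" using c by (simp add: \<rho>_def)
    have c\<rho>: "continuous_on UNIV \<rho>" by (rule C_diff_continuous[OF \<rho>])
    \<comment> \<open>Taken over a box containing the support of \<open>f\<close>, the form in which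
      convolutions were differentiated; \<open>HK\<close> identifies such integrals with Lebesgue
      integrals over the whole space.\<close>
    define \<phi> where "\<phi> x = integral (cbox (-a) a) (\<lambda>t. f t * \<rho> (x - t))" for x
    have HK: "integral (cbox (-a) a) (\<lambda>t. f t * g t) = (LBINT t. f t * g t)" if "continuous_on UNIV g" for g :: "'a \<Rightarrow> real"
    proof -
      have "integrable lborel (\<lambda>t. f t * g t)"
        by (rule integrable_compact_support(1)[OF _ bd]) (auto intro!: continuous_intros cont that simp: K0)
      then have "((\<lambda>t. f t * g t) has_integral (LBINT t. f t * g t)) UNIV"
        by (rule has_integral_integral_lborel)
      moreover have eq: "(\<lambda>t. if t \<in> cbox (-a) a then f t * g t else 0) = (\<lambda>t. f t * g t)"
        using K0(3) a by (auto simp: fun_eq_iff)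
      ultimately have "((\<lambda>t. f t * g t) has_integral (LBINT t. f t * g t)) (cbox (-a) a)"
        by (subst has_integral_restrict_UNIV[symmetric], subst eq)
      then show ?thesis by (rule integral_unique)
    qed
    have c\<rho>x: "continuous_on UNIV (\<lambda>t. \<rho> (x - t))" for x
      by (intro continuous_on_compose2[OF c\<rho>] continuous_intros) auto
    have cD\<rho>: "continuous_on UNIV (gradient \<rho>)" by (rule C_diff_gradient_continuous[OF \<rho>])
    have \<phi>eq: "\<phi> x = (LBINT t. \<rho> (x - t) *\<^sub>R f t)" for x
      using HK[OF c\<rho>x[of x]] by (simp add: \<phi>_def mult.commute)
    have \<phi>C: "C_diff k \<phi>" for k unfolding \<phi>_def by (rule C_diff_convolution[OF cont(2) \<rho>])
    have grad: "gradient \<phi> x = (LBINT t. \<rho> (x - t) *\<^sub>R D t)" for x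
    proof (rule gradient_eqI)
      have "integral (cbox (-a) a) (\<lambda>t. f t * (gradient \<rho> (x - t) \<bullet> h)) = (LBINT t. \<rho> (x - t) *\<^sub>R D t) \<bullet> h" for h
      proof -
        \<comment> \<open>Moves the derivative from the kernel to \<open>f\<close>: the gradient of
          the mollification is the mollification of \<open>D\<close>.\<close>
        have ibp: "(LBINT t. \<rho> (x - t) * (D t \<bullet> h)) = - (LBINT t. (- gradient \<rho> (x - t) \<bullet> h) * f t)"
        proof (rule integration_by_parts[of UNIV])
          show "has_gradient (\<lambda>t. \<rho> (x - t)) (- gradient \<rho> (x - t)) t" for t
            by (rule has_derivative_eq_rhs[OF has_derivative_compose[OF _ C_diff_gradient(1)[OF \<rho>], of _ "\<lambda>h. -h"]])
               (auto intro!: derivative_eq_intros)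
          show "continuous_on UNIV (\<lambda>t. - gradient \<rho> (x - t))"
            by (intro continuous_intros continuous_on_compose2[OF cD\<rho>]) auto
          show "C1_compact UNIV f D"
            by (rule C1_compactI[OF _ K0(1) _ der cont(1) K0(3,4)]) auto
        qed simp
        have "integrable lborel (\<lambda>t. \<rho> (x - t) *\<^sub>R D t)"
          by (rule integrable_compact_support(1)[OF _ bd]) (auto intro!: continuous_intros cont c\<rho>x simp: K0)
        then have "(LBINT t. \<rho> (x - t) *\<^sub>R D t) \<bullet> h = (LBINT t. \<rho> (x - t) * (D t \<bullet> h))"
          by (subst integral_inner_left[symmetric]) auto
        also have "\<dots> = (LBINT t. f t * (gradient \<rho> (x - t) \<bullet> h))"
          unfolding ibp by (simp add: mult.commute)
        also have "\<dots> = integral (cbox (-a) a) (\<lambda>t. f t * (gradient \<rho> (x - t) \<bullet> h))"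
          by (rule HK[symmetric]) (intro continuous_intros continuous_on_compose2[OF cD\<rho>]; auto)
        finally show ?thesis by simp
      qed
      then show "has_gradient \<phi> (LBINT t. \<rho> (x - t) *\<^sub>R D t) x"
        using has_derivative_convolution[OF cont(2) \<rho>, of "-a" a x] by (simp add: \<phi>_def[abs_def])
    qed
    have out: "\<rho> (x - t) = 0" if "x \<notin> K" "t \<in> K0" for x t
      using Kin[of t x] that \<delta> by (intro \<rho>0(1)) force
    have z1: "\<phi> x = 0" if "x \<notin> K" for x
    proof -
      have "(\<lambda>t. \<rho> (x - t) *\<^sub>R f t) = (\<lambda>t. 0)" using out[OF that] K0(3) by (auto simp: fun_eq_iff)
      then show ?thesis unfolding \<phi>eq by simp
    qed
    have z2: "gradient \<phi> x = 0" if "x \<notin> K" for x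
    proof -
      have "(\<lambda>t. \<rho> (x - t) *\<^sub>R D t) = (\<lambda>t. 0)" using out[OF that] K0(4) by (auto simp: fun_eq_iff)
      then show ?thesis unfolding grad by simp
    qed
    have "norm (f t - f x) \<le> e" "norm (D t - D x) \<le> e" if "norm (t - x) < \<delta>" for t x
      using that d1(2)[of t x] d2(2)[of t x] \<delta> by auto
    then have "\<bar>\<phi> x - f x\<bar> \<le> e" "norm (gradient \<phi> x - D x) \<le> e" for x
      using mollify_close[OF c\<rho> \<rho>0 \<rho>1 cont(2), where e = e and x = x]
        mollify_close[OF c\<rho> \<rho>0 \<rho>1 cont(1), where e = e and x = x]
      unfolding \<phi>eq grad real_norm_def by simp_all
    then show "\<exists>\<phi>. test_function S \<phi> \<and> (\<forall>x. x \<notin> K \<longrightarrow> \<phi> x = 0 \<and> gradient \<phi> x = 0) \<and>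
       (\<forall>x. \<bar>\<phi> x - f x\<bar> \<le> e \<and> norm (gradient \<phi> x - D x) \<le> e)"
      using z1 z2 test_functionI[OF \<phi>C K KO z1] by (intro exI[of _ \<phi>]) auto
  qed
qed

section \<open>The energy functional\<close>

text \<open>The nonlinearity of the p-Laplacian, which is the gradient of |a|^p divided by p when p
  > 1. On the real line it is the odd extension of t^(p-1).\<close>

definition flux :: "real \<Rightarrow> 'a::euclidean_space \<Rightarrow> 'a" where
  "flux p a = norm a powr (p - 2) *\<^sub>R a"

lemma flux_zero [simp]: "flux p 0 = 0"
  by (simp add: flux_def)

lemma norm_flux: "norm (flux p a) = norm a powr (p - 1)"
proof (cases "a = 0")
  case False
  then show ?thesis using powr_add[of "norm a" "p - 2" 1] by (simp add: flux_def)
qed simp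

lemma flux_pos: "0 < (t::real) \<Longrightarrow> flux p t = t powr (p - 1)"
  using powr_add[of t "p - 2" 1] by (simp add: flux_def)

lemma flux_scaleR: "flux p (c *\<^sub>R a) = flux p c *\<^sub>R flux p a"
  by (simp add: flux_def powr_mult mult.commute mult.left_commute)

lemma inner_flux_self: "flux p a \<bullet> a = norm a powr p"
proof (cases "a = 0")
  case False
  then show ?thesis using powr_add[of "norm a" "p - 2" 2]
    by (simp add: flux_def power2_norm_eq_inner powr_numeral)
qed simp

lemma powr_norm_tendsto_0: "0 < q \<Longrightarrow> ((\<lambda>x. norm x powr q) \<longlongrightarrow> 0) (at (0::'a::euclidean_space))"
  by (rule tendsto_zero_powrI[OF tendsto_norm_zero[OF tendsto_ident_at] tendsto_const]) auto

lemma continuous_flux: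
  assumes "1 < p" shows "continuous_on UNIV (flux p :: 'a::euclidean_space \<Rightarrow> 'a)"
proof (rule continuous_at_imp_continuous_on, rule ballI)
  fix a :: 'a
  show "isCont (flux p) a"
  proof (cases "a = 0")
    case True
    have "((\<lambda>x. norm (flux p x)) \<longlongrightarrow> 0) (at (0::'a))"
      unfolding norm_flux using powr_norm_tendsto_0[of "p - 1"] assms by simp
    then show ?thesis using True by (simp add: isCont_def tendsto_norm_zero_iff)
  next
    case False
    then show ?thesis unfolding flux_def[abs_def] by (intro continuous_intros) auto
  qed
qed

lemma has_derivative_norm_powr:
  assumes "1 < p"
  shows "((\<lambda>x. norm x powr p) has_derivative (\<lambda>h. p * (flux p a \<bullet> h))) (at (a::'a::euclidean_space))"
proof (cases "a = 0")
  case True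
  have "((\<lambda>y. norm y powr p / norm y) \<longlongrightarrow> 0) (at (0::'a))"
    by (rule Lim_transform_eventually[OF powr_norm_tendsto_0[of "p - 1"]])
       (use assms in \<open>auto simp: eventually_at_filter powr_diff\<close>)
  then show ?thesis unfolding True has_derivative_iff_norm by simp
next
  case False
  have "((\<lambda>x. norm x powr p) has_derivative (\<lambda>h. (sgn a \<bullet> h) * (p * norm a powr (p - 1)))) (at a)"
    using False
    by (intro has_derivative_eq_rhs[OF has_derivative_compose[OF has_derivative_norm[OF False]
        has_real_derivative_powr[of "norm a" p, unfolded has_field_derivative_def]]]) (auto simp: mult.commute inner_commute)
  moreover have "(sgn a \<bullet> h) * (p * norm a powr (p - 1)) = p * (flux p a \<bullet> h)" for h
    using False powr_add[of "norm a" "p - 2" 1] by (simp add: flux_def sgn_div_norm field_simps)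
  ultimately show ?thesis by simp
qed

lemma powr_add_le:
  fixes a b :: "'a::real_normed_vector"
  assumes "0 < p"
  shows "norm (a + b) powr p \<le> 2 powr p * (norm a powr p + norm b powr p)"
proof -
  have "norm (a + b) powr p \<le> (2 * max (norm a) (norm b)) powr p"
    using norm_triangle_ineq[of a b] assms by (intro powr_mono2) auto
  also have "\<dots> = 2 powr p * (max (norm a) (norm b)) powr p"
    by (simp add: powr_mult le_max_iff_disj)
  also have "\<dots> \<le> 2 powr p * (norm a powr p + norm b powr p)"
    by (intro mult_left_mono) (auto simp: max_def)
  finally show ?thesis .
qed

text \<open>Mean value inequality on the ball of radius \<open>norm a + norm b\<close>, which
  contains \<open>a\<close> and \<open>a + b\<close>.\<close>

lemma norm_powr_diff_le:
  fixes a b :: "'a::euclidean_space"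
  assumes "1 < p"
  shows "\<bar>norm (a + b) powr p - norm a powr p\<bar> \<le> p * (norm a + norm b) powr (p - 1) * norm b"
proof -
  have "norm (norm (a + b) powr p - norm a powr p) \<le> p * (norm a + norm b) powr (p - 1) * norm (a + b - a)"
  proof (rule differentiable_bound[of "cball 0 (norm a + norm b)" _ "\<lambda>x h. p * (flux p x \<bullet> h)"])
    fix x :: 'a assume x: "x \<in> cball 0 (norm a + norm b)"
    show "((\<lambda>x. norm x powr p) has_derivative (\<lambda>h. p * (flux p x \<bullet> h))) (at x within cball 0 (norm a + norm b))"
      using has_derivative_norm_powr[OF assms] has_derivative_at_withinI by blast
    show "onorm (\<lambda>h. p * (flux p x \<bullet> h)) \<le> p * (norm a + norm b) powr (p - 1)"
    proof (rule onorm_le)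
      fix h
      have "\<bar>flux p x \<bullet> h\<bar> \<le> norm x powr (p - 1) * norm h"
        using Cauchy_Schwarz_ineq2[of "flux p x" h] by (simp add: norm_flux)
      also have "\<dots> \<le> (norm a + norm b) powr (p - 1) * norm h"
        using x assms by (intro mult_right_mono powr_mono2) auto
      finally show "norm (p * (flux p x \<bullet> h)) \<le> p * (norm a + norm b) powr (p - 1) * norm h"
        using assms by (simp add: abs_mult mult.assoc)
    qed
  qed (auto intro: norm_triangle_ineq)
  then show ?thesis by simp
qed

lemma powr_le_one_add:
  assumes "0 \<le> (x::real)" "0 \<le> q" "q \<le> p" shows "x powr q \<le> 1 + x powr p"
proof (cases "x \<le> 1")
  case True
  have "x powr q \<le> 1" using True assms powr_mono2[of q x 1] by simp
  then show ?thesis using powr_ge_zero[of x p] by linarith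
next
  case False
  then show ?thesis using powr_mono[of q p x] assms by (simp add: add_increasing)
qed

section \<open>Integrability in L^p over sets of finite measure\<close>

lemma measurable_lebesgue_on:
  "f \<in> borel_measurable borel \<Longrightarrow> f \<in> borel_measurable (lebesgue_on S)"
  by (simp add: measurable_completion measurable_restrict_space1)

lemma integral_lebesgue_on_eq_lborel:
  fixes f :: "'a::euclidean_space \<Rightarrow> 'b::euclidean_space"
  assumes "f \<in> borel_measurable borel" "S \<in> sets lebesgue" "\<And>x. x \<notin> S \<Longrightarrow> f x = 0"
  shows "(LINT x|lebesgue_on S. f x) = (LBINT x. f x)"
    and "integrable lborel f \<Longrightarrow> integrable (lebesgue_on S) f"
proof -
  have eq: "(\<lambda>x. if x \<in> S then f x else 0) = f" using assms(3) by (auto simp: fun_eq_iff)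
  show "(LINT x|lebesgue_on S. f x) = (LBINT x. f x)"
    using Lebesgue_Measure.integral_restrict_UNIV[OF assms(2), of f] assms(1) by (simp add: eq integral_completion)
  show "integrable lborel f \<Longrightarrow> integrable (lebesgue_on S) f"
    using Lebesgue_Measure.integrable_restrict_UNIV[OF assms(2), of f] assms(1) by (simp add: eq integrable_completion)
qed

lemma in_Lp_integrable:
  assumes "in_Lp p S f" "1 < p" "finite_measure (lebesgue_on S)"
  shows "integrable (lebesgue_on S) f"
proof -
  interpret finite_measure "lebesgue_on S" by (rule assms(3))
  show ?thesis
  proof (rule Bochner_Integration.integrable_bound[of _ "\<lambda>x. 1 + norm (f x) powr p"])
    show "integrable (lebesgue_on S) (\<lambda>x. 1 + norm (f x) powr p)"
      using assms(1) by (intro Bochner_Integration.integrable_add integrable_const) (simp add: in_Lp_def)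
    show "AE x in lebesgue_on S. norm (f x) \<le> norm (1 + norm (f x) powr p)"
      using powr_le_one_add[of "norm (f x)" 1 p for x] assms(2) by (intro AE_I2) force
  qed (use assms(1) in \<open>simp add: in_Lp_def\<close>)
qed

lemma in_Lp_bounded:
  assumes "f \<in> borel_measurable (lebesgue_on S)" "finite_measure (lebesgue_on S)" "\<And>x. norm (f x) \<le> M" "0 < p"
  shows "in_Lp p S f"
proof -
  interpret finite_measure "lebesgue_on S" by (rule assms(2))
  have "integrable (lebesgue_on S) (\<lambda>x. norm (f x) powr p)"
    using assms by (intro integrable_const_bound[where B = "M powr p"]) (auto intro!: powr_mono2)
  then show ?thesis using assms(1) by (simp add: in_Lp_def)
qed

lemma integrable_mult_bounded:
  fixes f g :: "'a \<Rightarrow> real"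
  assumes "integrable M f" "g \<in> borel_measurable M" "\<And>x. norm (g x) \<le> B"
  shows "integrable M (\<lambda>x. f x * g x)"
proof (rule Bochner_Integration.integrable_bound[of _ "\<lambda>x. B * f x"])
  have "norm (f x * g x) \<le> norm (B * f x)" for x
    using mult_left_mono[OF assms(3)[of x], of "norm (f x)"] assms(3)[of x] by (simp add: abs_mult mult.commute)
  then show "AE x in M. norm (f x * g x) \<le> norm (B * f x)" by simp
qed (use assms in auto)

lemma in_Lp_add:
  assumes "in_Lp p S f" "in_Lp p S g" "0 < p"
  shows "in_Lp p S (\<lambda>x. f x + g x)"
proof -
  have [measurable]: "f \<in> borel_measurable (lebesgue_on S)" "g \<in> borel_measurable (lebesgue_on S)"
    using assms by (auto simp: in_Lp_def)
  have "integrable (lebesgue_on S) (\<lambda>x. norm (f x + g x) powr p)"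
    by (rule Bochner_Integration.integrable_bound[of _ "\<lambda>x. 2 powr p * (norm (f x) powr p + norm (g x) powr p)"])
       (use assms powr_add_le[OF assms(3)] in \<open>auto simp: in_Lp_def\<close>)
  then show ?thesis by (simp add: in_Lp_def)
qed

lemma in_Lp_scaleR:
  assumes "in_Lp p S f"
  shows "in_Lp p S (\<lambda>x. t *\<^sub>R f x)"
  using assms by (auto simp: in_Lp_def powr_mult)

text \<open>Differentiation under the integral sign; the difference quotients are dominated by a
  multiple of \<open>1 + (norm f + M) powr p\<close>.\<close>

lemma has_derivative_Lp_energy:
  fixes f h :: "'a::euclidean_space \<Rightarrow> 'b::euclidean_space"
  assumes "1 < p" and fin: "finite_measure (lebesgue_on S)" and f: "in_Lp p S f"
    and h: "h \<in> borel_measurable (lebesgue_on S)" "\<And>x. norm (h x) \<le> M"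
  shows "((\<lambda>t. Lp_energy p S (\<lambda>x. f x + t *\<^sub>R h x)) has_real_derivative
    (LINT x|lebesgue_on S. p * (flux p (f x) \<bullet> h x))) (at 0)"
proof -
  interpret finite_measure "lebesgue_on S" by (rule fin)
  have [measurable]: "f \<in> borel_measurable (lebesgue_on S)" "h \<in> borel_measurable (lebesgue_on S)"
    using f h by (auto simp: in_Lp_def)
  have M: "0 \<le> M" using h(2) norm_ge_zero order_trans by blast
  have Lp: "in_Lp p S (\<lambda>x. f x + t *\<^sub>R h x)" for t
    using assms by (intro in_Lp_add in_Lp_scaleR in_Lp_bounded[of h S M]) auto
  have [measurable]: "flux p \<in> borel_measurable (borel :: 'b measure)"
    using continuous_flux[OF assms(1)] by (rule borel_measurable_continuous_onI)
  show ?thesis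
    unfolding DERIV_def tendsto_at_iff_sequentially
  proof (intro allI impI)
    fix X :: "nat \<Rightarrow> real" assume X: "\<forall>i. X i \<in> UNIV - {0}" "X \<longlonglongrightarrow> 0"
    obtain B where B0: "\<And>i. norm (X i) \<le> B" using X(2) convergent_imp_Bseq[of X] BseqE by (metis convergentI)
    \<comment> \<open>\<open>B\<close> bounds the parameters and \<open>C\<close> the perturbations,
      uniformly in \<open>i\<close>, so that one dominating function serves the whole
      sequence.\<close>
    define C where "C = B * M"
    have B: "0 \<le> B" using B0[of 0] by (meson norm_ge_zero order_trans)
    have C: "0 \<le> C" unfolding C_def using B M by simp
    define s where "s i x = (norm (f x + X i *\<^sub>R h x) powr p - norm (f x) powr p) / X i" for i x
    have "(\<lambda>i. (LINT x|lebesgue_on S. s i x)) \<longlonglongrightarrow> (LINT x|lebesgue_on S. p * (flux p (f x) \<bullet> h x))"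
    proof (rule integral_dominated_convergence[where w = "\<lambda>x. p * M * (1 + 2 powr p * (norm (f x) powr p + C powr p))"])
      show "integrable (lebesgue_on S) (\<lambda>x. p * M * (1 + 2 powr p * (norm (f x) powr p + C powr p)))"
        using f by (intro integrable_mult_right Bochner_Integration.integrable_add integrable_const) (auto simp: in_Lp_def)
      show "AE x in lebesgue_on S. (\<lambda>i. s i x) \<longlonglongrightarrow> p * (flux p (f x) \<bullet> h x)"
      proof (rule AE_I2)
        fix x
        have "((\<lambda>t. norm (f x + t *\<^sub>R h x) powr p) has_derivative (\<lambda>t. p * (flux p (f x) \<bullet> (t *\<^sub>R h x)))) (at 0)"
          by (rule has_derivative_compose[of "\<lambda>t. f x + t *\<^sub>R h x" "\<lambda>t. t *\<^sub>R h x", where g = "\<lambda>y. norm y powr p"])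
             (auto intro!: derivative_eq_intros has_derivative_norm_powr assms(1))
        then have "DERIV (\<lambda>t. norm (f x + t *\<^sub>R h x) powr p) 0 :> p * (flux p (f x) \<bullet> h x)"
          unfolding has_field_derivative_def by (rule has_derivative_eq_rhs) (auto simp: fun_eq_iff)
        then have "((\<lambda>t. (norm (f x + t *\<^sub>R h x) powr p - norm (f x) powr p) / t) \<longlongrightarrow> p * (flux p (f x) \<bullet> h x)) (at 0)"
          by (simp add: DERIV_def)
        moreover have "filterlim X (at 0) sequentially"
          unfolding filterlim_at using X by auto
        ultimately show "(\<lambda>i. s i x) \<longlonglongrightarrow> p * (flux p (f x) \<bullet> h x)"
          unfolding s_def by (rule filterlim_compose)
      qed
      show "AE x in lebesgue_on S. norm (s i x) \<le> p * M * (1 + 2 powr p * (norm (f x) powr p + C powr p))" for i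
      proof (rule AE_I2)
        fix x
        have Xi: "X i \<noteq> 0" using X(1) by auto
        have hC: "norm (X i *\<^sub>R h x) \<le> C"
          unfolding C_def using B0[of i] h(2)[of x] B by (auto intro: mult_mono)
        have "\<bar>norm (f x + X i *\<^sub>R h x) powr p - norm (f x) powr p\<bar> \<le> p * (norm (f x) + norm (X i *\<^sub>R h x)) powr (p - 1) * norm (X i *\<^sub>R h x)"
          by (rule norm_powr_diff_le[OF assms(1)])
        also have "\<dots> \<le> p * (norm (f x) + C) powr (p - 1) * (\<bar>X i\<bar> * M)"
          using hC assms(1) mult_left_mono[OF h(2)[of x], of "\<bar>X i\<bar>"]
          by (intro mult_mono mult_left_mono powr_mono2 mult_nonneg_nonneg) auto
        also have "\<dots> \<le> p * (1 + (norm (f x) + C) powr p) * (\<bar>X i\<bar> * M)"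
          using M C assms(1) by (intro mult_right_mono mult_left_mono powr_le_one_add) auto
        also have "\<dots> \<le> p * (1 + 2 powr p * (norm (f x) powr p + C powr p)) * (\<bar>X i\<bar> * M)"
          using powr_add_le[of p "norm (f x)" C] M C assms(1) by (intro mult_right_mono mult_left_mono) auto
        finally show "norm (s i x) \<le> p * M * (1 + 2 powr p * (norm (f x) powr p + C powr p))"
          using Xi by (simp add: s_def abs_divide field_simps)
      qed
    qed (auto simp: s_def)
    moreover have "(LINT x|lebesgue_on S. s i x) = (Lp_energy p S (\<lambda>x. f x + X i *\<^sub>R h x) - Lp_energy p S f) / X i" for i
      using Lp[of "X i"] f unfolding s_def Lp_energy_def by (simp add: in_Lp_def Bochner_Integration.integral_diff)
    ultimately show "((\<lambda>ha. (Lp_energy p S (\<lambda>x. f x + (0 + ha) *\<^sub>R h x) - Lp_energy p S (\<lambda>x. f x + 0 *\<^sub>R h x)) / ha) \<circ> X) \<longlonglongrightarrow>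
       (LINT x|lebesgue_on S. p * (flux p (f x) \<bullet> h x))"
      by (simp add: comp_def)
  qed
qed

section \<open>Weak gradients\<close>

lemma test_function_bounded:
  assumes "test_function S \<phi>"
  obtains M where "\<And>x. norm (\<phi> x) \<le> M" "\<And>x. norm (gradient \<phi> x) \<le> M"
    "\<phi> \<in> borel_measurable borel" "gradient \<phi> \<in> borel_measurable borel"
proof -
  obtain K where "C1_compact_in K S \<phi> (gradient \<phi>)" using test_function_C1_compact[OF assms] unfolding C1_compact_def by blast
  note K = C1_compact_inD[OF this]
  obtain M1 where "\<And>x. norm (\<phi> x) \<le> M1"
    using bounded_compact_support[OF K(7) compact_imp_bounded[OF K(1)] K(3)] by blast
  moreover obtain M2 where "\<And>x. norm (gradient \<phi> x) \<le> M2"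
    using bounded_compact_support[OF K(6) compact_imp_bounded[OF K(1)] K(4)] by blast
  ultimately show ?thesis
    using K(6,7) by (intro that[of "max M1 M2"] borel_measurable_continuous_onI) (auto simp: le_max_iff_disj)
qed

lemma test_function_in_Lp:
  assumes "test_function S \<phi>" "finite_measure (lebesgue_on S)" "0 < p"
  shows "in_Lp p S \<phi>" "in_Lp p S (gradient \<phi>)"
proof -
  obtain M where M: "\<And>x. norm (\<phi> x) \<le> M" "\<And>x. norm (gradient \<phi> x) \<le> M"
    "\<phi> \<in> borel_measurable borel" "gradient \<phi> \<in> borel_measurable borel"
    using test_function_bounded[OF assms(1)] by blast
  show "in_Lp p S \<phi>" "in_Lp p S (gradient \<phi>)"
    by (rule in_Lp_bounded[OF measurable_lebesgue_on[OF M(3)] assms(2) M(1) assms(3)],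
        rule in_Lp_bounded[OF measurable_lebesgue_on[OF M(4)] assms(2) M(2) assms(3)])
qed

text \<open>Two integrations by parts, one built into the definition of the weak gradient and one
  classical, show that \<open>G\<close> and \<open>D\<close> cannot be told apart by test
  functions.\<close>

lemma weak_gradient_test:
  assumes W: "W1p p S u G" and op: "open S"
    and der: "\<And>x. x \<in> S \<Longrightarrow> has_gradient u (D x) x"
    and cont: "continuous_on S D" and \<phi>: "test_function S \<phi>" and b: "b \<in> Basis"
  shows "(LINT x|lebesgue_on S. (G x \<bullet> b) * \<phi> x) = (LBINT x. (D x \<bullet> b) * \<phi> x)"
proof -
  have C1: "C1_compact S \<phi> (gradient \<phi>)" by (rule test_function_C1_compact[OF \<phi>])
  obtain K where "C1_compact_in K S \<phi> (gradient \<phi>)" using C1 unfolding C1_compact_def by blast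
  note K = C1_compact_inD[OF this]
  have cu: "continuous_on S u"
    using der by (rule gradient_imp_continuous_on)
  have "(LINT x|lebesgue_on S. (G x \<bullet> b) * \<phi> x) = - (LINT x|lebesgue_on S. u x * (gradient \<phi> x \<bullet> b))"
    using W \<phi> b by (simp add: W1p_def)
  also have "(LINT x|lebesgue_on S. u x * (gradient \<phi> x \<bullet> b)) = (LBINT x. u x * (gradient \<phi> x \<bullet> b))"
  proof (rule integral_lebesgue_on_eq_lborel(1))
    show "(\<lambda>x. u x * (gradient \<phi> x \<bullet> b)) \<in> borel_measurable borel"
      using C1_compact_integrable(2)[OF op cu C1, of b] by auto
    show "u x * (gradient \<phi> x \<bullet> b) = 0" if "x \<notin> S" for x
    proof -
      have "x \<notin> K" using K(2) that by blast
      then show ?thesis by (simp add: K(4))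
    qed
  qed (use op in auto)
  also have "\<dots> = - (LBINT x. (D x \<bullet> b) * \<phi> x)"
    by (rule integration_by_parts[OF op _ cont C1]) (rule der)
  finally show ?thesis by simp
qed

lemma integrable_indicator_scaleR:
  fixes D :: "'a::euclidean_space \<Rightarrow> 'b::euclidean_space"
  assumes "compact K" "continuous_on K D"
  shows "integrable lborel (\<lambda>x. indicator K x *\<^sub>R D x)"
  using borel_integrable_compact[OF assms] by (simp add: indicator_scaleR_eq_if)

text \<open>The test functions \<open>1 - exp (- n * T)\<close>, with \<open>T\<close> a bump positive exactly on a box,
  increase to the indicator of the box.\<close>

lemma du_Bois_Reymond:
  fixes F :: "'a::euclidean_space \<Rightarrow> real"
  assumes F: "integrable lebesgue F" and op: "open S"
    and 0: "\<And>\<phi>. test_function S \<phi> \<Longrightarrow> (LINT x|lebesgue. F x * \<phi> x) = 0"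
  shows "AE x in lebesgue. x \<in> S \<longrightarrow> F x = 0"
proof -
  have box0: "(LINT x|lebesgue. F x * indicator (box a c) x) = 0" if ac: "cbox a c \<subseteq> S" for a c
  proof -
    obtain T :: "'a \<Rightarrow> real" where T: "\<And>k. C_diff k T" "\<And>x. x \<in> box a c \<Longrightarrow> T x > 0"
      "\<And>x. x \<notin> box a c \<Longrightarrow> T x = 0" "\<And>x. T x \<ge> 0"
      using box_bump_exists[of a c] by blast
    define \<phi> where "\<phi> n x = 1 - exp ((- real n) * T x)" for n x
    have C\<phi>: "C_diff k (\<phi> n)" for k n
      unfolding \<phi>_def by (intro C_diff_diff C_diff_exp C_diff_mult C_diff_const T)
    have \<phi>: "test_function S (\<phi> n)" for n
    proof (rule test_functionI[OF C\<phi> compact_cbox ac])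
      show "\<phi> n x = 0" if "x \<notin> cbox a c" for x
        using T(3)[of x] that box_subset_cbox[of a c] by (auto simp: \<phi>_def)
    qed
    have \<phi>01: "\<bar>\<phi> n x\<bar> \<le> 1" for n x using T(4)[of x] by (simp add: \<phi>_def)
    have lim: "(\<lambda>n. \<phi> n x) \<longlonglongrightarrow> indicator (box a c) x" for x
    proof (cases "x \<in> box a c")
      case True
      have "(\<lambda>n. exp (- T x) ^ n) \<longlonglongrightarrow> 0" using T(2)[OF True] by (intro LIMSEQ_realpow_zero) auto
      then have "(\<lambda>n. 1 - exp (- T x) ^ n) \<longlonglongrightarrow> 1 - 0" by (rule tendsto_diff[OF tendsto_const])
      then show ?thesis using True by (simp add: \<phi>_def exp_of_nat_mult[symmetric])
    qed (simp add: T(3) \<phi>_def)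
    have m\<phi>: "\<phi> n \<in> borel_measurable lebesgue" for n
      using borel_measurable_continuous_onI[OF C_diff_continuous[OF C\<phi>]] by (simp add: measurable_completion)
    have mF: "F \<in> borel_measurable lebesgue" using F by auto
    have "(\<lambda>n. (LINT x|lebesgue. F x * \<phi> n x)) \<longlonglongrightarrow> (LINT x|lebesgue. F x * indicator (box a c) x)"
    proof (rule integral_dominated_convergence[where w = "\<lambda>x. norm (F x)"])
      show "AE x in lebesgue. (\<lambda>i. F x * \<phi> i x) \<longlonglongrightarrow> F x * indicator (box a c) x"
        by (intro AE_I2 tendsto_intros lim)
      show "AE x in lebesgue. norm (F x * \<phi> i x) \<le> norm (F x)" for i
        using mult_left_le[OF \<phi>01] by (intro AE_I2) (simp add: abs_mult)
      show "integrable lebesgue (\<lambda>x. norm (F x))" using F by simp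
    qed (auto intro!: borel_measurable_times borel_measurable_indicator m\<phi> mF)
    then show ?thesis by (simp add: 0[OF \<phi>] LIMSEQ_const_iff)
  qed
  have ion: "integrable (lebesgue_on X) F" if "X \<in> sets lebesgue" for X
    using Lebesgue_Measure.integrable_restrict_UNIV[OF that, of F] integrable_mult_indicator[OF that F]
    unfolding indicator_scaleR_eq_if by blast
  have int: "F integrable_on cbox a c" for a c
    by (intro integrable_on_lebesgue_on ion) auto
  have zero: "integral (cbox a c) F = 0" if ac: "cbox a c \<subseteq> S" for a c
  proof -
    have "integral (cbox a c) F = integral (box a c) F" by (simp add: integral_open_interval)
    also have "\<dots> = (LINT x|lebesgue_on (box a c). F x)"
      by (intro lebesgue_integral_eq_integral[symmetric] ion) auto
    also have "\<dots> = (LINT x|lebesgue. F x * indicator (box a c) x)"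
      by (subst Lebesgue_Measure.integral_restrict_UNIV[symmetric])
         (auto intro!: Bochner_Integration.integral_cong split: split_indicator)
    finally show ?thesis using box0[OF ac] by simp
  qed
  \<comment> \<open>Lebesgue differentiation along cubes with corner \<open>x\<close>: off a null
    set the averages of \<open>F\<close> converge to \<open>F x\<close>, whereas they vanish for all
    small cubes inside \<open>S\<close>.\<close>
  obtain N where N: "negligible N" "\<And>x e. \<lbrakk>x \<notin> N; 0 < e\<rbrakk> \<Longrightarrow>
     \<exists>d>0. \<forall>h. 0 < h \<and> h < d \<longrightarrow> norm (integral (cbox x (x + h *\<^sub>R One)) F /\<^sub>R h ^ DIM('a) - F x) < e"
    using integrable_ccontinuous_explicit[OF int] by blast
  have F0: "F x = 0" if x: "x \<notin> N" "x \<in> S" for x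
  proof (rule ccontr)
    assume "F x \<noteq> 0"
    then obtain d where d: "d > 0" "\<And>h. 0 < h \<Longrightarrow> h < d \<Longrightarrow>
       norm (integral (cbox x (x + h *\<^sub>R One)) F /\<^sub>R h ^ DIM('a) - F x) < norm (F x)"
      using N(2)[OF x(1), of "norm (F x)"] by auto
    obtain r where r: "r > 0" "ball x r \<subseteq> S" using x(2) op open_contains_ball by blast
    \<comment> \<open>A point of the cube is within \<open>h * DIM('a)\<close> of \<open>x\<close>
      in the l1 norm, so this choice keeps the cube in the ball of radius \<open>r\<close>.\<close>
    define h where "h = min (d / 2) (r / (2 * DIM('a)))"
    have h: "0 < h" "h < d" "h * DIM('a) \<le> r / 2"
      using d(1) r(1) DIM_positive[where 'a='a] by (auto simp: h_def min_def field_simps)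
    have "cbox x (x + h *\<^sub>R One) \<subseteq> ball x r"
    proof
      fix y assume y: "y \<in> cbox x (x + h *\<^sub>R One)"
      have "norm (y - x) \<le> (\<Sum>b\<in>Basis. \<bar>(y - x) \<bullet> b\<bar>)" by (rule norm_le_l1)
      also have "\<dots> \<le> (\<Sum>b\<in>(Basis::'a set). h)"
        using y by (intro sum_mono) (auto simp: mem_box inner_diff_left inner_add_left)
      also have "\<dots> < r" using h r by (simp add: mult.commute)
      finally show "y \<in> ball x r" by (simp add: dist_norm norm_minus_commute)
    qed
    then have "integral (cbox x (x + h *\<^sub>R One)) F = 0" using r by (intro zero) auto
    then show False using d(2)[OF h(1,2)] by simp
  qed
  have "AE x in lebesgue. x \<notin> N"
    using N(1) by (intro AE_not_in) (simp add: negligible_iff_null_sets)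
  then show ?thesis by eventually_elim (use F0 in auto)
qed

text \<open>\<open>D\<close> is only continuous in \<open>S\<close> and may fail to be integrable up
  to the boundary. The comparison is therefore made on boxes whose closure lies in \<open>S\<close>,
  countably many of which cover \<open>S\<close>.\<close>

lemma weak_gradient_eq:
  fixes u :: "'a::euclidean_space \<Rightarrow> real"
  assumes W: "W1p p S u G" and op: "open S" and p: "1 < p" and fin: "finite_measure (lebesgue_on S)"
    and der: "\<And>x. x \<in> S \<Longrightarrow> has_gradient u (D x) x"
    and cont: "continuous_on S D"
  shows "AE x in lebesgue_on S. G x = D x"
proof -
  have S: "S \<in> sets lebesgue" using op by auto
  have "in_Lp p S G" using W by (simp add: W1p_def)
  note iG = in_Lp_integrable[OF this p fin]
  have loc: "AE x in lebesgue. x \<in> box a c \<longrightarrow> G x \<bullet> b = D x \<bullet> b" if b: "b \<in> Basis" and ac: "cbox a c \<subseteq> S" for a b c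
  proof -
    let ?F1 = "\<lambda>x. if x \<in> S then G x \<bullet> b else 0" and ?F2 = "\<lambda>x. indicator (cbox a c) x *\<^sub>R (D x \<bullet> b)"
    have F1: "integrable lebesgue ?F1"
      using iG Lebesgue_Measure.integrable_restrict_UNIV[OF S, of "\<lambda>x. G x \<bullet> b"] by simp
    have F2b: "integrable lborel ?F2"
      by (intro integrable_indicator_scaleR continuous_intros continuous_on_subset[OF cont ac]) simp
    then have F2: "integrable lebesgue ?F2" by (simp add: integrable_completion)
    have "AE x in lebesgue. x \<in> box a c \<longrightarrow> ?F1 x - ?F2 x = 0"
    proof (rule du_Bois_Reymond[OF Bochner_Integration.integrable_diff[OF F1 F2] open_box])
      fix \<phi> :: "'a \<Rightarrow> real" assume \<phi>: "test_function (box a c) \<phi>"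
      have "box a c \<subseteq> S" using ac box_subset_cbox[of a c] by blast
      with \<phi> have \<phi>S: "test_function S \<phi>" by (auto simp: test_function_def)
      obtain M where M: "\<And>x. norm (\<phi> x) \<le> M" "\<phi> \<in> borel_measurable borel"
        by (rule test_function_bounded[OF \<phi>]) rule
      have m: "\<phi> \<in> borel_measurable lebesgue" using M(2) by (simp add: measurable_completion)
      have out: "\<phi> x = 0" if "x \<notin> box a c" for x
        using C1_compact_outside[OF test_function_C1_compact[OF \<phi>] that] by simp
      have "(LINT x|lebesgue. (?F1 x - ?F2 x) * \<phi> x) = (LINT x|lebesgue. ?F1 x * \<phi> x) - (LINT x|lebesgue. ?F2 x * \<phi> x)"
        unfolding left_diff_distrib
        by (intro Bochner_Integration.integral_diff integrable_mult_bounded[OF F1 m M(1)] integrable_mult_bounded[OF F2 m M(1)])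
      also have "(LINT x|lebesgue. ?F1 x * \<phi> x) = (LINT x|lebesgue_on S. (G x \<bullet> b) * \<phi> x)"
        by (subst Lebesgue_Measure.integral_restrict_UNIV[OF S, symmetric])
           (auto intro!: Bochner_Integration.integral_cong)
      also have "\<dots> = (LBINT x. (D x \<bullet> b) * \<phi> x)"
        by (rule weak_gradient_test[OF W op der cont \<phi>S b])
      also have "\<dots> = (LBINT x. ?F2 x * \<phi> x)"
        using out box_subset_cbox[of a c] by (intro Bochner_Integration.integral_cong) (auto split: split_indicator)
      also have "\<dots> = (LINT x|lebesgue. ?F2 x * \<phi> x)"
        using F2b M(2) by (intro integral_completion[symmetric]) auto
      finally show "(LINT x|lebesgue. (?F1 x - ?F2 x) * \<phi> x) = 0" by simp
    qed
    then show ?thesis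
      by eventually_elim (use ac box_subset_cbox[of a c] in \<open>auto split: split_indicator_asm\<close>)
  qed
  obtain \<D> where \<D>: "countable \<D>" "\<D> \<subseteq> Pow S" "\<And>X. X \<in> \<D> \<Longrightarrow> \<exists>a b. X = cbox a b" "\<Union>\<D> = S"
    using open_countable_Union_open_cbox[OF op] by blast
  have "AE x in lebesgue. x \<in> X \<longrightarrow> G x \<bullet> b = D x \<bullet> b" if X: "X \<in> \<D>" and b: "b \<in> Basis" for X b
  proof -
    obtain a c where ac: "X = cbox a c" using \<D>(3)[OF X] by blast
    \<comment> \<open>The cover consists of closed boxes, whereas \<open>loc\<close> speaks about
      open ones; their difference is a null set.\<close>
    have "negligible (cbox a c - box a c)" by (rule negligible_frontier_interval)
    then have "AE x in lebesgue. x \<notin> cbox a c - box a c"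
      by (intro AE_not_in) (simp add: negligible_iff_null_sets)
    moreover have "cbox a c \<subseteq> S" using X \<D>(2) ac by auto
    ultimately show ?thesis using loc[OF b \<open>cbox a c \<subseteq> S\<close>]
      by eventually_elim (use ac in auto)
  qed
  then have "AE x in lebesgue. \<forall>X\<in>\<D>. \<forall>b\<in>Basis. x \<in> X \<longrightarrow> G x \<bullet> b = D x \<bullet> b"
    unfolding AE_ball_countable[OF \<D>(1)] AE_ball_countable[OF countable_finite[OF finite_Basis]] by blast
  then have "AE x in lebesgue. x \<in> S \<longrightarrow> G x = D x"
    by eventually_elim (use \<D>(4) in \<open>auto intro: euclidean_eqI\<close>)
  then show ?thesis using S by (simp add: AE_restrict_space_iff)
qed


section \<open>Admissible competitors for the Rayleigh quotient\<close>

lemma Lp_energy_nonneg: "0 \<le> Lp_energy p S w"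
  unfolding Lp_energy_def by (rule integral_nonneg_AE) simp

lemma Lp_energy_eq_0_iff:
  assumes "in_Lp p S w" "0 < p"
  shows "Lp_energy p S w = 0 \<longleftrightarrow> (AE x in lebesgue_on S. w x = 0)"
proof -
  show "Lp_energy p S w = 0 \<longleftrightarrow> (AE x in lebesgue_on S. w x = 0)"
    using integral_nonneg_eq_0_iff_AE[of "lebesgue_on S" "\<lambda>x. norm (w x) powr p"] assms
    by (simp add: in_Lp_def Lp_energy_def)
qed

text \<open>Clearing the denominator includes competitors that vanish almost everywhere, which the
  infimum excludes; a variation can then be inserted without checking that it is nonzero.\<close>

lemma first_eigenvalue_le:
  assumes "W1p_0 p S w H" "0 < p"
  shows "first_eigenvalue p S * Lp_energy p S w \<le> Lp_energy p S H"
proof -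
  have w: "in_Lp p S w" "in_Lp p S H" using assms(1) by (auto simp: W1p_0_def W1p_def)
  note E = Lp_energy_nonneg[of p S w] Lp_energy_eq_0_iff[OF w(1) assms(2)] Lp_energy_nonneg[of p S H]
  show ?thesis
  proof (cases "AE x in lebesgue_on S. w x = 0")
    case True
    then show ?thesis using E by simp
  next
    case False
    then have pos: "0 < Lp_energy p S w" using E by (simp add: less_le)
    let ?A = "{Lp_energy p S G / Lp_energy p S u | u G. W1p_0 p S u G \<and> \<not> (AE x in lebesgue_on S. u x = 0)}"
    have "bdd_below ?A"
    proof (rule bdd_belowI[of _ 0])
      fix y assume "y \<in> ?A"
      then obtain v G where "y = Lp_energy p S G / Lp_energy p S v" "W1p_0 p S v G" by blast
      then show "0 \<le> y" by (simp add: Lp_energy_nonneg)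
    qed
    moreover have "Lp_energy p S H / Lp_energy p S w \<in> ?A" using assms(1) False by blast
    ultimately have "first_eigenvalue p S \<le> Lp_energy p S H / Lp_energy p S w"
      unfolding first_eigenvalue_def by (intro cInf_lower) auto
    then show ?thesis using pos by (simp add: field_simps)
  qed
qed

lemma first_eigenvalue_nonneg:
  assumes "W1p_0 p S w H" "\<not> (AE x in lebesgue_on S. w x = 0)" "0 < p"
  shows "0 \<le> first_eigenvalue p S"
  unfolding first_eigenvalue_def
proof (rule cInf_greatest)
  fix y assume "y \<in> {Lp_energy p S G / Lp_energy p S u | u G. W1p_0 p S u G \<and> \<not> (AE x in lebesgue_on S. u x = 0)}"
  then obtain v G where "y = Lp_energy p S G / Lp_energy p S v" "W1p_0 p S v G" by blast
  then show "0 \<le> y" by (simp add: Lp_energy_nonneg)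
qed (use assms in blast)

lemma test_function_lincomb:
  assumes "test_function S \<phi>" "test_function S \<psi>"
  shows "test_function S (\<lambda>x. \<phi> x + t * \<psi> x)"
    "gradient (\<lambda>x. \<phi> x + t * \<psi> x) x = gradient \<phi> x + t *\<^sub>R gradient \<psi> x"
proof -
  let ?K = "closure {x. \<phi> x \<noteq> 0} \<union> closure {x. \<psi> x \<noteq> 0}"
  show "test_function S (\<lambda>x. \<phi> x + t * \<psi> x)"
  proof (rule test_functionI[of _ ?K])
    show "C_diff k (\<lambda>x. \<phi> x + t * \<psi> x)" for k
      using assms by (intro C_diff_add C_diff_mult C_diff_const) (auto simp: test_function_def)
    show "\<phi> x + t * \<psi> x = 0" if "x \<notin> ?K" for x
    proof -
      have "\<phi> x = 0" "\<psi> x = 0"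
        using that subsetD[OF closure_subset, of x "{x. \<phi> x \<noteq> 0}"] subsetD[OF closure_subset, of x "{x. \<psi> x \<noteq> 0}"] by auto
      then show ?thesis by simp
    qed
  qed (use assms in \<open>auto simp: test_function_def intro: compact_Un\<close>)
  have C: "C_diff (Suc 0) \<phi>" "C_diff (Suc 0) \<psi>" using assms by (simp_all add: test_function_def)
  show "gradient (\<lambda>x. \<phi> x + t * \<psi> x) x = gradient \<phi> x + t *\<^sub>R gradient \<psi> x"
    by (rule gradient_eqI, rule has_derivative_eq_rhs[OF has_derivative_add[OF C_diff_gradient(1)[OF C(1)]
          has_derivative_mult_right[OF C_diff_gradient(1)[OF C(2)], of t]]])
       (simp add: fun_eq_iff inner_add_left)
qed

text \<open>Provides the variations for the minimization. Shifting the approximating sequence by the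
  same multiple of \<open>\<phi>\<close> leaves all differences, hence both limits,
  unchanged.\<close>

lemma W1p_0_add_test_function:
  fixes u :: "'a::euclidean_space \<Rightarrow> real"
  assumes W: "W1p_0 p S u G" and \<phi>: "test_function S \<phi>" and p: "1 < p"
    and op: "open S" and fin: "finite_measure (lebesgue_on S)"
  shows "W1p_0 p S (\<lambda>x. u x + t * \<phi> x) (\<lambda>x. G x + t *\<^sub>R gradient \<phi> x)"
proof -
  have M: "\<phi> \<in> borel_measurable borel" "gradient \<phi> \<in> borel_measurable borel"
    by (rule test_function_bounded[OF \<phi>], assumption)+
  have Lp: "in_Lp p S u" "in_Lp p S G" using W by (auto simp: W1p_0_def W1p_def)
  have Lp\<phi>: "in_Lp p S \<phi>" "in_Lp p S (gradient \<phi>)"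
    using test_function_in_Lp[OF \<phi> fin] p by auto
  have Lpw: "in_Lp p S (\<lambda>x. u x + t * \<phi> x)" "in_Lp p S (\<lambda>x. G x + t *\<^sub>R gradient \<phi> x)"
    using in_Lp_add[OF Lp(1) in_Lp_scaleR[OF Lp\<phi>(1)]] in_Lp_add[OF Lp(2) in_Lp_scaleR[OF Lp\<phi>(2)]] p by auto
  have bdd: "integrable (lebesgue_on S) (\<lambda>x. f x * g x)"
    if "integrable (lebesgue_on S) f" "g \<in> borel_measurable borel" "\<And>x. norm (g x) \<le> B" for f g :: "'a \<Rightarrow> real" and B
    using integrable_mult_bounded[OF that(1) measurable_lebesgue_on[OF that(2)] that(3)] .
  note i = Lp[THEN in_Lp_integrable[OF _ p fin]] Lp\<phi>[THEN in_Lp_integrable[OF _ p fin]]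
  have "(LINT x|lebesgue_on S. (u x + t * \<phi> x) * (gradient \<eta> x \<bullet> b)) =
      - (LINT x|lebesgue_on S. ((G x + t *\<^sub>R gradient \<phi> x) \<bullet> b) * \<eta> x)"
    if \<eta>: "test_function S \<eta>" and b: "b \<in> Basis" for \<eta> b
  proof -
    obtain N where N: "\<And>x. norm (\<eta> x) \<le> N" "\<And>x. norm (gradient \<eta> x) \<le> N"
      "\<eta> \<in> borel_measurable borel" "gradient \<eta> \<in> borel_measurable borel"
      using test_function_bounded[OF \<eta>] by blast
    have Nb: "norm (gradient \<eta> x \<bullet> b) \<le> N" for x
      using Basis_le_norm[OF b, of "gradient \<eta> x"] N(2)[of x] by simp
    have mb: "(\<lambda>x. gradient \<eta> x \<bullet> b) \<in> borel_measurable borel" using N(4) by simp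
    have C1: "C1_compact S \<eta> (gradient \<eta>)" by (rule test_function_C1_compact[OF \<eta>])
    have C: "C_diff (Suc 0) \<phi>" using \<phi> by (simp add: test_function_def)
    have "(LBINT x. \<phi> x * (gradient \<eta> x \<bullet> b)) = - (LBINT x. (gradient \<phi> x \<bullet> b) * \<eta> x)"
      by (rule integration_by_parts[OF op _ _ C1])
         (auto intro: C_diff_gradient(1)[OF C] continuous_on_subset[OF C_diff_gradient_continuous[OF C]])
    moreover have "gradient \<eta> x = 0 \<and> \<eta> x = 0" if "x \<notin> S" for x
      by (rule C1_compact_outside[OF C1 that])
    ultimately have ibp: "(LINT x|lebesgue_on S. \<phi> x * (gradient \<eta> x \<bullet> b)) = - (LINT x|lebesgue_on S. (gradient \<phi> x \<bullet> b) * \<eta> x)"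
      using N M op by (subst (1 2) integral_lebesgue_on_eq_lborel(1)) auto
    have "(LINT x|lebesgue_on S. (u x + t * \<phi> x) * (gradient \<eta> x \<bullet> b)) =
      (LINT x|lebesgue_on S. u x * (gradient \<eta> x \<bullet> b)) + t * (LINT x|lebesgue_on S. \<phi> x * (gradient \<eta> x \<bullet> b))"
      using bdd[OF i(1) mb Nb] bdd[OF i(3) mb Nb] by (simp add: algebra_simps)
    also have "\<dots> = - ((LINT x|lebesgue_on S. (G x \<bullet> b) * \<eta> x) + t * (LINT x|lebesgue_on S. (gradient \<phi> x \<bullet> b) * \<eta> x))"
      unfolding ibp using W \<eta> b by (simp add: W1p_0_def W1p_def)
    also have "\<dots> = - (LINT x|lebesgue_on S. ((G x + t *\<^sub>R gradient \<phi> x) \<bullet> b) * \<eta> x)"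
      using bdd[OF integrable_inner_left[OF i(2)] N(3,1)] bdd[OF integrable_inner_left[OF i(4)] N(3,1)] by (simp add: algebra_simps inner_add_left)
    finally show ?thesis .
  qed
  then have "W1p p S (\<lambda>x. u x + t * \<phi> x) (\<lambda>x. G x + t *\<^sub>R gradient \<phi> x)"
    using Lpw by (simp add: W1p_def)
  moreover obtain \<Phi> where \<Phi>: "\<And>n. test_function S (\<Phi> n)"
    "(\<lambda>n. Lp_energy p S (\<lambda>x. \<Phi> n x - u x)) \<longlonglongrightarrow> 0" "(\<lambda>n. Lp_energy p S (\<lambda>x. gradient (\<Phi> n) x - G x)) \<longlonglongrightarrow> 0"
    using W by (auto simp: W1p_0_def)
  ultimately show ?thesis
    unfolding W1p_0_def
    by (intro conjI exI[of _ "\<lambda>n x. \<Phi> n x + t * \<phi> x"])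
       (simp_all add: test_function_lincomb[OF \<Phi>(1) \<phi>])
qed

section \<open>The Euler--Lagrange equation\<close>

text \<open>A quantitative estimate takes the place of the triangle inequality in L^p: the
  difference of p-th powers is at most a small multiple of |b|^p plus a large multiple of |a -
  b|^p.\<close>

lemma Lp_energy_tendsto:
  fixes f :: "'a::euclidean_space \<Rightarrow> 'b::euclidean_space" and F :: "nat \<Rightarrow> 'a \<Rightarrow> 'b"
  assumes p: "1 < p" and f: "in_Lp p S f" and F: "\<And>n. in_Lp p S (F n)"
    and lim: "(\<lambda>n. Lp_energy p S (\<lambda>x. F n x - f x)) \<longlonglongrightarrow> 0"
  shows "(\<lambda>n. Lp_energy p S (F n)) \<longlonglongrightarrow> Lp_energy p S f"
proof -
  define C where "C = p * 2 powr (p - 1)"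
  have C: "C > 0" using p by (simp add: C_def)
  have pt: "\<bar>norm a powr p - norm b powr p\<bar> \<le> C * (e * norm b powr p + e powr (1 - p) * norm (a - b) powr p)"
    if e: "0 < e" "e \<le> 1" for a b :: 'b and e
  proof -
    let ?c = "norm (a - b)"
    have "\<bar>norm a powr p - norm b powr p\<bar> \<le> p * ((norm b + ?c) powr (p - 1) * ?c)"
      using norm_powr_diff_le[OF p, of b "a - b"] by (simp add: mult.assoc)
    also have "(norm b + ?c) powr (p - 1) * ?c \<le> 2 powr (p - 1) * (e * norm b powr p + e powr (1 - p) * ?c powr p)"
    \<comment> \<open>Either the perturbation is small relative to \<open>b\<close> and the first
      term absorbs it, or \<open>b\<close> is at most \<open>?c / e\<close> and the second term
      does.\<close>
    proof (cases "?c \<le> e * norm b")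
      case True
      have cb: "?c \<le> norm b" using True e mult_right_mono[of e 1 "norm b"] by simp
      have "(norm b + ?c) powr (p - 1) * ?c \<le> (2 * norm b) powr (p - 1) * (e * norm b)"
        using True cb p e by (intro mult_mono powr_mono2) auto
      also have "\<dots> = 2 powr (p - 1) * (e * norm b powr p)"
        by (cases "b = 0") (simp_all add: powr_mult powr_diff)
      also have "\<dots> \<le> 2 powr (p - 1) * (e * norm b powr p + e powr (1 - p) * ?c powr p)"
        by (intro mult_left_mono) auto
      finally show ?thesis .
    next
      case False
      have "0 \<le> e * norm b" using e by simp
      then have c: "0 < ?c" using False by linarith
      have b: "norm b \<le> ?c / e" using False e by (simp add: field_simps)
      have "?c \<le> ?c / e" using e by (simp add: field_simps mult_left_le_one_le)
      then have "(norm b + ?c) powr (p - 1) * ?c \<le> (2 * (?c / e)) powr (p - 1) * ?c"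
        using b p by (intro mult_right_mono powr_mono2) auto
      also have "\<dots> = 2 powr (p - 1) * (e powr (1 - p) * ?c powr p)"
        using c e by (simp add: powr_mult powr_divide powr_diff field_simps)
      also have "\<dots> \<le> 2 powr (p - 1) * (e * norm b powr p + e powr (1 - p) * ?c powr p)"
        using e by (intro mult_left_mono) auto
      finally show ?thesis .
    qed
    finally show ?thesis using p by (simp add: C_def mult_left_mono mult.assoc)
  qed
  have Lpd: "in_Lp p S (\<lambda>x. F n x - f x)" for n
    using in_Lp_add[OF F[of n] in_Lp_scaleR[OF f, of "-1"]] p by simp
  have est: "\<bar>Lp_energy p S (F n) - Lp_energy p S f\<bar> \<le> C * (e * Lp_energy p S f + e powr (1 - p) * Lp_energy p S (\<lambda>x. F n x - f x))"
    if e: "0 < e" "e \<le> 1" for e n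
  proof -
    have i: "integrable (lebesgue_on S) (\<lambda>x. norm (F n x) powr p)" "integrable (lebesgue_on S) (\<lambda>x. norm (f x) powr p)"
      "integrable (lebesgue_on S) (\<lambda>x. norm (F n x - f x) powr p)"
      using F f Lpd by (auto simp: in_Lp_def)
    have "\<bar>Lp_energy p S (F n) - Lp_energy p S f\<bar> = \<bar>\<integral>x. norm (F n x) powr p - norm (f x) powr p \<partial>lebesgue_on S\<bar>"
      using i by (simp add: Lp_energy_def)
    also have "\<dots> \<le> (LINT x|lebesgue_on S. \<bar>norm (F n x) powr p - norm (f x) powr p\<bar>)"
      using integral_norm_bound[of "lebesgue_on S" "\<lambda>x. norm (F n x) powr p - norm (f x) powr p"] by simp
    also have "\<dots> \<le> (LINT x|lebesgue_on S. C * (e * norm (f x) powr p + e powr (1 - p) * norm (F n x - f x) powr p))"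
      using i pt[OF e] by (intro integral_mono) auto
    also have "\<dots> = C * (e * Lp_energy p S f + e powr (1 - p) * Lp_energy p S (\<lambda>x. F n x - f x))"
      using i by (simp add: Lp_energy_def)
    finally show ?thesis .
  qed
  show ?thesis
  proof (rule LIMSEQ_I)
    fix r :: real assume r: "0 < r"
    let ?E = "Lp_energy p S f"
    have E: "0 \<le> ?E" by (rule Lp_energy_nonneg)
    \<comment> \<open>Chosen so that the part not tending to 0 contributes at most
      \<open>r / 2\<close>; the summand 1 guards against a vanishing energy.\<close>
    define e where "e = min 1 (r / (2 * C * (?E + 1)))"
    have e: "0 < e" "e \<le> 1" using r C E by (auto simp: e_def)
    have "C * (e * ?E) \<le> C * (r / (2 * C * (?E + 1)) * ?E)"
      using C E by (intro mult_left_mono mult_right_mono) (auto simp: e_def)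
    also have "\<dots> \<le> C * (r / (2 * C * (?E + 1)) * (?E + 1))"
      using C E r by (intro mult_left_mono) auto
    also have "\<dots> = r / 2" using C E by simp
    finally have 1: "C * (e * ?E) \<le> r / 2" .
    have "(\<lambda>n. C * (e powr (1 - p) * Lp_energy p S (\<lambda>x. F n x - f x))) \<longlonglongrightarrow> C * (e powr (1 - p) * 0)"
      by (intro tendsto_intros lim)
    then have "eventually (\<lambda>n. C * (e powr (1 - p) * Lp_energy p S (\<lambda>x. F n x - f x)) < r / 2) sequentially"
      using r by (intro order_tendstoD) auto
    then obtain N where N: "\<And>n. n \<ge> N \<Longrightarrow> C * (e powr (1 - p) * Lp_energy p S (\<lambda>x. F n x - f x)) < r / 2"
      by (auto simp: eventually_sequentially)
    show "\<exists>N. \<forall>n\<ge>N. norm (Lp_energy p S (F n) - Lp_energy p S f) < r"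
    proof (intro exI[of _ N] allI impI)
      fix n assume "N \<le> n"
      then show "norm (Lp_energy p S (F n) - Lp_energy p S f) < r"
        using 1 N[of n] est[OF e, of n] by (simp add: distrib_left)
    qed
  qed
qed

text \<open>The graph of x^p lies strictly above its tangent at 1, by the mean value theorem. The
  point 0 is separate because the derivative of \<open>powr\<close> is used at positive arguments
  only.\<close>

lemma bernoulli_powr_strict:
  assumes "1 < p" "0 \<le> x" "x \<noteq> (1::real)"
  shows "1 + p * (x - 1) < x powr p"
proof -
  have der: "DERIV (\<lambda>t. t powr p) t :> p * t powr (p - 1)" if "t > 0" for t
    using that has_real_derivative_powr by blast
  consider "x = 0" | "0 < x" "x < 1" | "1 < x" using assms by linarith
  then show ?thesis
  proof cases
    case 1 then show ?thesis using assms by simp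
  next
    case 2
    obtain z where z: "x < z" "z < 1" "1 powr p - x powr p = (1 - x) * (p * z powr (p - 1))"
      using MVT2[of x 1 "\<lambda>t. t powr p" "\<lambda>t. p * t powr (p - 1)"] der 2 by auto
    have "z powr (p - 1) < 1" using z 2 assms powr_less_mono2[of "p - 1" z 1] by simp
    then have "(1 - x) * (p * z powr (p - 1)) < (1 - x) * p" using 2 assms by simp
    then show ?thesis using z by (simp add: algebra_simps)
  next
    case 3
    obtain z where z: "1 < z" "z < x" "x powr p - 1 powr p = (x - 1) * (p * z powr (p - 1))"
      using MVT2[of 1 x "\<lambda>t. t powr p" "\<lambda>t. p * t powr (p - 1)"] der 3 by auto
    have "1 < z powr (p - 1)" using z assms by simp
    then have "(x - 1) * (p * 1) < (x - 1) * (p * z powr (p - 1))" using 3 assms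
      by (intro mult_strict_left_mono) auto
    then show ?thesis using z by (simp add: algebra_simps)
  qed
qed

text \<open>The integrand of Picone's identity.\<close>

lemma picone_pointwise:
  fixes b c :: "'a::euclidean_space"
  assumes "1 < p"
  shows "0 \<le> norm b powr p - p * (flux p c \<bullet> b) + (p - 1) * norm c powr p"
    and "norm b powr p - p * (flux p c \<bullet> b) + (p - 1) * norm c powr p = 0 \<Longrightarrow> b = c"
proof -
  let ?L = "norm b powr p - p * (flux p c \<bullet> b) + (p - 1) * norm c powr p"
  have "0 \<le> ?L \<and> (?L = 0 \<longrightarrow> b = c)"
  proof (cases "c = 0")
    case True
    then show ?thesis by simp
  next
    case False
    \<comment> \<open>Cauchy-Schwarz reduces the claim to the ratio of the norms, where it is the
      tangent inequality. In the equality case the ratio must be 1, and then Cauchy-Schwarz itself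
      is an equality.\<close>
    define x where "x = norm b / norm c"
    have x: "norm b = x * norm c" "x \<ge> 0" using False by (auto simp: x_def)
    have c1: "norm c powr (p - 1) * norm c = norm c powr p" using False by (simp add: powr_diff)
    have cp: "norm c powr p > 0" using False by simp
    have b1: "norm b powr p = x powr p * norm c powr p" using x by (simp add: powr_mult)
    have cs: "flux p c \<bullet> b \<le> x * norm c powr p"
      using norm_cauchy_schwarz[of "flux p c" b] c1 by (simp add: norm_flux x mult.left_commute)
    have "?L \<ge> (x powr p - (1 + p * (x - 1))) * norm c powr p"
      using mult_left_mono[OF cs, of p] assms by (simp add: b1 algebra_simps)
    moreover have bern: "x powr p - (1 + p * (x - 1)) \<ge> 0" "x \<noteq> 1 \<Longrightarrow> x powr p - (1 + p * (x - 1)) > 0"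
      using bernoulli_powr_strict[OF assms x(2)] by (cases "x = 1"; force)+
    moreover have "b = c" if L0: "?L = 0"
    proof -
      have "(x powr p - (1 + p * (x - 1))) * norm c powr p \<le> 0" using calculation L0 by simp
      then have x1: "x = 1" using bern(2) cp by (meson mult_pos_pos not_less)
      then have nb: "norm b = norm c" using x by simp
      have "flux p c \<bullet> b = norm c powr p"
        using L0 assms nb by (simp add: algebra_simps)
      then have "norm c powr (p - 2) * (c \<bullet> b) = norm c powr (p - 2) * (norm c * norm c)"
        using False inner_flux_self[of p c] by (simp add: flux_def dot_square_norm power2_eq_square)
      then have "c \<bullet> b = norm c * norm b" using False nb by simp
      then show "b = c" using norm_cauchy_schwarz_eq[of c b] nb False by simp
    qed
    ultimately show ?thesis using cp by (meson mult_nonneg_nonneg less_imp_le order_trans)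
  qed
  then show "0 \<le> ?L" "?L = 0 \<Longrightarrow> b = c" by auto
qed

lemma C1_compact_integrable_inner:
  fixes F :: "'a::euclidean_space \<Rightarrow> 'a"
  assumes "open S" "continuous_on S F" "C1_compact S g E"
  shows "integrable lborel (\<lambda>x. F x \<bullet> E x)"
proof -
  have "integrable lborel (\<lambda>x. \<Sum>b\<in>Basis. (F x \<bullet> b) * (E x \<bullet> b))"
    by (intro Bochner_Integration.integrable_sum C1_compact_integrable(2)[OF assms(1) _ assms(3)] continuous_intros assms(2))
  then show ?thesis by (simp add: euclidean_inner[of "F _" "E _"])
qed

text \<open>The dimension is left open: on the real line the ball is the interval, so both models
  are instances.\<close>

locale ball_eigenfunction =
  fixes p R :: real and u :: "'a::euclidean_space \<Rightarrow> real"
  assumes p: "1 < p" and R: "0 < R" and cl: "classical_first_eigenfunction p (ball 0 R) u"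
begin

abbreviation \<Omega> :: "'a set" where "\<Omega> \<equiv> ball 0 R"
abbreviation \<L> where "\<L> \<equiv> lebesgue_on \<Omega>"
abbreviation Du :: "'a \<Rightarrow> 'a" where "Du \<equiv> gradient u"
definition lam :: real where "lam = first_eigenvalue p \<Omega>"

lemma der_u: "x \<in> \<Omega> \<Longrightarrow> has_gradient u (Du x) x"
  using cl by (intro has_derivative_gradient) (auto simp: classical_first_eigenfunction_def)

lemma cont_Du: "continuous_on \<Omega> Du"
  using cl by (auto simp: classical_first_eigenfunction_def)

lemma cont_u: "continuous_on (cball 0 R) u"
  using cl R by (auto simp: classical_first_eigenfunction_def)

lemma cont_u': "continuous_on \<Omega> u"
  using cont_u by (rule continuous_on_subset) auto

lemma pos_u: "x \<in> \<Omega> \<Longrightarrow> 0 < u x"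
  using cl by (auto simp: classical_first_eigenfunction_def first_eigenfunction_def)

lemma boundary_u: "norm x = R \<Longrightarrow> u x = 0"
  using cl R by (auto simp: classical_first_eigenfunction_def frontier_ball)

lemma fin: "finite_measure \<L>"
  by (intro finite_measure_lebesgue_on) simp

text \<open>A nonempty open set is not a null set; this upgrades almost-everywhere identities
  between continuous functions to pointwise ones.\<close>

lemma AE_imp_everywhere:
  assumes "AE x in \<L>. P x" "open {x \<in> \<Omega>. \<not> P x}" "x \<in> \<Omega>"
  shows "P x"
proof (rule ccontr)
  assume "\<not> P x"
  then have "{x \<in> \<Omega>. \<not> P x} \<noteq> {}" using assms(3) by blast
  moreover have "AE x in lebesgue. x \<notin> {x \<in> \<Omega>. \<not> P x}"
    using assms(1) by (simp add: AE_restrict_space_iff)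
  then have "negligible {x \<in> \<Omega>. \<not> P x}"
    using assms(2) by (subst (asm) AE_iff_null_sets[symmetric]) (auto simp: negligible_iff_null_sets)
  ultimately show False using open_not_negligible[OF assms(2)] by blast
qed

lemma nontrivial: "\<not> (AE x in \<L>. u x = 0)"
proof
  assume *: "AE x in \<L>. u x = 0"
  have "{x \<in> \<Omega>. u x \<noteq> 0} = \<Omega>" using pos_u by force
  then have "u 0 = 0" using AE_imp_everywhere[OF *, of 0] R by auto
  then show False using pos_u[of 0] R by simp
qed

text \<open>\<open>G\<close> is kept beside \<open>Du\<close> because the approximation by test
  functions and the minimality are stated for \<open>G\<close>, while the two gradients are only
  known to agree almost everywhere.\<close>

lemma weak_gradient:
  obtains G where "W1p_0 p \<Omega> u G" "Lp_energy p \<Omega> G = lam * Lp_energy p \<Omega> u" "AE x in \<L>. G x = Du x"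
proof -
  obtain G where G: "W1p_0 p \<Omega> u G" "Lp_energy p \<Omega> G / Lp_energy p \<Omega> u = lam"
    using cl by (auto simp: lam_def classical_first_eigenfunction_def first_eigenfunction_def)
  have W: "W1p p \<Omega> u G" using G by (simp add: W1p_0_def)
  have "Lp_energy p \<Omega> u \<noteq> 0"
    using Lp_energy_eq_0_iff[of p \<Omega> u] W p nontrivial by (simp add: W1p_def)
  then have "Lp_energy p \<Omega> G = lam * Lp_energy p \<Omega> u" using G(2) by (auto simp: field_simps)
  moreover have "AE x in \<L>. G x = Du x"
    by (rule weak_gradient_eq[OF W open_ball p fin der_u cont_Du])
  ultimately show ?thesis using that G by blast
qed

lemma lam_nonneg: "0 \<le> lam"
proof -
  obtain G where "W1p_0 p \<Omega> u G" by (rule weak_gradient)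
  then show ?thesis unfolding lam_def using first_eigenvalue_nonneg[OF _ nontrivial] p by auto
qed

lemma continuous_flux_Du: "continuous_on \<Omega> (\<lambda>x. flux p (Du x))"
  by (rule continuous_on_compose2[OF continuous_flux[OF p] cont_Du]) auto

lemma continuous_u_powr: "continuous_on \<Omega> (\<lambda>x. u x powr q)"
  using pos_u by (intro continuous_on_powr' cont_u' continuous_on_const) force

lemma euler_lagrange_test:
  assumes \<phi>: "test_function \<Omega> \<phi>"
  shows "(LBINT x. flux p (Du x) \<bullet> gradient \<phi> x) = lam * (LBINT x. u x powr (p - 1) * \<phi> x)"
proof -
  obtain G where G: "W1p_0 p \<Omega> u G" "Lp_energy p \<Omega> G = lam * Lp_energy p \<Omega> u" "AE x in \<L>. G x = Du x"
    by (rule weak_gradient)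
  have Lp: "in_Lp p \<Omega> u" "in_Lp p \<Omega> G" using G(1) by (auto simp: W1p_0_def W1p_def)
  obtain M where M: "\<And>x. norm (\<phi> x) \<le> M" "\<And>x. norm (gradient \<phi> x) \<le> M"
    "\<phi> \<in> borel_measurable borel" "gradient \<phi> \<in> borel_measurable borel"
    using test_function_bounded[OF \<phi>] by blast
  note m = measurable_lebesgue_on[OF M(3)] measurable_lebesgue_on[OF M(4)]
  have C1: "C1_compact \<Omega> \<phi> (gradient \<phi>)" by (rule test_function_C1_compact[OF \<phi>])
  have z: "gradient \<phi> x = 0 \<and> \<phi> x = 0" if "x \<notin> \<Omega>" for x
    using C1_compact_outside[OF C1 that] .
  \<comment> \<open>Variational inequality without quotients: \<open>J\<close> is nonnegative by
    definition of the eigenvalue and \<open>J 0 = 0\<close> because \<open>u\<close> is a minimizer,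
    so its derivative at 0 vanishes.\<close>
  define J where "J t = Lp_energy p \<Omega> (\<lambda>x. G x + t *\<^sub>R gradient \<phi> x) - lam * Lp_energy p \<Omega> (\<lambda>x. u x + t *\<^sub>R \<phi> x)" for t
  have "DERIV J 0 :> (LINT x|\<L>. p * (flux p (G x) \<bullet> gradient \<phi> x))
      - lam * (LINT x|\<L>. p * (flux p (u x) \<bullet> \<phi> x))"
    unfolding J_def
    by (intro DERIV_diff DERIV_cmult has_derivative_Lp_energy[OF p fin Lp(2) m(2) M(2)]
        has_derivative_Lp_energy[OF p fin Lp(1) m(1) M(1)])
  moreover have "J 0 \<le> J t" for t
    using first_eigenvalue_le[OF W1p_0_add_test_function[OF G(1) \<phi> p open_ball fin, of t]] p G(2)
    by (simp add: J_def lam_def)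
  ultimately have "(LINT x|\<L>. p * (flux p (G x) \<bullet> gradient \<phi> x))
      - lam * (LINT x|\<L>. p * (flux p (u x) \<bullet> \<phi> x)) = 0"
    by (intro DERIV_local_min[of J _ 0 1]) auto
  then have eq: "(LINT x|\<L>. flux p (G x) \<bullet> gradient \<phi> x) = lam * (LINT x|\<L>. flux p (u x) * \<phi> x)"
    using p by simp
  have [measurable]: "flux p \<in> borel_measurable (borel :: 'a measure)"
    using continuous_flux[OF p] by (rule borel_measurable_continuous_onI)
  have [measurable]: "G \<in> borel_measurable \<L>" using Lp by (simp add: in_Lp_def)
  have [measurable]: "Du \<in> borel_measurable \<L>"
    by (rule continuous_imp_measurable_on_sets_lebesgue[OF cont_Du]) auto
  note [measurable] = m
  have "(LINT x|\<L>. flux p (G x) \<bullet> gradient \<phi> x) = (LINT x|\<L>. flux p (Du x) \<bullet> gradient \<phi> x)"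
    by (rule integral_cong_AE) (use G(3) in auto)
  also have "\<dots> = (LBINT x. flux p (Du x) \<bullet> gradient \<phi> x)"
    using C1_compact_integrable_inner[OF open_ball continuous_flux_Du C1] z by (intro integral_lebesgue_on_eq_lborel(1)) auto
  finally have 1: "(LINT x|\<L>. flux p (G x) \<bullet> gradient \<phi> x) = (LBINT x. flux p (Du x) \<bullet> gradient \<phi> x)" .
  have "(LINT x|\<L>. flux p (u x) * \<phi> x) = (LINT x|\<L>. u x powr (p - 1) * \<phi> x)"
    using pos_u by (intro Bochner_Integration.integral_cong) (auto simp: flux_pos)
  also have "\<dots> = (LBINT x. u x powr (p - 1) * \<phi> x)"
    using C1_compact_integrable(1)[OF open_ball continuous_u_powr C1] z by (intro integral_lebesgue_on_eq_lborel(1)) auto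
  finally show ?thesis using eq 1 by simp
qed

text \<open>Both sides are continuous under uniform convergence of the test function and its
  gradient, as long as the supports stay in a fixed compact subset of the ball.\<close>

lemma euler_lagrange:
  assumes \<psi>: "C1_compact \<Omega> \<psi> D"
  shows "(LBINT x. flux p (Du x) \<bullet> D x) = lam * (LBINT x. u x powr (p - 1) * \<psi> x)"
proof -
  obtain K where K: "compact K" "K \<subseteq> \<Omega>" "\<And>x. x \<notin> K \<Longrightarrow> \<psi> x = 0 \<and> D x = 0"
    and ap: "\<And>e. e > 0 \<Longrightarrow> \<exists>\<phi>. test_function \<Omega> \<phi> \<and> (\<forall>x. x \<notin> K \<longrightarrow> \<phi> x = 0 \<and> gradient \<phi> x = 0) \<and>
       (\<forall>x. \<bar>\<phi> x - \<psi> x\<bar> \<le> e \<and> norm (gradient \<phi> x - D x) \<le> e)"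
    by (rule C1_compact_approx[OF open_ball \<psi>]) blast
  \<comment> \<open>Cutting the weights off to \<open>K\<close> makes them integrable over the whole
    space and changes nothing where the test functions live; their L^1 norms make up the constant
    \<open>c\<close>.\<close>
  define A where "A x = indicator K x *\<^sub>R flux p (Du x)" for x
  define B where "B x = indicator K x *\<^sub>R (u x powr (p - 1))" for x
  have AB: "integrable lborel A" "integrable lborel B"
    unfolding A_def B_def using K(2)
    by (intro integrable_indicator_scaleR K(1) continuous_on_subset[OF continuous_flux_Du] continuous_on_subset[OF continuous_u_powr]; simp)+
  define c where "c = (LBINT x. norm (A x)) + lam * (LBINT x. norm (B x))"
  define X where "X = (LBINT x. flux p (Du x) \<bullet> D x) - lam * (LBINT x. u x powr (p - 1) * \<psi> x)"
  have c: "0 \<le> c" using lam_nonneg by (auto simp: c_def)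
  have X: "\<bar>X\<bar> \<le> e * c" if e: "e > 0" for e
  proof -
    obtain \<phi> where \<phi>: "test_function \<Omega> \<phi>" "\<And>x. x \<notin> K \<Longrightarrow> \<phi> x = 0 \<and> gradient \<phi> x = 0"
       "\<And>x. \<bar>\<phi> x - \<psi> x\<bar> \<le> e \<and> norm (gradient \<phi> x - D x) \<le> e"
      using ap[OF e] by blast
    note C1 = test_function_C1_compact[OF \<phi>(1)]
    note i = C1_compact_integrable_inner[OF open_ball continuous_flux_Du C1] C1_compact_integrable_inner[OF open_ball continuous_flux_Du \<psi>]
      C1_compact_integrable(1)[OF open_ball continuous_u_powr C1] C1_compact_integrable(1)[OF open_ball continuous_u_powr \<psi>]
    have eA: "A x \<bullet> (D x - gradient \<phi> x) = flux p (Du x) \<bullet> D x - flux p (Du x) \<bullet> gradient \<phi> x" for x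
      using K(3)[of x] \<phi>(2)[of x] by (cases "x \<in> K") (auto simp: A_def inner_diff_right)
    have eB: "B x * (\<psi> x - \<phi> x) = u x powr (p - 1) * \<psi> x - u x powr (p - 1) * \<phi> x" for x
      using K(3)[of x] \<phi>(2)[of x] by (cases "x \<in> K") (auto simp: B_def algebra_simps)
    have iA: "integrable lborel (\<lambda>x. A x \<bullet> (D x - gradient \<phi> x))" "integrable lborel (\<lambda>x. B x * (\<psi> x - \<phi> x))"
      unfolding eA eB using i by auto
    define Y Z where "Y = (LBINT x. A x \<bullet> (D x - gradient \<phi> x))" and "Z = (LBINT x. B x * (\<psi> x - \<phi> x))"
    have "X = Y - lam * Z"
      unfolding Y_def Z_def X_def eA eB using i euler_lagrange_test[OF \<phi>(1)] by (simp add: algebra_simps)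
    moreover have "\<bar>Y\<bar> \<le> e * (LBINT x. norm (A x))"
    proof -
      have "norm (LBINT x. A x \<bullet> (D x - gradient \<phi> x)) \<le> (LBINT x. e * norm (A x))"
      proof (rule Bochner_Integration.integral_norm_bound_integral[OF iA(1)])
        show "norm (A x \<bullet> (D x - gradient \<phi> x)) \<le> e * norm (A x)" for x
        proof -
          have "norm (A x \<bullet> (D x - gradient \<phi> x)) \<le> norm (A x) * norm (D x - gradient \<phi> x)"
            using Cauchy_Schwarz_ineq2 by simp
          also have "\<dots> \<le> norm (A x) * e" using \<phi>(3)[of x] by (intro mult_left_mono) (auto simp: norm_minus_commute)
          finally show ?thesis by (simp add: mult.commute)
        qed
      qed (use AB in auto)
      then show ?thesis by (simp add: Y_def)
    qed
    moreover have "\<bar>Z\<bar> \<le> e * (LBINT x. norm (B x))"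
    proof -
      have "norm (LBINT x. B x * (\<psi> x - \<phi> x)) \<le> (LBINT x. e * norm (B x))"
      proof (rule Bochner_Integration.integral_norm_bound_integral[OF iA(2)])
        show "norm (B x * (\<psi> x - \<phi> x)) \<le> e * norm (B x)" for x
          using mult_left_mono[of "\<bar>\<psi> x - \<phi> x\<bar>" e "\<bar>B x\<bar>"] \<phi>(3)[of x] by (simp add: abs_mult mult.commute abs_minus_commute)
      qed (use AB in auto)
      then show ?thesis by (simp add: Z_def)
    qed
    moreover have "\<bar>lam * Z\<bar> = lam * \<bar>Z\<bar>" using lam_nonneg by (simp add: abs_mult)
    moreover have "lam * \<bar>Z\<bar> \<le> lam * (e * (LBINT x. norm (B x)))" if "\<bar>Z\<bar> \<le> e * (LBINT x. norm (B x))"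
      using that lam_nonneg by (rule mult_left_mono)
    ultimately have "\<bar>X\<bar> \<le> e * (LBINT x. norm (A x)) + lam * (e * (LBINT x. norm (B x)))"
      by linarith
    then show ?thesis by (simp add: c_def algebra_simps)
  qed
  have "\<bar>X\<bar> \<le> 0"
  proof (rule field_le_epsilon)
    fix e :: real assume e: "0 < e"
    have "\<bar>X\<bar> \<le> e / (c + 1) * c" using c e by (intro X) auto
    also have "\<dots> \<le> e" using c e by (simp add: field_simps)
    finally show "\<bar>X\<bar> \<le> 0 + e" by simp
  qed
  then show ?thesis by (simp add: X_def)
qed

end

section \<open>Picone's identity and radial symmetry\<close>

lemma flux_linear_isometry:
  assumes "linear S" "\<And>x. norm (S x) = norm x"
  shows "flux p (S a) = S (flux p a)"
  by (simp add: flux_def assms linear_scale)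

lemma isometry_involution_adjoint:
  fixes S :: "'a::euclidean_space \<Rightarrow> 'a"
  assumes "linear S" "\<And>x. norm (S x) = norm x" "\<And>x. S (S x) = x"
  shows "S x \<bullet> y = x \<bullet> S y"
proof -
  have "orthogonal_transformation S" using assms by (simp add: orthogonal_transformation)
  then have "S x \<bullet> S (S y) = x \<bullet> S y" by (simp add: orthogonal_transformation_def)
  then show ?thesis by (simp add: assms)
qed

lemma flux_divide: "0 < (b::real) \<Longrightarrow> flux p (a / b) = flux p a * b powr (1 - p)"
  using flux_scaleR[of p "1 / b" a] flux_pos[of "1 / b" p] powr_minus_divide[of b "p - 1"]
  by (simp add: powr_divide mult.commute)

text \<open>The condition p > 1 gives differentiability at the zeros of \<open>f\<close>, but in
  general nothing smoother than C^1. This is why the weak equation is needed for C^1 test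
  functions.\<close>

lemma C1_compact_norm_powr:
  assumes "1 < p" "C1_compact \<Omega> f D"
  shows "C1_compact \<Omega> (\<lambda>x. \<bar>f x\<bar> powr p) (\<lambda>x. (p * flux p (f x)) *\<^sub>R D x)"
proof -
  obtain K where "C1_compact_in K \<Omega> f D" using assms(2) unfolding C1_compact_def by blast
  note K = C1_compact_inD[OF this]
  have d: "has_gradient (\<lambda>x. \<bar>f x\<bar> powr p) ((p * flux p (f x)) *\<^sub>R D x) x" for x
    using has_derivative_compose[OF K(5) has_derivative_norm_powr[OF assms(1), of "f x"]] by (simp add: mult.assoc)
  have c: "continuous_on UNIV (\<lambda>x. (p * flux p (f x)) *\<^sub>R D x)"
    by (intro continuous_intros K(6) continuous_on_compose2[OF continuous_flux[OF assms(1)] K(7)]) auto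
  show ?thesis
    unfolding C1_compact_def C1_compact_in_def
    by (intro exI[of _ K] conjI allI impI K(1,2) d c) (simp_all add: K(3,4))
qed

context ball_eigenfunction
begin

text \<open>\<open>S (Du (S x))\<close> is the gradient of the reflected function. Substituting
  \<open>S\<close> in the integrals and using that it is self-adjoint transfers the reflection to
  the test function.\<close>

lemma euler_lagrange_isometry:
  assumes S: "linear S" "\<And>x. norm (S x) = norm x" "\<And>x. S (S x) = x"
    and \<psi>: "C1_compact \<Omega> \<psi> D"
  shows "(LBINT x. flux p (S (Du (S x))) \<bullet> D x) = lam * (LBINT x. u (S x) powr (p - 1) * \<psi> x)"
proof -
  note adj = isometry_involution_adjoint[OF S]
  have bl: "bounded_linear S" using S(1) by (simp add: linear_conv_bounded_linear)
  note cS = linear_continuous_on[OF bl]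
  obtain K where "C1_compact_in K \<Omega> \<psi> D" using \<psi> unfolding C1_compact_def by blast
  note K = C1_compact_inD[OF this]
  have C1: "C1_compact \<Omega> (\<lambda>x. \<psi> (S x)) (\<lambda>x. S (D (S x)))"
    unfolding C1_compact_def C1_compact_in_def
  proof (intro conjI allI exI[of _ "S ` K"] impI)
    show "has_gradient (\<lambda>x. \<psi> (S x)) (S (D (S x))) x" for x
      by (rule has_derivative_eq_rhs[OF has_derivative_compose[OF bounded_linear_imp_has_derivative[OF bl] K(5)]]) (simp add: adj)
    show "continuous_on UNIV (\<lambda>x. S (D (S x)))"
      by (intro continuous_on_compose2[OF cS[of UNIV]] continuous_on_compose2[OF K(6)] cS) auto
    show "compact (S ` K)" by (intro compact_continuous_image cS K)
    show "S ` K \<subseteq> \<Omega>" using K(2) S(2) by auto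
    fix x assume "x \<notin> S ` K"
    then have "S x \<notin> K" using S(3) by (metis image_eqI)
    then show "\<psi> (S x) = 0" "S (D (S x)) = 0" using K(3,4) linear_0[OF S(1)] by auto
  qed
  have [measurable]: "S \<in> borel_measurable borel" by (rule borel_measurable_continuous_onI[OF cS])
  have sub: "(LBINT x. g (S x)) = (LBINT x. g x)" if "g \<in> borel_measurable borel" for g :: "'a \<Rightarrow> real"
    using integral_distr[of S lborel borel g] that distr_lborel_isometry[OF S] by simp
  have "(LBINT x. flux p (S (Du (S x))) \<bullet> D x) = (LBINT x. flux p (Du (S x)) \<bullet> S (D (S (S x))))"
    by (simp add: flux_linear_isometry[OF S(1,2)] adj S(3))
  also have "\<dots> = (LBINT x. flux p (Du x) \<bullet> S (D (S x)))"
    using C1_compact_integrable_inner[OF open_ball continuous_flux_Du C1] by (intro sub[of "\<lambda>x. flux p (Du x) \<bullet> S (D (S x))"]) auto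
  also have "\<dots> = lam * (LBINT x. u x powr (p - 1) * \<psi> (S x))" by (rule euler_lagrange[OF C1])
  also have "(LBINT x. u x powr (p - 1) * \<psi> (S x)) = (LBINT x. u (S x) powr (p - 1) * \<psi> (S (S x)))"
    using C1_compact_integrable(1)[OF open_ball continuous_u_powr C1] by (intro sub[of "\<lambda>x. u x powr (p - 1) * \<psi> (S x)", symmetric]) auto
  finally show ?thesis by (simp add: S(3))
qed

text \<open>Picone's identity with the test function \<open>norm \<phi> powr p / v powr (p - 1)\<close>.\<close>

lemma picone_integral:
  assumes v: "\<And>x. x \<in> \<Omega> \<Longrightarrow> has_gradient v (Dv x) x" "continuous_on \<Omega> Dv" "\<And>x. x \<in> \<Omega> \<Longrightarrow> 0 < v x"
    and EL: "\<And>\<psi> D. C1_compact \<Omega> \<psi> D \<Longrightarrow> (LBINT x. flux p (Dv x) \<bullet> D x) = lam * (LBINT x. v x powr (p - 1) * \<psi> x)"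
    and \<phi>: "test_function \<Omega> \<phi>"
  defines "L \<equiv> \<lambda>x. norm (gradient \<phi> x) powr p - p * (flux p ((\<phi> x / v x) *\<^sub>R Dv x) \<bullet> gradient \<phi> x)
      + (p - 1) * norm ((\<phi> x / v x) *\<^sub>R Dv x) powr p"
  shows "integrable \<L> L" "(LINT x|\<L>. L x) = Lp_energy p \<Omega> (gradient \<phi>) - lam * Lp_energy p \<Omega> \<phi>"
proof -
  have C1: "C1_compact \<Omega> \<phi> (gradient \<phi>)" by (rule test_function_C1_compact[OF \<phi>])
  have cv: "continuous_on \<Omega> v"
    using v(1) by (rule gradient_imp_continuous_on)
  have cvp: "continuous_on \<Omega> (\<lambda>x. v x powr q)" for q
    using v(3) by (intro continuous_on_powr' cv continuous_on_const) force
  let ?\<psi> = "\<lambda>x. v x powr (1 - p) * \<bar>\<phi> x\<bar> powr p"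
  let ?D = "\<lambda>x. (\<bar>\<phi> x\<bar> powr p) *\<^sub>R (((1 - p) * v x powr (- p)) *\<^sub>R Dv x) + v x powr (1 - p) *\<^sub>R ((p * flux p (\<phi> x)) *\<^sub>R gradient \<phi> x)"
  have \<psi>: "C1_compact \<Omega> ?\<psi> ?D"
  proof (rule C1_compact_mult[OF open_ball _ _ C1_compact_norm_powr[OF p C1]])
    fix x assume x: "x \<in> \<Omega>"
    show "has_gradient (\<lambda>x. v x powr (1 - p)) (((1 - p) * v x powr (- p)) *\<^sub>R Dv x) x"
      using has_derivative_compose[OF v(1)[OF x] has_real_derivative_powr[OF v(3)[OF x], of "1 - p", unfolded has_field_derivative_def]]
      by (simp add: mult.commute mult.left_commute)
  next
    show "continuous_on \<Omega> (\<lambda>x. ((1 - p) * v x powr - p) *\<^sub>R Dv x)" by (intro continuous_intros cvp v(2))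
  qed
  have cflux: "continuous_on \<Omega> (\<lambda>x. flux p (Dv x))"
    by (rule continuous_on_compose2[OF continuous_flux[OF p] v(2)]) auto
  have z: "gradient \<phi> x = 0 \<and> \<phi> x = 0" if "x \<notin> \<Omega>" for x
    using C1_compact_outside[OF C1 that] .
  have M: "\<phi> \<in> borel_measurable borel"
    by (rule test_function_bounded[OF \<phi>])
  have "in_Lp p \<Omega> (gradient \<phi>)"
    using test_function_in_Lp[OF \<phi> fin] p by auto
  then have i1: "integrable \<L> (\<lambda>x. norm (gradient \<phi> x) powr p)" by (simp add: in_Lp_def)
  have i2: "integrable lborel (\<lambda>x. flux p (Dv x) \<bullet> ?D x)"
    by (rule C1_compact_integrable_inner[OF open_ball cflux \<psi>])
  have zD: "flux p (Dv x) \<bullet> ?D x = 0" if "x \<notin> \<Omega>" for x using z[OF that] by simp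
  have i3: "integrable \<L> (\<lambda>x. flux p (Dv x) \<bullet> ?D x)"
    using i2 zD by (intro integral_lebesgue_on_eq_lborel(2)) auto
  \<comment> \<open>By homogeneity of \<open>flux\<close>, the last two terms of \<open>L\<close>
    are minus the Euler-Lagrange integrand of \<open>v\<close> tested with
    \<open>?\<psi>\<close>.\<close>
  have L: "L x = norm (gradient \<phi> x) powr p - flux p (Dv x) \<bullet> ?D x" if x: "x \<in> \<Omega>" for x
  proof -
    have vx: "0 < v x" by (rule v(3)[OF x])
    have 1: "flux p ((\<phi> x / v x) *\<^sub>R Dv x) = (flux p (\<phi> x) * v x powr (1 - p)) *\<^sub>R flux p (Dv x)"
      by (simp add: flux_scaleR flux_divide[OF vx])
    have 2: "norm ((\<phi> x / v x) *\<^sub>R Dv x) powr p = \<bar>\<phi> x\<bar> powr p * v x powr (- p) * norm (Dv x) powr p"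
    proof -
      have "norm ((\<phi> x / v x) *\<^sub>R Dv x) = \<bar>\<phi> x\<bar> / v x * norm (Dv x)" using vx by simp
      then show ?thesis using vx by (simp only: powr_mult powr_divide) (simp add: powr_minus divide_inverse)
    qed
    show ?thesis unfolding L_def 1 2
      by (simp add: inner_add_right inner_flux_self algebra_simps)
  qed
  have Leq: "integrable \<L> L \<longleftrightarrow> integrable \<L> (\<lambda>x. norm (gradient \<phi> x) powr p - flux p (Dv x) \<bullet> ?D x)"
    "(LINT x|\<L>. L x) = (LINT x|\<L>. norm (gradient \<phi> x) powr p - flux p (Dv x) \<bullet> ?D x)"
    using L by (intro Bochner_Integration.integrable_cong Bochner_Integration.integral_cong; simp)+
  show "integrable \<L> L"
    unfolding Leq using i1 i3 by (rule Bochner_Integration.integrable_diff)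
  have "(LINT x|\<L>. L x) = Lp_energy p \<Omega> (gradient \<phi>) - (LINT x|\<L>. flux p (Dv x) \<bullet> ?D x)"
    unfolding Leq(2) Lp_energy_def using i1 i3 by (rule Bochner_Integration.integral_diff)
  also have "(LINT x|\<L>. flux p (Dv x) \<bullet> ?D x) = (LBINT x. flux p (Dv x) \<bullet> ?D x)"
    using i2 zD by (intro integral_lebesgue_on_eq_lborel(1)) auto
  also have "\<dots> = lam * (LBINT x. v x powr (p - 1) * ?\<psi> x)" by (rule EL[OF \<psi>])
  also have "(LBINT x. v x powr (p - 1) * ?\<psi> x) = (LBINT x. \<bar>\<phi> x\<bar> powr p)"
  proof (rule Bochner_Integration.integral_cong[OF refl])
    fix x show "v x powr (p - 1) * ?\<psi> x = \<bar>\<phi> x\<bar> powr p"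
    proof (cases "x \<in> \<Omega>")
      case True
      then have "v x powr (p - 1) * v x powr (1 - p) = 1" using v(3)[of x] by (simp add: powr_add[symmetric])
      then show ?thesis by (simp add: mult.assoc[symmetric])
    qed (simp add: z)
  qed
  also have "\<dots> = Lp_energy p \<Omega> \<phi>"
    unfolding Lp_energy_def real_norm_def using M z by (intro integral_lebesgue_on_eq_lborel(1)[symmetric]) auto
  finally show "(LINT x|\<L>. L x) = Lp_energy p \<Omega> (gradient \<phi>) - lam * Lp_energy p \<Omega> \<phi>" .
qed

text \<open>The integrals of the nonnegative Picone remainders tend to
  \<open>Lp_energy p \<Omega> G - lam * Lp_energy p \<Omega> u\<close>, which is 0. In the limit the
  remainder of \<open>u\<close> itself vanishes, and the equality case determines the
  gradient.\<close>

lemma log_gradient_unique: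
  assumes v: "\<And>x. x \<in> \<Omega> \<Longrightarrow> has_gradient v (Dv x) x" "continuous_on \<Omega> Dv" "\<And>x. x \<in> \<Omega> \<Longrightarrow> 0 < v x"
    and EL: "\<And>\<psi> D. C1_compact \<Omega> \<psi> D \<Longrightarrow> (LBINT x. flux p (Dv x) \<bullet> D x) = lam * (LBINT x. v x powr (p - 1) * \<psi> x)"
    and x: "x \<in> \<Omega>"
  shows "Du x = (u x / v x) *\<^sub>R Dv x"
proof -
  obtain G where G: "W1p_0 p \<Omega> u G" "Lp_energy p \<Omega> G = lam * Lp_energy p \<Omega> u" "AE x in \<L>. G x = Du x"
    by (rule weak_gradient)
  have Lp: "in_Lp p \<Omega> u" "in_Lp p \<Omega> G" using G(1) by (auto simp: W1p_0_def W1p_def)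
  obtain \<Phi> where \<Phi>: "\<And>n. test_function \<Omega> (\<Phi> n)"
    "(\<lambda>n. Lp_energy p \<Omega> (\<lambda>x. \<Phi> n x - u x)) \<longlonglongrightarrow> 0" "(\<lambda>n. Lp_energy p \<Omega> (\<lambda>x. gradient (\<Phi> n) x - G x)) \<longlonglongrightarrow> 0"
    using G(1) by (auto simp: W1p_0_def)
  have Lp\<Phi>: "in_Lp p \<Omega> (\<Phi> n)" "in_Lp p \<Omega> (gradient (\<Phi> n))" for n
    using test_function_in_Lp[OF \<Phi>(1) fin] p by auto
  define L where "L n x = norm (gradient (\<Phi> n) x) powr p - p * (flux p ((\<Phi> n x / v x) *\<^sub>R Dv x) \<bullet> gradient (\<Phi> n) x)
      + (p - 1) * norm ((\<Phi> n x / v x) *\<^sub>R Dv x) powr p" for n x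
  have iL: "integrable \<L> (L n)" "(LINT x|\<L>. L n x) = Lp_energy p \<Omega> (gradient (\<Phi> n)) - lam * Lp_energy p \<Omega> (\<Phi> n)" for n
    using picone_integral[OF v EL \<Phi>(1)[of n]] by (simp_all add: L_def[abs_def])
  have L0: "0 \<le> L n x" for n x unfolding L_def by (rule picone_pointwise(1)[OF p])
  have "(\<lambda>n. (LINT x|\<L>. L n x)) \<longlonglongrightarrow> Lp_energy p \<Omega> G - lam * Lp_energy p \<Omega> u"
    unfolding iL by (intro tendsto_intros Lp_energy_tendsto[OF p Lp(1) Lp\<Phi>(1) \<Phi>(2)] Lp_energy_tendsto[OF p Lp(2) Lp\<Phi>(2) \<Phi>(3)])
  then have limL: "(\<lambda>n. (LINT x|\<L>. L n x)) \<longlonglongrightarrow> 0" using G(2) by simp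
  \<comment> \<open>Adding three nonnegative quantities whose integrals tend to 0 yields one
    subsequence along which all of them tend to 0 almost everywhere.\<close>
  define w where "w n x = norm (\<Phi> n x - u x) powr p + norm (gradient (\<Phi> n) x - G x) powr p + L n x" for n x
  have d: "integrable \<L> (\<lambda>x. norm (\<Phi> n x - u x) powr p)" "integrable \<L> (\<lambda>x. norm (gradient (\<Phi> n) x - G x) powr p)" for n
    using in_Lp_add[OF Lp\<Phi>(1)[of n] in_Lp_scaleR[OF Lp(1), of "-1"]] in_Lp_add[OF Lp\<Phi>(2)[of n] in_Lp_scaleR[OF Lp(2), of "-1"]] p
    by (simp_all add: in_Lp_def)
  have w0: "0 \<le> w n x" for n x using L0 by (simp add: w_def)
  have iw: "integrable \<L> (w n)" for n unfolding w_def using d iL by auto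
  have "(LINT x|\<L>. norm (w n x)) = Lp_energy p \<Omega> (\<lambda>x. \<Phi> n x - u x) + Lp_energy p \<Omega> (\<lambda>x. gradient (\<Phi> n) x - G x) + (LINT x|\<L>. L n x)" for n
  proof -
    have "(LINT x|\<L>. norm (w n x)) = (LINT x|\<L>. w n x)" using w0 by simp
    then show ?thesis unfolding w_def Lp_energy_def using d iL(1)[of n] by simp
  qed
  then have "(\<lambda>n. (LINT x|\<L>. norm (w n x))) \<longlonglongrightarrow> 0"
    using tendsto_add[OF tendsto_add[OF \<Phi>(2,3)] limL] by simp
  then obtain r :: "nat \<Rightarrow> nat" where r: "AE x in \<L>. (\<lambda>n. w (r n) x) \<longlonglongrightarrow> 0"
    using tendsto_L1_AE_subseq[of "\<L>" w, OF iw] by blast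
  have eq: "G x = (u x / v x) *\<^sub>R Dv x" if lim: "(\<lambda>n. w (r n) x) \<longlonglongrightarrow> 0" for x
  proof -
    have nz: "f \<longlonglongrightarrow> l" if "(\<lambda>n. norm (f n - l) powr p) \<longlonglongrightarrow> 0" for f :: "nat \<Rightarrow> 'b::euclidean_space" and l
    proof -
      have "(\<lambda>n. (norm (f n - l) powr p) powr (1 / p)) \<longlonglongrightarrow> 0"
        using p by (intro tendsto_zero_powrI[OF that tendsto_const]) auto
      then have "(\<lambda>n. norm (f n - l)) \<longlonglongrightarrow> 0" using p by (simp add: powr_powr)
      then show ?thesis by (simp add: tendsto_norm_zero_iff LIM_zero_iff)
    qed
    have 1: "(\<lambda>n. norm (\<Phi> (r n) x - u x) powr p) \<longlonglongrightarrow> 0"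
      by (rule tendsto_sandwich[OF _ _ tendsto_const lim]) (use L0 in \<open>auto simp: w_def\<close>)
    have 2: "(\<lambda>n. norm (gradient (\<Phi> (r n)) x - G x) powr p) \<longlonglongrightarrow> 0"
      by (rule tendsto_sandwich[OF _ _ tendsto_const lim]) (use L0 in \<open>auto simp: w_def\<close>)
    have 3: "(\<lambda>n. L (r n) x) \<longlonglongrightarrow> 0"
      by (rule tendsto_sandwich[OF _ _ tendsto_const lim]) (use L0 in \<open>auto simp: w_def\<close>)
    note l = nz[OF 1] nz[OF 2]
    have cp: "(\<lambda>n. flux p (f n)) \<longlonglongrightarrow> flux p a" if "f \<longlonglongrightarrow> a" for f and a :: 'a
      using continuous_on_tendsto_compose[OF continuous_flux[OF p] that] by simp
    have cn: "(\<lambda>n. norm (f n) powr p) \<longlonglongrightarrow> norm a powr p" if "f \<longlonglongrightarrow> a" for f and a :: 'a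
      unfolding inner_flux_self[symmetric] by (intro tendsto_inner cp that)
    have d: "(\<lambda>n. (\<Phi> (r n) x / v x) *\<^sub>R Dv x) \<longlonglongrightarrow> (u x / v x) *\<^sub>R Dv x"
      unfolding divide_inverse by (intro tendsto_scaleR tendsto_mult l tendsto_const)
    have "(\<lambda>n. L (r n) x) \<longlonglongrightarrow> norm (G x) powr p - p * (flux p ((u x / v x) *\<^sub>R Dv x) \<bullet> G x)
      + (p - 1) * norm ((u x / v x) *\<^sub>R Dv x) powr p"
      unfolding L_def by (intro tendsto_add tendsto_diff tendsto_mult tendsto_const tendsto_inner cn cp l d)
    then show ?thesis using LIMSEQ_unique[OF 3] picone_pointwise(2)[OF p] by metis
  qed
  have AE: "AE x in \<L>. Du x = (u x / v x) *\<^sub>R Dv x"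
    using r G(3) by eventually_elim (use eq in auto)
  have cv: "continuous_on \<Omega> v"
    using v(1) by (rule gradient_imp_continuous_on)
  have "continuous_on \<Omega> (\<lambda>x. Du x - (u x / v x) *\<^sub>R Dv x)"
    using v(3) by (intro continuous_intros cont_Du cont_u' cv v(2)) force
  then have "open (\<Omega> \<inter> (\<lambda>x. Du x - (u x / v x) *\<^sub>R Dv x) -` (- {0}))"
    by (rule continuous_open_preimage) auto
  moreover have "\<Omega> \<inter> (\<lambda>x. Du x - (u x / v x) *\<^sub>R Dv x) -` (- {0}) = {x \<in> \<Omega>. \<not> (Du x = (u x / v x) *\<^sub>R Dv x)}" by auto
  ultimately show ?thesis using AE_imp_everywhere[OF AE _ x] by simp
qed

text \<open>The difference of the logarithms has zero derivative on a convex set, hence is constant;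
  at the centre, which \<open>S\<close> fixes, the constant is 0.\<close>

lemma isometry_invariant:
  assumes S: "linear S" "\<And>x. norm (S x) = norm x" "\<And>x. S (S x) = x" and x: "x \<in> \<Omega>"
  shows "u (S x) = u x"
proof -
  note adj = isometry_involution_adjoint[OF S]
  have bl: "bounded_linear S" using S(1) by (simp add: linear_conv_bounded_linear)
  note cS = linear_continuous_on[OF bl]
  have S\<Omega>: "S x \<in> \<Omega>" if "x \<in> \<Omega>" for x using that S(2) by simp
  have dv: "has_gradient (\<lambda>x. u (S x)) (S (Du (S x))) x" if "x \<in> \<Omega>" for x
    by (rule has_derivative_eq_rhs[OF has_derivative_compose[OF bounded_linear_imp_has_derivative[OF bl] der_u[OF S\<Omega>[OF that]]]]) (simp add: adj)
  have cv: "continuous_on \<Omega> (\<lambda>x. S (Du (S x)))"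
    by (intro continuous_on_compose2[OF cS[of UNIV]] continuous_on_compose2[OF cont_Du] cS) (use S\<Omega> in auto)
  have pv: "0 < u (S x)" if "x \<in> \<Omega>" for x using pos_u[OF S\<Omega>[OF that]] .
  have main: "Du x = (u x / u (S x)) *\<^sub>R S (Du (S x))" if "x \<in> \<Omega>" for x
    by (rule log_gradient_unique[OF dv cv pv euler_lagrange_isometry[OF S] that])
  have "\<exists>c. \<forall>x\<in>\<Omega>. ln (u x) - ln (u (S x)) = c"
  proof (rule has_derivative_zero_constant[OF convex_ball])
    fix x assume x: "x \<in> \<Omega>"
    have ln: "(ln has_derivative (\<lambda>h. inverse y * h)) (at y)" if "y > 0" for y :: real
      using DERIV_ln[OF that] by (simp add: has_field_derivative_def)
    have "((\<lambda>x. ln (u x) - ln (u (S x))) has_derivative (\<lambda>h. inverse (u x) * (Du x \<bullet> h) - inverse (u (S x)) * (S (Du (S x)) \<bullet> h))) (at x)"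
      by (intro has_derivative_diff has_derivative_compose[OF der_u[OF x] ln[OF pos_u[OF x]]]
            has_derivative_compose[OF dv[OF x] ln[OF pv[OF x]]])
    moreover have "inverse (u x) * (Du x \<bullet> h) - inverse (u (S x)) * (S (Du (S x)) \<bullet> h) = 0" for h
      using pos_u[OF x] pv[OF x] by (subst main[OF x]) (simp add: field_simps)
    ultimately show "((\<lambda>x. ln (u x) - ln (u (S x))) has_derivative (\<lambda>h. 0)) (at x within \<Omega>)"
      by (simp add: has_derivative_at_withinI)
  qed
  then obtain c where c: "\<And>x. x \<in> \<Omega> \<Longrightarrow> ln (u x) - ln (u (S x)) = c" by blast
  have "c = 0" using c[of 0] R linear_0[OF S(1)] by simp
  then have "ln (u x) = ln (u (S x))" using c[OF x] by simp
  then show ?thesis using pos_u[OF x] pv[OF x] by simp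
qed

lemma radial:
  assumes "x \<in> \<Omega>" "norm y = norm x"
  shows "u y = u x"
proof (cases "x = y")
  case False
  \<comment> \<open>The reflection in the hyperplane orthogonal to \<open>x - y\<close> exchanges
    \<open>x\<close> and \<open>y\<close>, because they have equal norms.\<close>
  define e where "e = (x - y) /\<^sub>R norm (x - y)"
  have e: "e \<bullet> e = 1" using False by (simp add: e_def dot_square_norm power2_eq_square)
  define S where "S z = z - (2 * (z \<bullet> e)) *\<^sub>R e" for z
  have lin: "linear S" unfolding S_def by (rule linearI) (simp_all add: inner_add_left algebra_simps)
  have inv: "S (S z) = z" for z by (simp add: S_def inner_diff_left e algebra_simps)
  have "S z \<bullet> S z = z \<bullet> z" for z
    by (simp add: S_def inner_diff_left inner_diff_right e inner_commute algebra_simps)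
  then have norm: "norm (S z) = norm z" for z by (simp add: norm_eq_sqrt_inner)
  have "x \<bullet> x = y \<bullet> y" using assms(2) by (simp add: dot_square_norm)
  then have "2 * (x \<bullet> (x - y)) = (norm (x - y))\<^sup>2"
    by (simp add: power2_norm_eq_inner inner_diff_left inner_diff_right inner_commute)
  then have "2 * (x \<bullet> e) = norm (x - y)"
    using False by (simp only: e_def inner_scaleR_right) (simp add: power2_eq_square field_simps)
  then have "(2 * (x \<bullet> e)) *\<^sub>R e = x - y"
    using False by (simp add: e_def)
  then have "S x = y" by (simp add: S_def)
  then show ?thesis using isometry_invariant[OF lin norm inv assms(1)] by simp
qed simp

end

section \<open>The radial equation\<close>

lemma integral_radial_interval:
  fixes F :: "real \<Rightarrow> real"
  assumes F: "continuous_on {0..b} F"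
  shows "(LBINT x. indicator (cball 0 b) x * F (norm (x::'a::euclidean_space)))
    = DIM('a) * unit_ball_vol (DIM('a)) * integral {0..b} (\<lambda>r. r ^ (DIM('a) - 1) * F r)"
proof -
  have "integrable lborel (\<lambda>r. indicator {0..b} r *\<^sub>R F r)"
    by (intro integrable_indicator_scaleR F) simp
  then have m: "(\<lambda>r. indicator {0..b} r * F r) \<in> borel_measurable borel" by auto
  have i: "set_integrable lborel {0..b} (\<lambda>r. r ^ (DIM('a) - 1) * F r)"
    unfolding set_integrable_def
    by (intro integrable_indicator_scaleR continuous_intros F) simp
  have "(LBINT x. indicator (cball 0 b) x * F (norm (x::'a))) = (LBINT x. indicator {0..b} (norm (x::'a)) * F (norm x))"
    by (intro Bochner_Integration.integral_cong) (auto split: split_indicator)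
  also have "\<dots> = DIM('a) * unit_ball_vol (DIM('a)) * (LBINT r. indicator {0..} r * (r ^ (DIM('a) - 1) * (indicator {0..b} r * F r)))"
    by (rule integral_radial[OF m])
  also have "(LBINT r. indicator {0..} r * (r ^ (DIM('a) - 1) * (indicator {0..b} r * F r)))
     = (LINT r:{0..b}|lborel. r ^ (DIM('a) - 1) * F r)"
    unfolding set_lebesgue_integral_def
    by (intro Bochner_Integration.integral_cong) (auto split: split_indicator)
  also have "\<dots> = integral {0..b} (\<lambda>r. r ^ (DIM('a) - 1) * F r)"
    by (rule set_borel_integral_eq_integral(2)[OF i])
  finally show ?thesis .
qed

text \<open>Builds radial test functions from a prescribed derivative. As \<open>w\<close> vanishes
  up to \<open>a > 0\<close>, the antiderivative is constant near 0, and composing it with the norm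
  causes no singularity at the origin.\<close>

lemma antiderivative_compact_support:
  fixes w :: "real \<Rightarrow> real"
  assumes w: "continuous_on UNIV w" "\<And>r. r \<le> a \<or> b \<le> r \<Longrightarrow> w r = 0" and ab: "0 < a" "a < b"
  obtains \<eta> where "\<And>r. (\<eta> has_real_derivative w r) (at r)" "\<And>r. b \<le> r \<Longrightarrow> \<eta> r = 0"
proof -
  \<comment> \<open>For negative \<open>r\<close> the interval is empty and the integral is 0, which
    agrees with \<open>w\<close> vanishing there.\<close>
  define W where "W r = integral {0..r} w" for r
  have int: "w integrable_on {c..d}" for c d
    by (intro integrable_continuous_real continuous_on_subset[OF w(1)]) auto
  have W0: "W r = 0" if "r \<le> a" for r
  proof -
    have "integral {0..r} w = integral {0..r} (\<lambda>_. 0)"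
      using that w(2) by (intro Henstock_Kurzweil_Integration.integral_cong) auto
    then show ?thesis by (simp add: W_def)
  qed
  have der: "DERIV W r :> w r" for r
  proof (cases "r < a")
    case True
    have "DERIV (\<lambda>_. 0) r :> w r" using True w(2)[of r] by simp
    then show ?thesis
      by (rule has_field_derivative_transform_within_open[of _ _ _ "{..<a}"]) (use True W0 in auto)
  next
    case False
    have "(W has_real_derivative w r) (at r within {0..r + 1})"
      unfolding W_def using False ab by (intro integral_has_real_derivative continuous_on_subset[OF w(1)]) auto
    then show ?thesis using False ab at_within_interior[of r "{0..r + 1}"] by simp
  qed
  have "W r = W b" if "b \<le> r" for r
  proof -
    have "integral {b..r} w = integral {b..r} (\<lambda>_. 0)"
      using w(2) by (intro Henstock_Kurzweil_Integration.integral_cong) auto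
    then show ?thesis using Henstock_Kurzweil_Integration.integral_combine[of 0 b r w] int that ab by (simp add: W_def)
  qed
  note const = this
  show ?thesis
  proof (rule that)
    show "DERIV (\<lambda>r. W r - W b) r :> w r" for r
      using DERIV_diff[OF der[of r] DERIV_const[of "W b"]] by simp
    show "W r - W b = 0" if "b \<le> r" for r
      using const[OF that] by simp
  qed
qed

lemma norm_some_Basis [simp]: "norm (SOME b. b \<in> (Basis::'a::euclidean_space set)) = 1"
  using some_in_eq[of "Basis::'a set"] by simp

lemma flux_sgn: "flux p (sgn (x::'a::euclidean_space)) = sgn x"
  by (simp add: flux_def norm_sgn)

section \<open>The radial profile and its integrated equation\<close>

context ball_eigenfunction
begin

abbreviation U :: "real \<Rightarrow> real" where "U \<equiv> profile u"
abbreviation e\<^sub>0 :: 'a where "e\<^sub>0 \<equiv> SOME b. b \<in> Basis"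
text \<open>This is the derivative of \<open>U\<close>; written as a component of \<open>Du\<close>,
  it inherits continuity from the gradient.\<close>

definition V :: "real \<Rightarrow> real" where "V r = Du (r *\<^sub>R e\<^sub>0) \<bullet> e\<^sub>0"

lemma u_eq_profile: "x \<in> \<Omega> \<Longrightarrow> u x = U (norm x)"
  unfolding profile_def by (rule radial) auto

lemma profile_pos: "\<bar>r\<bar> < R \<Longrightarrow> 0 < U r"
  unfolding profile_def by (rule pos_u) simp

lemma profile_R: "U R = 0"
  unfolding profile_def using R by (intro boundary_u) simp

lemma DERIV_profile:
  assumes "\<bar>r\<bar> < R" shows "DERIV U r :> V r"
proof -
  have "((\<lambda>r. u (r *\<^sub>R e\<^sub>0)) has_derivative (\<lambda>h. Du (r *\<^sub>R e\<^sub>0) \<bullet> (h *\<^sub>R e\<^sub>0))) (at r)"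
    by (rule has_derivative_compose[OF _ der_u]) (use assms in \<open>auto intro!: derivative_eq_intros\<close>)
  then show ?thesis
    unfolding has_field_derivative_def profile_def[abs_def] V_def
    by (rule has_derivative_eq_rhs) (simp add: fun_eq_iff mult.commute)
qed

lemma continuous_profile: "continuous_on {0..R} U"
  unfolding profile_def[abs_def] by (rule continuous_on_compose2[OF cont_u]) (auto intro!: continuous_intros)

lemma continuous_profile_powr:
  assumes "b < R" shows "continuous_on {0..b} (\<lambda>s. U s powr q)"
proof (intro continuous_on_powr' continuous_on_subset[OF continuous_profile] continuous_on_const ballI)
  fix s assume "s \<in> {0..b}"
  then have "0 < U s" using assms by (intro profile_pos) auto
  then show "0 \<le> U s \<and> (U s = 0 \<longrightarrow> 0 < q)" by simp
qed (use assms in auto)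

lemma continuous_V: "continuous_on {-R<..<R} V"
  unfolding V_def[abs_def] by (intro continuous_intros continuous_on_compose2[OF cont_Du]) auto

lemma continuous_flux_V: "continuous_on {-R<..<R} (\<lambda>r. flux p (V r))"
  by (rule continuous_on_compose2[OF continuous_flux[OF p] continuous_V]) simp

text \<open>Radiality makes \<open>u\<close> even, so its derivative at the centre equals its own
  negative.\<close>

lemma gradient_0: "Du 0 = 0"
proof -
  have d: "has_gradient u (Du 0) 0" using R by (intro der_u) simp
  have "((\<lambda>x. u (- x)) has_derivative (\<lambda>h. Du 0 \<bullet> (- h))) (at 0)"
    by (rule has_derivative_compose[where g = u and g' = "\<lambda>h. Du 0 \<bullet> h"]) (use d in \<open>auto intro!: derivative_eq_intros\<close>)
  then have "(u has_derivative (\<lambda>h. Du 0 \<bullet> (- h))) (at 0)"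
    by (rule has_derivative_transform_within_open[OF _ open_ball[of 0 R]]) (use R in \<open>auto intro: radial\<close>)
  then have "Du 0 \<bullet> (- h) = Du 0 \<bullet> h" for h using has_derivative_unique[OF d] by metis
  from this[of "Du 0"] show ?thesis by simp
qed

lemma V_0: "V 0 = 0"
  by (simp add: V_def gradient_0)

lemma gradient_radial:
  assumes "x \<in> \<Omega>" shows "Du x = V (norm x) *\<^sub>R sgn x"
proof (cases "x = 0")
  case False
  have "((\<lambda>x. U (norm x)) has_derivative (\<lambda>h. V (norm x) * (sgn x \<bullet> h))) (at x)"
    using assms DERIV_profile[of "norm x"]
    by (intro has_derivative_compose[OF has_derivative_eq_rhs[OF has_derivative_norm[OF False]]])
       (auto simp: has_field_derivative_def inner_commute)
  then have "(u has_derivative (\<lambda>h. V (norm x) * (sgn x \<bullet> h))) (at x)"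
    by (rule has_derivative_transform_within_open[OF _ open_ball assms]) (simp add: u_eq_profile)
  then show ?thesis by (intro gradient_eqI) simp
qed (simp add: gradient_0)

text \<open>Testing the weak equation with \<open>\<eta> (norm x)\<close>, where \<open>\<eta>\<close> is constant near \<open>0\<close>
  and vanishes near the boundary.\<close>

lemma euler_lagrange_radial:
  assumes ab: "0 < a" "a < b" "b < R"
    and \<eta>: "\<And>r. (\<eta> has_real_derivative w r) (at r)" "continuous_on UNIV w"
    "\<And>r. b \<le> r \<Longrightarrow> \<eta> r = 0" "\<And>r. r \<le> a \<or> b \<le> r \<Longrightarrow> w r = 0"
  shows "integral {0..b} (\<lambda>r. r ^ (DIM('a) - 1) * (flux p (V r) * w r))
    = lam * integral {0..b} (\<lambda>r. r ^ (DIM('a) - 1) * (U r powr (p - 1) * \<eta> r))"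
proof -
  define D where "D x = w (norm x) *\<^sub>R sgn x" for x :: 'a
  have "C1_compact \<Omega> (\<lambda>x. \<eta> (norm x)) D"
  proof (rule C1_compactI[OF open_ball])
    show "compact (cball (0::'a) b)" "cball (0::'a) b \<subseteq> \<Omega>" using ab by auto
    show "\<eta> (norm x) = 0" "D x = 0" if "x \<notin> cball 0 b" for x using \<eta>(3,4)[of "norm x"] that by (auto simp: D_def)
    fix x assume "x \<in> \<Omega>"
    show "has_gradient (\<lambda>x. \<eta> (norm x)) (D x) x"
    proof (cases "x = 0")
      case False
      have "((\<lambda>x. \<eta> (norm x)) has_derivative (\<lambda>h. w (norm x) * (sgn x \<bullet> h))) (at x)"
        using \<eta>(1)[of "norm x"]
        by (intro has_derivative_compose[OF has_derivative_eq_rhs[OF has_derivative_norm[OF False]]])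
           (auto simp: has_field_derivative_def inner_commute)
      then show ?thesis by (simp add: D_def)
    next
      case True
      have c: "\<eta> r = \<eta> 0" if "0 \<le> r" "r < a" for r
      proof (cases "r = 0")
        case False
        then have "0 < r" using that by simp
        then obtain z where "z < r" "\<eta> r - \<eta> 0 = (r - 0) * w z"
          using MVT2[OF \<open>0 < r\<close>, of \<eta> w] \<eta>(1) by blast
        then show ?thesis using that \<eta>(4)[of z] by simp
      qed simp
      have "has_gradient (\<lambda>x. \<eta> 0) (D x) x" by (simp add: D_def True)
      then show ?thesis
      proof (rule has_derivative_transform_within_open[OF _ open_ball[of 0 a]])
        show "x \<in> ball 0 a" using True ab by simp
        show "\<eta> 0 = \<eta> (norm y)" if "y \<in> ball 0 a" for y :: 'a
          using c[of "norm y"] that by simp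
      qed
    qed
  next
    have "closed {x::'a. a \<le> norm x}" by (intro closed_Collect_le continuous_intros)
    then have "continuous_on UNIV D"
      using ab by (rule_tac continuous_on_zero_extend[where S = "- {0}" and K = "{x. a \<le> norm x}"])
        (auto simp: D_def \<eta>(4) intro!: continuous_intros continuous_on_compose2[OF \<eta>(2)])
    then show "continuous_on \<Omega> D" using continuous_on_subset by blast
  qed
  note EL = euler_lagrange[OF this]
  have cV: "continuous_on {0..b} (\<lambda>r. flux p (V r))"
    by (rule continuous_on_subset[OF continuous_flux_V]) (use ab in auto)
  have c\<eta>: "continuous_on {0..b} \<eta>"
    using \<eta>(1) by (auto intro!: continuous_at_imp_continuous_on dest: DERIV_isCont)
  have cU: "continuous_on {0..b} (\<lambda>r. U r powr (p - 1))"
    by (rule continuous_profile_powr[OF ab(3)])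
  have 1: "(LBINT x. flux p (Du x) \<bullet> D x) = (LBINT x. indicator (cball 0 b) x * (flux p (V (norm (x::'a))) * w (norm x)))"
  proof (intro Bochner_Integration.integral_cong refl)
    fix x :: 'a
    show "flux p (Du x) \<bullet> D x = indicator (cball 0 b) x * (flux p (V (norm x)) * w (norm x))"
    proof (cases "x \<in> cball 0 b \<and> x \<noteq> 0")
      case True
      then have "x \<in> \<Omega>" using ab by auto
      then show ?thesis using True
        by (simp add: D_def gradient_radial flux_scaleR flux_sgn dot_square_norm norm_sgn)
    next
      case False
      then have "w (norm x) = 0" using \<eta>(4)[of "norm x"] ab by auto
      then show ?thesis by (simp add: D_def)
    qed
  qed
  have 2: "(LBINT x. u x powr (p - 1) * \<eta> (norm x)) = (LBINT x. indicator (cball 0 b) x * (U (norm (x::'a)) powr (p - 1) * \<eta> (norm x)))"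
  proof (intro Bochner_Integration.integral_cong refl)
    fix x :: 'a
    show "u x powr (p - 1) * \<eta> (norm x) = indicator (cball 0 b) x * (U (norm x) powr (p - 1) * \<eta> (norm x))"
    proof (cases "x \<in> cball 0 b")
      case True
      then have "x \<in> \<Omega>" using ab by auto
      then show ?thesis using True by (simp add: u_eq_profile)
    next
      case False
      then show ?thesis using \<eta>(3)[of "norm x"] by simp
    qed
  qed
  have "DIM('a) * unit_ball_vol (DIM('a)) * integral {0..b} (\<lambda>r. r ^ (DIM('a) - 1) * (flux p (V r) * w r))
    = lam * (DIM('a) * unit_ball_vol (DIM('a)) * integral {0..b} (\<lambda>r. r ^ (DIM('a) - 1) * (U r powr (p - 1) * \<eta> r)))"
    using EL unfolding 1 2
    by (subst (asm) (1 2) integral_radial_interval) (auto intro!: continuous_intros cV cU c\<eta> continuous_on_subset[OF \<eta>(2)])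
  moreover have "DIM('a) * unit_ball_vol (DIM('a)) \<noteq> 0"
    using unit_ball_vol_pos[of "real (DIM('a))"] DIM_positive[where 'a='a] by (simp add: less_imp_neq[symmetric])
  ultimately show ?thesis by (simp add: mult.left_commute)
qed

text \<open>Up to the area constant, the total inward flux through the sphere of radius
  \<open>r\<close>. It is differentiable by the fundamental theorem of calculus, whereas
  \<open>V\<close> is only known to be continuous.\<close>

definition \<Phi> :: "real \<Rightarrow> real" where
  "\<Phi> r = lam * integral {0..r} (\<lambda>s. s ^ (DIM('a) - 1) * U s powr (p - 1))"

lemma continuous_density: "b < R \<Longrightarrow> continuous_on {0..b} (\<lambda>s. s ^ (DIM('a) - 1) * U s powr (p - 1))"
  by (intro continuous_on_mult continuous_on_power continuous_on_id continuous_profile_powr)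

lemma DERIV_\<Phi>_within: "b < R \<Longrightarrow> r \<in> {0..b} \<Longrightarrow> (\<Phi> has_real_derivative lam * (r ^ (DIM('a) - 1) * U r powr (p - 1))) (at r within {0..b})"
  unfolding \<Phi>_def[abs_def] by (intro DERIV_cmult integral_has_real_derivative continuous_density)

lemma DERIV_\<Phi>:
  assumes "0 < r" "r < R" shows "DERIV \<Phi> r :> lam * (r ^ (DIM('a) - 1) * U r powr (p - 1))"
  using DERIV_\<Phi>_within[of "(r + R) / 2" r] assms at_within_interior[of r "{0..(r + R) / 2}"] by simp

lemma radial_ode:
  assumes r: "0 < r" "r < R"
  shows "r ^ (DIM('a) - 1) * flux p (V r) = - \<Phi> r"
proof -
  define a b where "a = r / 2" and "b = (r + R) / 2"
  have ab: "0 < a" "a < r" "r < b" "b < R" using r by (auto simp: a_def b_def)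
  \<comment> \<open>\<open>k\<close> is the defect of the claimed identity. Testing with an
    antiderivative of \<open>k\<close> times a cutoff positive on \<open>(a, b)\<close> gives a
    nonnegative continuous integrand \<open>k s * w s\<close> with integral 0.\<close>
  define k where "k s = s ^ (DIM('a) - 1) * flux p (V s) + \<Phi> s" for s
  define w where "w s = max 0 (s - a) * max 0 (b - s) * k s" for s
  have c\<Phi>: "continuous_on {0<..<R} \<Phi>"
    using DERIV_\<Phi> by (intro continuous_at_imp_continuous_on ballI) (auto intro: DERIV_isCont)
  have ck: "continuous_on {0<..<R} k"
    unfolding k_def[abs_def]
    by (intro continuous_intros c\<Phi> continuous_on_subset[OF continuous_flux_V]) auto
  have w0: "w s = 0" if "s \<le> a \<or> b \<le> s" for s using that by (auto simp: w_def)
  have cw: "continuous_on UNIV w"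
    using ab by (intro continuous_on_zero_extend[where S = "{0<..<R}" and K = "{a..b}"])
      (auto simp: w0 w_def[abs_def] intro!: continuous_intros ck)
  obtain \<eta> where \<eta>: "\<And>r. (\<eta> has_real_derivative w r) (at r)" "\<And>r. b \<le> r \<Longrightarrow> \<eta> r = 0"
    using antiderivative_compact_support[OF cw w0] ab by (metis less_trans)
  have "a < b" using ab by simp
  note EL = euler_lagrange_radial[OF ab(1) this ab(4) \<eta>(1) cw \<eta>(2) w0]
  have cV: "continuous_on {0..b} (\<lambda>r. flux p (V r))"
    by (rule continuous_on_subset[OF continuous_flux_V]) (use ab in auto)
  have c\<Phi>b: "continuous_on {0..b} \<Phi>" using DERIV_\<Phi>_within[OF ab(4)] by (rule DERIV_continuous_on)
  have c\<eta>: "continuous_on {0..b} \<eta>"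
    using \<eta>(1) by (auto intro!: continuous_at_imp_continuous_on dest: DERIV_isCont)
  note cw' = continuous_on_subset[OF cw subset_UNIV, of "{0..b}"]
  \<comment> \<open>Integration by parts for \<open>\<Phi> s * \<eta> s\<close>; the boundary terms
    vanish because \<open>\<Phi> 0 = 0\<close> and \<open>\<eta> b = 0\<close>.\<close>
  have "((\<lambda>s. lam * (s ^ (DIM('a) - 1) * U s powr (p - 1)) * \<eta> s + \<Phi> s * w s) has_integral (\<Phi> b * \<eta> b - \<Phi> 0 * \<eta> 0)) {0..b}"
  proof (rule fundamental_theorem_of_calculus)
    show "0 \<le> b" using ab by simp
    fix s assume s: "s \<in> {0..b}"
    show "((\<lambda>s. \<Phi> s * \<eta> s) has_vector_derivative lam * (s ^ (DIM('a) - 1) * U s powr (p - 1)) * \<eta> s + \<Phi> s * w s) (at s within {0..b})"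
      unfolding has_real_derivative_iff_has_vector_derivative[symmetric]
      using DERIV_mult[OF DERIV_\<Phi>_within[OF ab(4) s] has_field_derivative_at_within[OF \<eta>(1)]] by (simp add: mult.commute add.commute)
  qed
  then have ibp: "integral {0..b} (\<lambda>s. lam * (s ^ (DIM('a) - 1) * U s powr (p - 1)) * \<eta> s + \<Phi> s * w s) = 0"
    using \<eta>(2)[of b] by (simp add: \<Phi>_def integral_unique)
  have i1: "(\<lambda>s. lam * (s ^ (DIM('a) - 1) * U s powr (p - 1)) * \<eta> s) integrable_on {0..b}"
    by (intro integrable_continuous_real continuous_intros continuous_density c\<eta> ab)
  have i2: "(\<lambda>s. \<Phi> s * w s) integrable_on {0..b}" "(\<lambda>s. s ^ (DIM('a) - 1) * (flux p (V s) * w s)) integrable_on {0..b}"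
    by (intro integrable_continuous_real continuous_intros c\<Phi>b cw' cV)+
  have "integral {0..b} (\<lambda>s. k s * w s) = integral {0..b} (\<lambda>s. s ^ (DIM('a) - 1) * (flux p (V s) * w s)) + integral {0..b} (\<lambda>s. \<Phi> s * w s)"
    by (subst Henstock_Kurzweil_Integration.integral_add[symmetric, OF i2(2,1)]) (simp add: k_def algebra_simps)
  also have "\<dots> = integral {0..b} (\<lambda>s. lam * (s ^ (DIM('a) - 1) * U s powr (p - 1)) * \<eta> s) + integral {0..b} (\<lambda>s. \<Phi> s * w s)"
    using EL by (simp add: mult.assoc)
  also have "\<dots> = 0" using ibp Henstock_Kurzweil_Integration.integral_add[OF i1 i2(1)] by simp
  finally have "integral {0..b} (\<lambda>s. k s * w s) = 0" .
  moreover have "continuous_on {0..b} (\<lambda>s. k s * w s)"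
    unfolding k_def by (intro continuous_intros c\<Phi>b cw' cV)
  moreover have "0 \<le> k s * w s" for s by (simp add: w_def mult.left_commute[of "k s"])
  ultimately have "k r * w r = 0"
    using integral_eq_0_iff[of 0 b "\<lambda>s. k s * w s"] ab by auto
  then have "k r = 0" using ab by (auto simp: w_def max_def split: if_splits)
  then show ?thesis by (simp add: k_def)
qed

text \<open>With eigenvalue 0 the integrated equation forces \<open>V = 0\<close>, so the profile
  would be constant, contradicting its zero at \<open>R\<close> and its positivity at 0.\<close>

lemma lam_pos: "0 < lam"
proof (rule ccontr)
  assume "\<not> 0 < lam"
  then have "lam = 0" using lam_nonneg by simp
  then have V0: "V r = 0" if "0 < r" "r < R" for r
    using radial_ode[OF that] that norm_flux[of p "V r"] by (simp add: \<Phi>_def)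
  have der: "DERIV U r :> 0" if "0 < r" "r < R" for r
    using DERIV_profile[of r] V0[OF that] that by simp
  have "U R = U 0"
    using DERIV_isconst2[OF R continuous_profile der, of R] R by simp
  then show False using profile_R profile_pos[of 0] R by simp
qed

lemma \<Phi>_pos:
  assumes "0 < r" "r < R" shows "0 < \<Phi> r"
proof -
  let ?f = "\<lambda>s. s ^ (DIM('a) - 1) * U s powr (p - 1)"
  have "0 < U r" using assms by (intro profile_pos) simp
  then have "?f r \<noteq> 0" using assms by simp
  moreover have "integral {0..r} ?f = 0 \<longleftrightarrow> (\<forall>s\<in>{0..r}. ?f s = 0)"
    using assms by (intro integral_eq_0_iff continuous_density) auto
  ultimately have "integral {0..r} ?f \<noteq> 0" using assms by (metis atLeastAtMost_iff less_imp_le order_refl)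
  moreover have "0 \<le> integral {0..r} ?f"
    using continuous_density[OF assms(2)] by (intro integral_nonneg integrable_continuous_real) auto
  ultimately show ?thesis using lam_pos by (simp add: \<Phi>_def)
qed

lemma V_neg:
  assumes "0 < r" "r < R" shows "V r < 0"
proof -
  have "0 < r ^ (DIM('a) - 1)" using assms by simp
  moreover have "r ^ (DIM('a) - 1) * flux p (V r) < 0" using radial_ode[OF assms] \<Phi>_pos[OF assms] by simp
  ultimately have "flux p (V r) < 0" by (meson mult_nonneg_nonneg less_imp_le not_less)
  then show ?thesis by (simp add: flux_def mult_less_0_iff split: if_splits)
qed

lemma radial_ode_powr:
  assumes "0 < r" "r < R"
  shows "(- V r) powr (p - 1) = \<Phi> r / r ^ (DIM('a) - 1)"
proof -
  have "flux p (V r) = - ((- V r) powr (p - 1))"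
    using V_neg[OF assms] flux_pos[of "- V r" p] by (simp add: flux_def)
  then show ?thesis using radial_ode[OF assms] assms by (simp add: field_simps)
qed

end

section \<open>Convexity of the radial flux\<close>

text \<open>The form in which integrating factors are exploited: the functions are singular at 0, so
  their initial value enters as a one-sided limit.\<close>

lemma positive_of_DERIV_pos:
  fixes f :: "real \<Rightarrow> real"
  assumes lim: "(f \<longlongrightarrow> 0) (at_right 0)" and der: "\<And>s. 0 < s \<Longrightarrow> s < b \<Longrightarrow> (f has_real_derivative f' s) (at s)"
    and pos: "\<And>s. 0 < s \<Longrightarrow> s < r \<Longrightarrow> 0 < f' s" and r: "0 < r" "r < b"
  shows "0 < f r"
proof -
  have mono: "f s < f t" if st: "0 < s" "s < t" "t \<le> r" for s t
  proof -
    obtain z where z: "s < z" "z < t" "f t - f s = (t - s) * f' z"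
      using MVT2[OF st(2), of f f'] der st r by force
    have "0 < (t - s) * f' z" using pos[of z] st z by (intro mult_pos_pos) auto
    then show ?thesis using z(3) by linarith
  qed
  have "0 \<le> f (r / 2)"
  proof (rule tendsto_upperbound[OF lim])
    show "\<forall>\<^sub>F s in at_right 0. f s \<le> f (r / 2)"
      unfolding eventually_at_right_field using r mono[of _ "r / 2"] by (intro exI[of _ "r / 2"]) (auto intro: less_imp_le)
  qed simp
  also have "\<dots> < f r" using r by (intro mono) auto
  finally show ?thesis .
qed

context ball_eigenfunction
begin

abbreviation q :: "real \<Rightarrow> real" where "q \<equiv> q_of u"
abbreviation Q :: "real \<Rightarrow> real" where "Q \<equiv> Q_of p u"
definition m :: "real \<Rightarrow> real" where "m r = Q r / r"
text \<open>The right-hand side of the Riccati equation for \<open>Q\<close>. The product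
  \<open>q r * Q r\<close> stands for the power p/(p-1) of \<open>Q r\<close>.\<close>

definition Q1 :: "real \<Rightarrow> real" where "Q1 r = lam + (p - 1) * (q r * Q r) - (real DIM('a) - 1) * m r"
text \<open>This is r times the derivative of \<open>m\<close>, so its sign decides the monotonicity
  of \<open>m\<close>.\<close>

definition g :: "real \<Rightarrow> real" where "g r = Q1 r - m r"

section \<open>The Riccati equation and its consequences by differentiation\<close>

lemma N_ge_1: "1 \<le> real DIM('a)"
  using DIM_positive[where 'a='a] by linarith

lemma q_eq: "\<bar>r\<bar> < R \<Longrightarrow> q r = - V r / U r"
  using DERIV_imp_deriv[OF DERIV_profile] by (simp add: q_of_def)

lemma Q_0: "Q 0 = 0"
  using R by (simp add: Q_of_def q_eq V_0)

lemma q_pos: "0 < r \<Longrightarrow> r < R \<Longrightarrow> 0 < q r"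
  using V_neg[of r] profile_pos[of r] by (simp add: q_eq divide_neg_pos)

lemma Q_pos: "0 < r \<Longrightarrow> r < R \<Longrightarrow> 0 < Q r"
  using q_pos[of r] by (simp add: Q_of_def)

lemma m_pos: "0 < r \<Longrightarrow> r < R \<Longrightarrow> 0 < m r"
  using Q_pos[of r] by (simp add: m_def)

lemma q_eq_Q: "0 < r \<Longrightarrow> r < R \<Longrightarrow> q r = Q r powr (1 / (p - 1))"
  using q_pos[of r] p by (simp add: Q_of_def powr_powr)

text \<open>Numerator and denominator have known derivatives, so \<open>Q\<close> can be
  differentiated through this quotient although \<open>V\<close> cannot be differentiated
  directly.\<close>

lemma Q_eq:
  assumes "0 < r" "r < R" shows "Q r = \<Phi> r / (r ^ (DIM('a) - 1) * U r powr (p - 1))"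
proof -
  have "Q r = ((- V r) / U r) powr (p - 1)" using assms by (simp add: Q_of_def q_eq)
  also have "\<dots> = (- V r) powr (p - 1) / U r powr (p - 1)"
    by (rule powr_divide)
  finally show ?thesis using radial_ode_powr[OF assms] by simp
qed

text \<open>Dividing by \<open>r\<close> instead of lowering the exponent avoids truncated
  subtraction on the naturals when the dimension is 1.\<close>

lemma DERIV_power_dim:
  assumes "0 < r" shows "DERIV (\<lambda>r. r ^ (DIM('a) - 1)) r :> (real DIM('a) - 1) * r ^ (DIM('a) - 1) / r"
proof -
  have "(real DIM('a) - 1) * r ^ (DIM('a) - 1) / r = real (DIM('a) - 1) * r ^ (DIM('a) - 1 - Suc 0)"
  proof -
    obtain n where n: "DIM('a) = Suc n" using DIM_positive[where 'a='a] gr0_conv_Suc by blast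
    show ?thesis unfolding n using assms by (cases n) auto
  qed
  then show ?thesis using DERIV_pow[of "DIM('a) - 1" r UNIV] by simp
qed

lemma DERIV_profile_powr:
  assumes "0 < r" "r < R" shows "DERIV (\<lambda>r. U r powr a) r :> - a * q r * U r powr a"
proof -
  have U: "0 < U r" using assms by (intro profile_pos) auto
  have "DERIV (\<lambda>r. U r powr a) r :> a * U r powr (a - 1) * V r"
    using DERIV_chain2[OF has_real_derivative_powr[OF U, of a] DERIV_profile[of r]] assms by simp
  moreover have "a * U r powr (a - 1) * V r = - a * q r * U r powr a"
    using U assms by (simp add: q_eq powr_diff)
  ultimately show ?thesis by simp
qed

lemma DERIV_Q:
  assumes r: "0 < r" "r < R" shows "DERIV Q r :> Q1 r"
proof -
  have U: "0 < U r" using r by (intro profile_pos) auto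
  define w where "w = (\<lambda>r. r ^ (DIM('a) - 1) * U r powr (p - 1))"
  have w: "w r > 0" using U r by (simp add: w_def)
  \<comment> \<open>The two terms of this logarithmic derivative become the damping term and the
    superlinear term of the Riccati equation.\<close>
  have dw: "DERIV w r :> w r * ((real DIM('a) - 1) / r - (p - 1) * q r)"
    unfolding w_def
    by (rule DERIV_cong[OF DERIV_mult[OF DERIV_power_dim[OF r(1)] DERIV_profile_powr[OF r, of "p - 1"]]])
       (simp add: algebra_simps)
  have d\<Phi>: "DERIV \<Phi> r :> lam * w r"
    using DERIV_\<Phi>[OF r] by (simp add: w_def)
  have "DERIV (\<lambda>r. \<Phi> r / w r) r :> (lam * w r * w r - \<Phi> r * (w r * ((real DIM('a) - 1) / r - (p - 1) * q r))) / (w r * w r)"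
    by (rule DERIV_divide[OF d\<Phi> dw]) (use w in simp)
  moreover have "(lam * w r * w r - \<Phi> r * (w r * ((real DIM('a) - 1) / r - (p - 1) * q r))) / (w r * w r) = Q1 r"
  proof -
    have "Q r = \<Phi> r / w r" unfolding w_def by (rule Q_eq[OF r])
    then have "\<Phi> r = Q r * w r" using w by simp
    then show ?thesis using w r by (simp add: Q1_def m_def divide_simps) (simp add: algebra_simps)
  qed
  ultimately have "DERIV (\<lambda>r. \<Phi> r / w r) r :> Q1 r" by simp
  then show ?thesis
    by (rule has_field_derivative_transform_within_open[of _ _ _ "{0<..<R}"]) (use r Q_eq in \<open>auto simp: w_def\<close>)
qed

lemma DERIV_q:
  assumes r: "0 < r" "r < R" shows "DERIV q r :> q r * Q1 r / ((p - 1) * Q r)"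
proof -
  note Qp = Q_pos[OF r]
  have "DERIV (\<lambda>r. Q r powr (1 / (p - 1))) r :> (1 / (p - 1)) * Q r powr (1 / (p - 1) - 1) * Q1 r"
    by (rule DERIV_chain2[OF has_real_derivative_powr[OF Qp] DERIV_Q[OF r]])
  moreover have "(1 / (p - 1)) * Q r powr (1 / (p - 1) - 1) * Q1 r = q r * Q1 r / ((p - 1) * Q r)"
    using Qp p by (simp add: q_eq_Q[OF r] powr_diff)
  ultimately have "DERIV (\<lambda>r. Q r powr (1 / (p - 1))) r :> q r * Q1 r / ((p - 1) * Q r)" by simp
  then show ?thesis
    by (rule has_field_derivative_transform_within_open[of _ _ _ "{0<..<R}"]) (use r q_eq_Q in auto)
qed

lemma DERIV_m:
  assumes r: "0 < r" "r < R" shows "DERIV m r :> g r / r"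
  unfolding m_def[abs_def]
  by (rule DERIV_cong[OF DERIV_divide[OF DERIV_Q[OF r] DERIV_ident]]) (use r in \<open>simp_all add: g_def m_def field_simps\<close>)

lemma DERIV_Q1:
  assumes r: "0 < r" "r < R" shows "DERIV Q1 r :> p * q r * Q1 r - (real DIM('a) - 1) * (g r / r)"
proof -
  have "DERIV (\<lambda>r. q r * Q r) r :> q r * Q1 r / ((p - 1) * Q r) * Q r + Q1 r * q r"
    by (rule DERIV_mult[OF DERIV_q[OF r] DERIV_Q[OF r]])
  moreover have "q r * Q1 r / ((p - 1) * Q r) * Q r + Q1 r * q r = p / (p - 1) * q r * Q1 r"
    using Q_pos[OF r] p by (simp add: field_simps)
  ultimately have d: "DERIV (\<lambda>r. q r * Q r) r :> p / (p - 1) * q r * Q1 r" by simp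
  show ?thesis
    unfolding Q1_def[abs_def]
    by (rule DERIV_cong[OF DERIV_diff[OF DERIV_add[OF DERIV_const DERIV_cmult[OF d]] DERIV_cmult[OF DERIV_m[OF r]]]])
       (use p in \<open>simp add: Q1_def[symmetric]\<close>)
qed

lemma DERIV_g:
  assumes r: "0 < r" "r < R" shows "DERIV g r :> p * q r * Q1 r - real DIM('a) * (g r / r)"
proof -
  have "DERIV (\<lambda>r. Q1 r - m r) r :> p * q r * Q1 r - real DIM('a) * (g r / r)"
    by (rule DERIV_cong[OF DERIV_diff[OF DERIV_Q1[OF r] DERIV_m[OF r]]]) (use r in \<open>simp add: field_simps\<close>)
  moreover have "(\<lambda>r. Q1 r - m r) = g" by (simp add: fun_eq_iff g_def)
  ultimately show ?thesis by simp
qed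

section \<open>Limits at the centre\<close>

lemma at_right_in_interval: "\<forall>\<^sub>F r in at_right 0. 0 < r \<and> r < R"
  using R unfolding eventually_at_right_field by auto

lemma profile_tendsto_0: "(U \<longlongrightarrow> U 0) (at_right 0)"
  using continuous_on_Icc_at_rightD[OF continuous_profile R] .

text \<open>L'Hopital's rule for \<open>\<Phi> r / r ^ DIM('a)\<close>, where the powers cancel.
  \<open>Q1\<close> has the same limit, so \<open>g\<close> starts from 0.\<close>

lemma m_tendsto: "(m \<longlongrightarrow> lam / real DIM('a)) (at_right 0)"
proof -
  have U0: "0 < U 0" using R by (intro profile_pos) simp
  have \<Phi>0: "(\<Phi> \<longlongrightarrow> 0) (at_right 0)"
  proof -
    have "continuous_on {0..R / 2} \<Phi>" using R by (intro DERIV_continuous_on[OF DERIV_\<Phi>_within]) auto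
    from continuous_on_Icc_at_rightD[OF this] R show ?thesis by (simp add: \<Phi>_def)
  qed
  have lim: "((\<lambda>r. \<Phi> r / r ^ DIM('a)) \<longlongrightarrow> lam * U 0 powr (p - 1) / real DIM('a)) (at_right 0)"
  proof (rule lhopital_right_0[where f' = "\<lambda>r. lam * (r ^ (DIM('a) - 1) * U r powr (p - 1))" and g' = "\<lambda>r. real DIM('a) * r ^ (DIM('a) - 1)"])
    show "((\<lambda>r::real. r ^ DIM('a)) \<longlongrightarrow> 0) (at_right 0)"
      by (rule tendsto_eq_rhs[OF tendsto_power[OF tendsto_ident_at]]) (simp add: DIM_positive)
    show "\<forall>\<^sub>F r in at_right 0. r ^ DIM('a) \<noteq> (0::real)"
      using at_right_in_interval by eventually_elim simp
    show "\<forall>\<^sub>F r in at_right 0. real DIM('a) * r ^ (DIM('a) - 1) \<noteq> 0"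
      using at_right_in_interval by eventually_elim simp
    show "\<forall>\<^sub>F r in at_right 0. (\<Phi> has_real_derivative lam * (r ^ (DIM('a) - 1) * U r powr (p - 1))) (at r)"
      using at_right_in_interval by eventually_elim (rule DERIV_\<Phi>, auto)
    show "\<forall>\<^sub>F r in at_right 0. ((\<lambda>r. r ^ DIM('a)) has_real_derivative real DIM('a) * r ^ (DIM('a) - 1)) (at r)"
      using DERIV_pow[of "DIM('a)"] by simp
    have "((\<lambda>r. lam * U r powr (p - 1) / real DIM('a)) \<longlongrightarrow> lam * U 0 powr (p - 1) / real DIM('a)) (at_right 0)"
      using U0 by (intro tendsto_intros profile_tendsto_0) (auto simp: N_ge_1)
    then show "((\<lambda>r. lam * (r ^ (DIM('a) - 1) * U r powr (p - 1)) / (real DIM('a) * r ^ (DIM('a) - 1))) \<longlongrightarrow> lam * U 0 powr (p - 1) / real DIM('a)) (at_right 0)"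
      by (rule Lim_transform_eventually) (use at_right_in_interval in \<open>eventually_elim, simp\<close>)
  qed (use \<Phi>0 in auto)
  have "((\<lambda>r. \<Phi> r / r ^ DIM('a) / U r powr (p - 1)) \<longlongrightarrow> lam * U 0 powr (p - 1) / real DIM('a) / U 0 powr (p - 1)) (at_right 0)"
    using U0 by (intro tendsto_intros lim profile_tendsto_0) auto
  then have "((\<lambda>r. \<Phi> r / r ^ DIM('a) / U r powr (p - 1)) \<longlongrightarrow> lam / real DIM('a)) (at_right 0)" using U0 by simp
  then show ?thesis
  proof (rule Lim_transform_eventually)
    show "\<forall>\<^sub>F r in at_right 0. \<Phi> r / r ^ DIM('a) / U r powr (p - 1) = m r"
      using at_right_in_interval
    proof eventually_elim
      case (elim r)
      have "r ^ DIM('a) = r * r ^ (DIM('a) - 1)" using DIM_positive[where 'a='a] by (metis power_eq_if not_less0)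
      then show ?case using elim by (simp add: m_def Q_eq)
    qed
  qed
qed

lemma Q_tendsto_0: "(Q \<longlongrightarrow> 0) (at_right 0)"
proof -
  have "((\<lambda>r. m r * r) \<longlongrightarrow> lam / real DIM('a) * 0) (at_right 0)" by (intro tendsto_intros m_tendsto)
  then have "((\<lambda>r. m r * r) \<longlongrightarrow> 0) (at_right 0)" by simp
  then show ?thesis
    by (rule Lim_transform_eventually) (use at_right_in_interval in \<open>eventually_elim, simp add: m_def\<close>)
qed

lemma q_tendsto_0: "(q \<longlongrightarrow> 0) (at_right 0)"
proof -
  have "((\<lambda>r. Q r powr (1 / (p - 1))) \<longlongrightarrow> 0) (at_right 0)"
    by (rule tendsto_zero_powrI[OF Q_tendsto_0 tendsto_const])
       (use p in \<open>auto simp: Q_of_def\<close>)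
  then show ?thesis
    by (rule Lim_transform_eventually) (use at_right_in_interval in \<open>eventually_elim, simp add: q_eq_Q\<close>)
qed

lemma Q1_tendsto: "(Q1 \<longlongrightarrow> lam / real DIM('a)) (at_right 0)"
proof -
  have "(Q1 \<longlongrightarrow> lam + (p - 1) * (0 * 0) - (real DIM('a) - 1) * (lam / real DIM('a))) (at_right 0)"
    unfolding Q1_def[abs_def] by (intro tendsto_intros m_tendsto Q_tendsto_0 q_tendsto_0)
  moreover have "lam + (p - 1) * (0 * 0) - (real DIM('a) - 1) * (lam / real DIM('a)) = lam / real DIM('a)" using N_ge_1 by (simp add: field_simps)
  ultimately show ?thesis by simp
qed

lemma g_tendsto_0: "(g \<longlongrightarrow> 0) (at_right 0)"
  unfolding g_def[abs_def] using tendsto_diff[OF Q1_tendsto m_tendsto] by simp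

lemma profile_powr_tendsto: "((\<lambda>r. U r powr p) \<longlongrightarrow> U 0 powr p) (at_right 0)"
  using profile_pos[of 0] R by (intro tendsto_intros profile_tendsto_0) auto

text \<open>Since \<open>q = - U' / U\<close>, the weight \<open>U powr p\<close> is an integrating factor for the term \<open>p * q * g\<close>.\<close>

lemma g_pos:
  assumes r: "0 < r" "r < R" shows "0 < g r"
proof -
  \<comment> \<open>After inserting \<open>Q1 = g + m\<close>, the equation for \<open>g\<close> is
    linear with source \<open>p * q * m\<close>. The factor \<open>r * r ^ (DIM('a) - 1)\<close>
    absorbs the remaining term, minus the dimension times \<open>g / r\<close>.\<close>
  define h where "h = (\<lambda>r. g r * (r * r ^ (DIM('a) - 1) * U r powr p))"
  have "(h \<longlongrightarrow> 0 * (0 * 0 ^ (DIM('a) - 1) * U 0 powr p)) (at_right 0)"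
    unfolding h_def by (intro tendsto_intros g_tendsto_0 profile_powr_tendsto)
  then have "(h \<longlongrightarrow> 0) (at_right 0)" by simp
  moreover have "DERIV h s :> s * s ^ (DIM('a) - 1) * U s powr p * (p * q s * m s)" if s: "0 < s" "s < R" for s
    unfolding h_def
    by (rule DERIV_cong[OF DERIV_mult[OF DERIV_g[OF s] DERIV_mult[OF DERIV_mult[OF DERIV_ident DERIV_power_dim[OF s(1)]] DERIV_profile_powr[OF s]]]])
       (use s in \<open>simp add: g_def field_simps\<close>)
  moreover have "0 < s * s ^ (DIM('a) - 1) * U s powr p * (p * q s * m s)" if s: "0 < s" "s < r" for s
    using s r p q_pos[of s] m_pos[of s] profile_pos[of s] by simp
  ultimately have "0 < h r" using r by (intro positive_of_DERIV_pos[of h R _ r])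
  moreover have "0 < r * r ^ (DIM('a) - 1) * U r powr p" using r profile_pos[of r] by simp
  ultimately show ?thesis unfolding h_def by (rule zero_less_mult_pos2)
qed

section \<open>Strict monotonicity and strict convexity\<close>

lemma Q1_pos: "0 < r \<Longrightarrow> r < R \<Longrightarrow> 0 < Q1 r"
  using g_pos[of r] m_pos[of r] by (simp add: g_def)

lemma m_strict_mono:
  assumes "0 < s" "s < t" "t < R" shows "m s < m t"
proof (rule DERIV_pos_imp_increasing[OF assms(2)])
  fix x assume "s \<le> x" "x \<le> t"
  then have x: "0 < x" "x < R" using assms by auto
  show "\<exists>y. (m has_real_derivative y) (at x) \<and> 0 < y"
    using DERIV_m[OF x] g_pos[OF x] x by (intro exI[of _ "g x / x"]) simp
qed

lemma Q_strict_mono: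
  assumes "0 < s" "s < t" "t < R" shows "Q s < Q t"
proof (rule DERIV_pos_imp_increasing[OF assms(2)])
  fix x assume "s \<le> x" "x \<le> t"
  then have x: "0 < x" "x < R" using assms by auto
  show "\<exists>y. (Q has_real_derivative y) (at x) \<and> 0 < y"
    using DERIV_Q[OF x] Q1_pos[OF x] by blast
qed

text \<open>The derivative of \<open>Q1\<close> found in \<open>DERIV_Q1\<close>, hence the second
  derivative of \<open>Q\<close>.\<close>

definition Q2 :: "real \<Rightarrow> real" where "Q2 r = p * q r * Q1 r - (real DIM('a) - 1) * (g r / r)"

text \<open>Arranged as a positive source plus a multiple of \<open>Q2\<close>: the positivity of
  \<open>g\<close> established before makes the source positive, and the multiple is removed by an
  integrating factor.\<close>

lemma DERIV_Q2:
  assumes r: "0 < r" "r < R"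
  shows "DERIV Q2 r :> p * q r * (Q1 r)\<^sup>2 / ((p - 1) * Q r) + 2 * (real DIM('a) - 1) * g r / r\<^sup>2
     + (p * q r - (real DIM('a) - 1) / r) * Q2 r"
proof -
  let ?X = "((p * q r * Q1 r - real DIM('a) * (g r / r)) * r - g r * 1) / (r * r)"
  have "DERIV (\<lambda>r. p * (q r * Q1 r)) r :> p * (q r * Q1 r / ((p - 1) * Q r) * Q1 r + Q2 r * q r)"
    by (rule DERIV_cmult[OF DERIV_mult[OF DERIV_q[OF r] DERIV_Q1[OF r, folded Q2_def]]])
  moreover have "DERIV (\<lambda>r. (real DIM('a) - 1) * (g r / r)) r :> (real DIM('a) - 1) * ?X"
    by (rule DERIV_cmult[OF DERIV_divide[OF DERIV_g[OF r] DERIV_ident]]) (use r in simp)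
  ultimately have "((\<lambda>r. p * (q r * Q1 r) - (real DIM('a) - 1) * (g r / r)) has_real_derivative
     p * (q r * Q1 r / ((p - 1) * Q r) * Q1 r + Q2 r * q r) - (real DIM('a) - 1) * ?X) (at r)"
    by (rule DERIV_diff)
  moreover have "p * (q r * Q1 r / ((p - 1) * Q r) * Q1 r + Q2 r * q r) - (real DIM('a) - 1) * ?X
    = p * q r * (Q1 r)\<^sup>2 / ((p - 1) * Q r) + 2 * (real DIM('a) - 1) * g r / r\<^sup>2 + (p * q r - (real DIM('a) - 1) / r) * Q2 r"
  proof -
    have "?X = p * q r * Q1 r / r - (real DIM('a) + 1) * g r / r\<^sup>2"
      using r by (simp add: field_simps power2_eq_square)
    moreover have "Q2 r / r = p * q r * Q1 r / r - (real DIM('a) - 1) * g r / r\<^sup>2"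
      using r by (simp add: Q2_def field_simps power2_eq_square)
    \<comment> \<open>\<open>?X\<close> is the derivative of \<open>g r / r\<close>. Expressing it
      through \<open>Q2\<close> leaves a term in \<open>g\<close> that, after multiplication by
      minus (N - 1), has the favourable sign.\<close>
    ultimately have eq: "?X = Q2 r / r - 2 * g r / r\<^sup>2"
      by (simp add: diff_divide_distrib add_divide_distrib algebra_simps)
    show ?thesis by (simp only: eq) (simp add: algebra_simps power2_eq_square)
  qed
  ultimately show ?thesis unfolding Q2_def[abs_def] by (simp add: mult.assoc)
qed

text \<open>The integrating factor is r^(N-1) U^p. At the centre its power of r cancels the division
  by r in \<open>g / r\<close>; for N >= 2 the power r^(N-2) left over stays bounded while
  \<open>g\<close> tends to 0.\<close>

lemma Q2_pos:
  assumes r: "0 < r" "r < R" and N2: "2 \<le> DIM('a)" shows "0 < Q2 r"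
proof -
  define h where "h = (\<lambda>r. Q2 r * (r ^ (DIM('a) - 1) * U r powr p))"
  let ?k = "\<lambda>r. (p * q r * Q1 r * (r * r ^ (DIM('a) - 2)) - (real DIM('a) - 1) * (g r * r ^ (DIM('a) - 2))) * U r powr p"
  have Suc: "DIM('a) - 1 = Suc (DIM('a) - 2)" using N2 by simp
  have "(?k \<longlongrightarrow>
     (p * 0 * (lam / real DIM('a)) * (0 * 0 ^ (DIM('a) - 2)) - (real DIM('a) - 1) * (0 * 0 ^ (DIM('a) - 2))) * U 0 powr p) (at_right 0)"
    by (intro tendsto_intros g_tendsto_0 profile_powr_tendsto q_tendsto_0 Q1_tendsto)
  then have "(?k \<longlongrightarrow> 0) (at_right 0)"
    by simp
  then have "(h \<longlongrightarrow> 0) (at_right 0)"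
  proof (rule Lim_transform_eventually)
    show "\<forall>\<^sub>F r in at_right 0. ?k r = h r"
      using at_right_in_interval
    proof eventually_elim
      case (elim r)
      have pw: "r ^ (DIM('a) - 1) = r * r ^ (DIM('a) - 2)" by (simp only: Suc power_Suc)
      show ?case unfolding h_def Q2_def pw using elim by (simp add: field_simps)
    qed
  qed
  moreover have "DERIV h s :> (p * q s * (Q1 s)\<^sup>2 / ((p - 1) * Q s) + 2 * (real DIM('a) - 1) * g s / s\<^sup>2) * (s ^ (DIM('a) - 1) * U s powr p)" if s: "0 < s" "s < R" for s
    unfolding h_def
    by (rule DERIV_cong[OF DERIV_mult[OF DERIV_Q2[OF s] DERIV_mult[OF DERIV_power_dim[OF s(1)] DERIV_profile_powr[OF s]]]])
       (simp add: algebra_simps)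
  moreover have "0 < (p * q s * (Q1 s)\<^sup>2 / ((p - 1) * Q s) + 2 * (real DIM('a) - 1) * g s / s\<^sup>2) * (s ^ (DIM('a) - 1) * U s powr p)" if s: "0 < s" "s < r" for s
    using s r p N_ge_1 q_pos[of s] Q_pos[of s] Q1_pos[of s] g_pos[of s] profile_pos[of s]
    by (intro mult_pos_pos add_pos_nonneg divide_pos_pos divide_nonneg_pos mult_nonneg_nonneg) auto
  ultimately have "0 < h r" using r by (intro positive_of_DERIV_pos[of h R _ r])
  moreover have "0 < r ^ (DIM('a) - 1) * U r powr p" using r profile_pos[of r] by simp
  ultimately show ?thesis unfolding h_def by (rule zero_less_mult_pos2)
qed

text \<open>Compares the mean slopes over the two halves of the interval; \<open>Q1\<close> is
  strictly increasing because \<open>Q2\<close> is positive.\<close>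

lemma Q_strictly_midconvex:
  assumes "0 < s" "s < t" "t < R" and N2: "2 \<le> DIM('a)" shows "2 * Q ((s + t) / 2) < Q s + Q t"
proof -
  let ?c = "(s + t) / 2"
  have c: "s < ?c" "?c < t" using assms by auto
  obtain y where y: "s < y" "y < ?c" "Q ?c - Q s = (?c - s) * Q1 y"
    using MVT2[OF c(1), of Q Q1] DERIV_Q assms c by force
  obtain z where z: "?c < z" "z < t" "Q t - Q ?c = (t - ?c) * Q1 z"
    using MVT2[OF c(2), of Q Q1] DERIV_Q assms c by force
  have "Q1 y < Q1 z"
  proof (rule DERIV_pos_imp_increasing[where f = Q1 and a = y and b = z])
    fix x assume "y \<le> x" "x \<le> z"
    then have x: "0 < x" "x < R" using assms y z by auto
    show "\<exists>d. (Q1 has_real_derivative d) (at x) \<and> 0 < d"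
      using DERIV_Q1[OF x] Q2_pos[OF x N2] unfolding Q2_def by blast
  qed (use y z in simp)
  then have lt: "(?c - s) * Q1 y < (?c - s) * Q1 z" using c by simp
  have eq: "t - ?c = ?c - s" by (simp add: field_simps)
  have "Q ?c - Q s < Q t - Q ?c" unfolding y(3) z(3) eq by (rule lt)
  then show ?thesis by linarith
qed

text \<open>If \<open>Q\<close> were bounded, so would be \<open>q\<close>, the negative logarithmic
  derivative of \<open>U\<close>. Then \<open>U r * exp (B * r)\<close> would be nondecreasing on
  \<open>[R/2, R)\<close> and could not tend to 0 at \<open>R\<close>.\<close>

lemma Q_unbounded: "\<exists>r>0. r < R \<and> M < Q r"
proof (rule ccontr)
  assume "\<not> ?thesis"
  then have QM: "Q r \<le> M" if "0 < r" "r < R" for r using that by force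
  define B where "B = M powr (1 / (p - 1))"
  have qB: "q r \<le> B" if "0 < r" "r < R" for r
    using QM[OF that] Q_pos[OF that] p unfolding q_eq_Q[OF that] B_def by (intro powr_mono2) auto
  \<comment> \<open>The exponent 1 is written out so that \<open>DERIV_profile_powr\<close>
    applies.\<close>
  define f where "f r = U r powr 1 * exp (B * r)" for r
  have der: "DERIV f r :> (B - q r) * f r" if r: "0 < r" "r < R" for r
    unfolding f_def
    by (rule DERIV_cong[OF DERIV_mult[OF DERIV_profile_powr[OF r]]]) (auto intro!: derivative_eq_intros simp: algebra_simps)
  have fpos: "0 < f r" if "0 < r" "r < R" for r using profile_pos[of r] that by (simp add: f_def)
  have mono: "f (R / 2) \<le> f r" if r: "R / 2 \<le> r" "r < R" for r
  proof (rule DERIV_nonneg_imp_nondecreasing[OF r(1)])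
    fix x assume "R / 2 \<le> x" "x \<le> r"
    then have x: "0 < x" "x < R" using R r by auto
    show "\<exists>y. (f has_real_derivative y) (at x) \<and> 0 \<le> y"
      using der[OF x] qB[OF x] fpos[OF x] by (intro exI[of _ "(B - q x) * f x"]) simp
  qed
  have Ul: "(U \<longlongrightarrow> 0) (at_left R)"
    using continuous_on_Icc_at_leftD[OF continuous_profile R] profile_R by simp
  have "((\<lambda>r. U r * exp (B * r)) \<longlongrightarrow> 0 * exp (B * R)) (at_left R)"
    by (intro tendsto_intros Ul)
  moreover have "\<forall>\<^sub>F r in at_left R. f (R / 2) \<le> U r * exp (B * r)"
    unfolding eventually_at_left_field
  proof (intro exI[of _ "R / 2"] conjI allI impI)
    fix r assume "R / 2 < r" "r < R"
    then show "f (R / 2) \<le> U r * exp (B * r)" using mono[of r] profile_pos[of r] R by (simp add: f_def)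
  qed (use R in simp)
  ultimately have "f (R / 2) \<le> 0 * exp (B * R)" by (intro tendsto_lowerbound[of _ _ "at_left R"]) auto
  then show False using fpos[of "R / 2"] R by simp
qed

end

section \<open>The two-point inequality and the comparison\<close>

context ball_eigenfunction
begin

text \<open>Covers pairs with one point at the centre, where only the strict monotonicity of
  \<open>m\<close> is at work.\<close>

lemma Q_half_lt:
  assumes "0 < t" "t < R" shows "2 * Q (t / 2) < Q t"
  using m_strict_mono[of "t / 2" t] assms by (simp add: m_def field_simps)

lemma log_flux_eq:
  assumes x: "x \<in> \<Omega>" shows "log_flux p u x = - (Q (norm x) *\<^sub>R sgn x)"
proof -
  have ux: "0 < u x" by (rule pos_u[OF x])
  have "((\<lambda>z. ln (u z)) has_derivative (\<lambda>h. inverse (u x) * (Du x \<bullet> h))) (at x)"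
    by (rule has_derivative_compose[OF der_u[OF x] DERIV_ln[OF ux, unfolded has_field_derivative_def]])
  then have "gradient (\<lambda>z. ln (u z)) x = inverse (u x) *\<^sub>R Du x" by (intro gradient_eqI) simp
  also have "\<dots> = - (q (norm x) *\<^sub>R sgn x)"
    using x by (simp add: gradient_radial u_eq_profile q_eq divide_inverse mult.commute)
  finally have "log_flux p u x = flux p (- (q (norm x) *\<^sub>R sgn x))"
    by (simp add: log_flux_def flux_def)
  also have "\<dots> = - (flux p (q (norm x)) *\<^sub>R sgn x)"
    using flux_scaleR[of p "- q (norm x)" "sgn x"] by (simp add: flux_sgn) (simp add: flux_def)
  also have "\<dots> = - (Q (norm x) *\<^sub>R sgn x)"
  proof (cases "x = 0")
    case False
    then have "0 < q (norm x)" using x by (intro q_pos) auto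
    then show ?thesis by (simp add: flux_pos Q_of_def)
  qed simp
  finally show ?thesis .
qed

text \<open>For fixed norms the inequality is tightest when the segment from \<open>x\<close> to \<open>y\<close> passes
  through the centre; there it is midpoint convexity of \<open>Q\<close>.\<close>

lemma two_point_nonzero:
  assumes x: "x \<in> \<Omega>" "x \<noteq> 0" and y: "y \<in> \<Omega>" "y \<noteq> 0" and xy: "x \<noteq> y" and N2: "2 \<le> DIM('a)"
  defines "A \<equiv> (Q (norm y) *\<^sub>R sgn y - Q (norm x) *\<^sub>R sgn x) \<bullet> (y - x)"
  defines "d \<equiv> norm (x - y)"
  shows "2 * d * Q (d / 2) \<le> A" "A = 2 * d * Q (d / 2) \<longleftrightarrow> y = - x"
proof -
  define s t where "s = norm x" and "t = norm y"
  have st: "0 < s" "s < R" "0 < t" "t < R" using x y by (auto simp: s_def t_def)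
  have d: "0 < d" "d \<le> s + t" using xy norm_triangle_ineq4[of x y] by (auto simp: d_def s_def t_def)
  have d2: "d\<^sup>2 = s\<^sup>2 + t\<^sup>2 - 2 * (x \<bullet> y)"
    by (simp add: d_def s_def t_def power2_norm_eq_inner inner_diff_left inner_diff_right inner_commute)
  \<comment> \<open>Replacing \<open>sgn\<close> by \<open>m\<close> times the point and eliminating
    the inner product in favour of \<open>d\<close> makes \<open>A\<close> affine in
    \<open>d\<^sup>2\<close> for fixed norms \<open>s\<close> and \<open>t\<close>.\<close>
  have A: "A = (m t + m s) / 2 * d\<^sup>2 + (m t - m s) * (t\<^sup>2 - s\<^sup>2) / 2"
  proof -
    have "Q t *\<^sub>R sgn y = m t *\<^sub>R y" "Q s *\<^sub>R sgn x = m s *\<^sub>R x"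
      using st by (simp_all add: m_def sgn_div_norm s_def t_def divide_inverse)
    then have "A = m t * t\<^sup>2 + m s * s\<^sup>2 - (m t + m s) * (x \<bullet> y)"
      unfolding A_def s_def[symmetric] t_def[symmetric]
      by (simp add: s_def t_def power2_norm_eq_inner inner_diff_left inner_diff_right inner_commute algebra_simps)
    then show ?thesis unfolding d2 by (simp add: field_simps)
  qed
  have mono: "0 \<le> (m t - m s) * (t\<^sup>2 - s\<^sup>2)"
  proof (cases s t rule: linorder_cases)
    case less
    then show ?thesis using m_strict_mono[of s t] st power_mono[of s t 2] by (intro mult_nonneg_nonneg) auto
  next
    case greater
    then show ?thesis using m_strict_mono[of t s] st power_mono[of t s 2] by (intro mult_nonpos_nonpos) auto
  qed simp
  let ?D = "s + t"
  have D: "0 < ?D" "?D / 2 < R" using st by auto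
  have dD: "d\<^sup>2 / ?D\<^sup>2 \<le> 1" using d D power_mono[of d ?D 2] by (simp add: divide_le_eq)
  have QQ: "(m t + m s) / 2 * ?D\<^sup>2 + (m t - m s) * (t\<^sup>2 - s\<^sup>2) / 2 = ?D * (Q t + Q s)"
  proof -
    have "Q t = m t * t" "Q s = m s * s" using st by (simp_all add: m_def)
    then show ?thesis by (simp add: field_simps power2_eq_square)
  qed
  \<comment> \<open>Shrinking the nonnegative constant term by \<open>d\<^sup>2 / ?D\<^sup>2\<close>
    makes the bound proportional to the value at \<open>d = ?D\<close>, where the points lie on
    opposite sides of the centre.\<close>
  have "A \<ge> (m t + m s) / 2 * d\<^sup>2 + d\<^sup>2 / ?D\<^sup>2 * ((m t - m s) * (t\<^sup>2 - s\<^sup>2) / 2)"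
    unfolding A using mult_right_mono[OF dD, of "(m t - m s) * (t\<^sup>2 - s\<^sup>2) / 2"] mono by simp
  also have "(m t + m s) / 2 * d\<^sup>2 + d\<^sup>2 / ?D\<^sup>2 * ((m t - m s) * (t\<^sup>2 - s\<^sup>2) / 2) = d\<^sup>2 / ?D\<^sup>2 * (?D * (Q t + Q s))"
    unfolding QQ[symmetric] using D by (simp add: field_simps)
  also have "\<dots> = d\<^sup>2 / ?D * (Q t + Q s)" using D by (simp add: power2_eq_square)
  finally have A1: "d\<^sup>2 / ?D * (Q s + Q t) \<le> A" by (simp add: add.commute)
  have conv: "2 * Q (?D / 2) \<le> Q s + Q t" "s \<noteq> t \<Longrightarrow> 2 * Q (?D / 2) < Q s + Q t"
    using Q_strictly_midconvex[of s t] Q_strictly_midconvex[of t s] st N2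
    by (cases s t rule: linorder_cases; force simp: add.commute)+
  have mD: "m (d / 2) \<le> m (?D / 2)" "d < ?D \<Longrightarrow> m (d / 2) < m (?D / 2)"
    using m_strict_mono[of "d / 2" "?D / 2"] d D by (cases "d = ?D"; force)+
  have e1: "2 * d * Q (d / 2) = d\<^sup>2 * m (d / 2)" using d by (simp add: m_def power2_eq_square)
  have e2: "d\<^sup>2 / ?D * (2 * Q (?D / 2)) = d\<^sup>2 * m (?D / 2)" using D by (simp add: m_def)
  have c2: "d\<^sup>2 / ?D * (2 * Q (?D / 2)) \<le> d\<^sup>2 / ?D * (Q s + Q t)"
    using conv(1) D by (intro mult_left_mono) auto
  have c3: "d\<^sup>2 * m (d / 2) \<le> d\<^sup>2 * m (?D / 2)" using mD(1) by (intro mult_left_mono) auto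
  show "2 * d * Q (d / 2) \<le> A" using A1 c2 c3 e1 e2 by linarith
  show "A = 2 * d * Q (d / 2) \<longleftrightarrow> y = - x"
  proof
    \<comment> \<open>Equality leaves no room in either estimate: strict convexity of
      \<open>Q\<close> forces equal norms, and strict monotonicity of \<open>m\<close> forces
      \<open>d = ?D\<close>. Together they give antipodal points.\<close>
    assume eq: "A = 2 * d * Q (d / 2)"
    have "s = t"
    proof (rule ccontr)
      assume "s \<noteq> t"
      then have "d\<^sup>2 / ?D * (2 * Q (?D / 2)) < d\<^sup>2 / ?D * (Q s + Q t)"
        using conv(2) D d by (intro mult_strict_left_mono) auto
      then show False using eq A1 c3 e1 e2 by linarith
    qed
    moreover have "d = ?D"
    proof (rule ccontr)
      assume "d \<noteq> ?D"
      then have "d\<^sup>2 * m (d / 2) < d\<^sup>2 * m (?D / 2)" using mD(2) d by (intro mult_strict_left_mono) auto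
      then show False using eq A1 c2 e1 e2 by linarith
    qed
    ultimately have "x \<bullet> y = - s\<^sup>2" using d2 by (simp add: power2_eq_square algebra_simps)
    moreover have "x \<bullet> x = s\<^sup>2" "y \<bullet> y = t\<^sup>2" by (simp_all add: s_def t_def power2_norm_eq_inner)
    ultimately have "(x + y) \<bullet> (x + y) = 0"
      using \<open>s = t\<close> by (simp add: inner_add_left inner_add_right inner_commute[of y x])
    then show "y = - x" by (simp add: eq_neg_iff_add_eq_0 add.commute)
  next
    assume y: "y = - x"
    then have "t = s" by (simp add: s_def t_def)
    moreover have "x - y = 2 *\<^sub>R x" using y by (simp add: scaleR_2)
    then have "d = 2 * s" by (simp add: d_def s_def)
    ultimately show "A = 2 * d * Q (d / 2)" unfolding A e1 by simp
  qed
qed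

lemma two_point:
  assumes x: "x \<in> \<Omega>" and y: "y \<in> \<Omega>" and xy: "x \<noteq> y" and N2: "2 \<le> DIM('a)"
  shows "(log_flux p u y - log_flux p u x) \<bullet> ((y - x) /\<^sub>R norm (y - x)) \<le> - 2 * Q (norm (x - y) / 2)" (is ?le)
    and "(log_flux p u y - log_flux p u x) \<bullet> ((y - x) /\<^sub>R norm (y - x)) = - 2 * Q (norm (x - y) / 2) \<longleftrightarrow> y = - x" (is ?eq)
proof -
  define A d where "A = (Q (norm y) *\<^sub>R sgn y - Q (norm x) *\<^sub>R sgn x) \<bullet> (y - x)" and "d = norm (x - y)"
  have d: "0 < d" using xy by (simp add: d_def)
  have "(log_flux p u y - log_flux p u x) = - (Q (norm y) *\<^sub>R sgn y - Q (norm x) *\<^sub>R sgn x)"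
    using x y by (simp add: log_flux_eq)
  then have L: "(log_flux p u y - log_flux p u x) \<bullet> ((y - x) /\<^sub>R norm (y - x)) = - A / d"
    by (simp only: inner_minus_left inner_scaleR_right A_def[symmetric]) (simp add: d_def norm_minus_commute divide_inverse)
  have "2 * d * Q (d / 2) \<le> A \<and> (A = 2 * d * Q (d / 2) \<longleftrightarrow> y = - x)"
  \<comment> \<open>The centre is treated apart because \<open>m 0\<close> is a division by zero
    with value 0, not the limit of \<open>m\<close> at 0.\<close>
  proof (cases "x = 0 \<or> y = 0")
    case True
    define t where "t = norm (if x = 0 then y else x)"
    have t: "0 < t" "t < R" "d = t" using True x y xy by (auto simp: t_def d_def)
    have A: "A = Q t * t"
      using True xy Q_0 by (auto simp: A_def t_def sgn_div_norm dot_square_norm power2_eq_square)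
    have "2 * Q (t / 2) * t < Q t * t" using Q_half_lt[OF t(1,2)] t(1) by (rule mult_strict_right_mono)
    then have "2 * d * Q (d / 2) < A" unfolding A t(3) by (simp only: mult.commute mult.left_commute)
    moreover have "y \<noteq> - x" using True xy by auto
    ultimately show ?thesis by auto
  next
    case False
    then show ?thesis using two_point_nonzero[OF x _ y _ xy N2] unfolding A_def d_def by blast
  qed
  then show ?le ?eq unfolding L d_def[symmetric] using d by (auto simp: field_simps)
qed

end

text \<open>In dimension one the Riccati equation is autonomous, with right-hand side
  \<open>\<sigma>\<close> evaluated at the flux. So \<open>T\<close>, the integral of
  1/\<open>\<sigma>\<close>, recovers the radius from the flux; as an integral it is available at
  the values of the other flux too.\<close>

lemma flux_comparison:
  fixes uB :: "'a::euclidean_space \<Rightarrow> real" and uI :: "real \<Rightarrow> real"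
  assumes "ball_eigenfunction p R uB" "ball_eigenfunction p R uI" and N2: "2 \<le> DIM('a)" and r: "0 < r" "r < R"
  shows "Q_of p uI r < Q_of p uB r"
proof -
  interpret B: ball_eigenfunction p R uB by fact
  interpret I: ball_eigenfunction p R uI by fact
  note p = B.p and R = B.R
  define \<sigma> where "\<sigma> y = I.lam + (p - 1) * y powr (p / (p - 1))" for y
  have \<sigma>: "I.lam \<le> \<sigma> y" "0 < \<sigma> y" for y
    using I.lam_pos p by (auto simp: \<sigma>_def add_pos_nonneg)
  have c\<sigma>: "continuous_on {0..b} (\<lambda>y. inverse (\<sigma> y))" for b
  proof -
    have "\<sigma> y \<noteq> 0" for y using \<sigma>(2)[of y] by simp
    then show ?thesis using p unfolding \<sigma>_def
      by (intro continuous_intros continuous_on_powr') auto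
  qed
  define T where "T y = integral {0..y} (\<lambda>y. inverse (\<sigma> y))" for y
  have dT: "DERIV T y :> inverse (\<sigma> y)" if "0 < y" for y
  proof -
    have "(T has_real_derivative inverse (\<sigma> y)) (at y within {0..y + 1})"
      unfolding T_def using that by (intro integral_has_real_derivative c\<sigma>) auto
    then show ?thesis using that at_within_interior[of y "{0..y + 1}"] by simp
  qed
  have T_mono: "T y < T z" if "0 < y" "y < z" for y z
    by (rule DERIV_pos_imp_increasing[OF that(2)]) (use that dT \<sigma>(2) in \<open>meson less_le_trans positive_imp_inverse_positive\<close>)
  have T0: "(T \<longlongrightarrow> 0) (at_right 0)"
  proof -
    have "continuous_on {0..1} T"
      unfolding T_def by (intro indefinite_integral_continuous_1 integrable_continuous_real c\<sigma>)
    from continuous_on_Icc_at_rightD[OF this] show ?thesis by (simp add: T_def)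
  qed
  have qQ: "q_of v s * Q_of p v s = Q_of p v s powr (p / (p - 1))" if "0 < q_of v s" for v :: "'c::euclidean_space \<Rightarrow> real" and s
  proof -
    have "q_of v s * q_of v s powr (p - 1) = q_of v s powr p" using that by (simp add: powr_diff)
    then show ?thesis using p that by (simp add: Q_of_def powr_powr)
  qed
  have TQ0: "((\<lambda>s. T (Q s)) \<longlongrightarrow> 0) (at_right 0)"
    if "(Q \<longlongrightarrow> 0) (at_right 0)" "\<And>s. 0 < s \<Longrightarrow> s < R \<Longrightarrow> 0 < Q s" for Q :: "real \<Rightarrow> real"
  proof (rule filterlim_compose[OF T0])
    have "\<forall>\<^sub>F s in at_right 0. Q s \<in> {0<..} \<and> Q s \<noteq> 0"
      using B.at_right_in_interval by eventually_elim (use that(2) in force)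
    then show "filterlim Q (at_right 0) (at_right 0)"
      unfolding filterlim_at using that(1) by blast
  qed
  have TI: "T (Q_of p uI s) = s" if s: "0 < s" "s < R" for s
  proof -
    define f where "f s = T (Q_of p uI s) - s" for s
    have f0: "(f \<longlongrightarrow> 0) (at_right 0)"
      unfolding f_def using tendsto_diff[OF TQ0[OF I.Q_tendsto_0 I.Q_pos] tendsto_ident_at[of 0 "{0<..}"]] by simp
    have der: "DERIV f s :> 0" if s: "0 < s" "s < R" for s
    proof -
      have "I.Q1 s = \<sigma> (Q_of p uI s)"
        using qQ[OF I.q_pos[OF s]] by (simp add: I.Q1_def \<sigma>_def)
      then have "inverse (\<sigma> (Q_of p uI s)) * I.Q1 s - 1 = 0" using \<sigma>(2)[of "Q_of p uI s"] by simp
      then show ?thesis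
        unfolding f_def using DERIV_diff[OF DERIV_chain2[OF dT[OF I.Q_pos[OF s]] I.DERIV_Q[OF s]] DERIV_ident] by simp
    qed
    have "f z = f s" if z: "0 < z" "z < s" for z
      using DERIV_isconst3[of 0 R z s f] der s z by simp
    then have "\<forall>\<^sub>F z in at_right 0. f z = f s"
      using s unfolding eventually_at_right_field by blast
    then have "(f \<longlongrightarrow> f s) (at_right 0)" by (rule tendsto_eventually)
    then have "f s = 0" using tendsto_unique[OF _ _ f0] by simp
    then show ?thesis by (simp add: f_def)
  qed
  define F where "F s = T (Q_of p uB s) - s" for s
  define F' where "F' s = inverse (\<sigma> (Q_of p uB s)) * (B.lam - I.lam - (real DIM('a) - 1) * B.m s)" for s
  have F0: "(F \<longlongrightarrow> 0) (at_right 0)"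
    unfolding F_def using tendsto_diff[OF TQ0[OF B.Q_tendsto_0 B.Q_pos] tendsto_ident_at[of 0 "{0<..}"]] by simp
  have dF: "DERIV F s :> F' s" if s: "0 < s" "s < R" for s
  proof -
    have "B.Q1 s = \<sigma> (Q_of p uB s) + (B.lam - I.lam - (real DIM('a) - 1) * B.m s)"
      using qQ[OF B.q_pos[OF s]] by (simp add: B.Q1_def \<sigma>_def)
    then have "inverse (\<sigma> (Q_of p uB s)) * B.Q1 s - 1 = F' s"
      using \<sigma>(2)[of "Q_of p uB s"] by (simp add: F'_def field_simps)
    then show ?thesis
      unfolding F_def using DERIV_diff[OF DERIV_chain2[OF dT[OF B.Q_pos[OF s]] B.DERIV_Q[OF s]] DERIV_ident] by simp
  qed
  have "0 < F r"
  proof (rule ccontr)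
    assume neg: "\<not> 0 < F r"
    \<comment> \<open>Otherwise \<open>F\<close> would increase from its limit 0 up to
      \<open>r\<close>. From such a \<open>z\<close> on, the strict growth of \<open>m\<close> keeps
      the derivative negative, as the dimension is at least 2.\<close>
    have "\<exists>z. 0 < z \<and> z < r \<and> F' z \<le> 0"
    proof (rule ccontr)
      assume "\<not> ?thesis"
      then have "0 < F' s" if "0 < s" "s < r" for s using that by force
      then show False using positive_of_DERIV_pos[OF F0 dF _ r] neg by blast
    qed
    then obtain z where z: "0 < z" "z < r" "F' z \<le> 0" by blast
    have F'neg: "F' s < 0" if s: "z < s" "s < R" for s
    proof -
      have "B.lam - I.lam - (real DIM('a) - 1) * B.m z \<le> 0"
        using z(3) \<sigma>(2)[of "Q_of p uB z"] by (simp add: F'_def mult_le_0_iff)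
      moreover have "(real DIM('a) - 1) * B.m z < (real DIM('a) - 1) * B.m s"
        using B.m_strict_mono[OF z(1) s] N2 by (intro mult_strict_left_mono) auto
      ultimately show ?thesis
        unfolding F'_def using \<sigma>(2)[of "Q_of p uB s"] by (intro mult_pos_neg) auto
    qed
    have decr: "F t < F s" if st: "r \<le> s" "s < t" "t < R" for s t
    proof (rule DERIV_neg_imp_decreasing[OF st(2)])
      fix x assume "s \<le> x" "x \<le> t"
      then have x: "0 < x" "z < x" "x < R" using st r z by auto
      show "\<exists>y. (F has_real_derivative y) (at x) \<and> y < 0"
        using dF[OF x(1,3)] F'neg[OF x(2,3)] by blast
    qed
    define c where "c = (r + R) / 2"
    have c: "r < c" "c < R" using r by (auto simp: c_def)
    have Fc: "F c < 0" using decr[of r c] c neg by simp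
    \<comment> \<open>Any \<open>s\<close> above \<open>R + F c\<close> will do. Unboundedness of
      the ball flux then gives \<open>t > s\<close> with \<open>T (Q_of p uB t) > s\<close>, hence
      \<open>F t > s - R > F c\<close>, although \<open>F\<close> decreases beyond
      \<open>c\<close>.\<close>
    define s where "s = max c (R + F c / 2)"
    have s: "c \<le> s" "s < R" "R + F c < s" "0 < s" using c Fc r by (auto simp: s_def)
    obtain t0 where t0: "0 < t0" "t0 < R" "Q_of p uI s < Q_of p uB t0"
      using B.Q_unbounded[of "Q_of p uI s"] by blast
    define t where "t = max t0 ((s + R) / 2)"
    have t: "t0 \<le> t" "t < R" "s < t" using t0 s by (auto simp: t_def less_max_iff_disj)
    have "Q_of p uB t0 \<le> Q_of p uB t" using B.Q_strict_mono[of t0 t] t t0 by (cases "t0 = t") auto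
    then have "T (Q_of p uI s) < T (Q_of p uB t)" using t0 I.Q_pos[OF s(4,2)] by (intro T_mono) auto
    then have "s < T (Q_of p uB t)" using TI s by simp
    moreover have "F t < F c" using decr[of c t] c s t by simp
    ultimately show False using t s by (simp add: F_def)
  qed
  then have lt: "T (Q_of p uI r) < T (Q_of p uB r)" using TI[OF r] by (simp add: F_def)
  show ?thesis
  proof (rule ccontr)
    assume "\<not> ?thesis"
    then have "T (Q_of p uB r) \<le> T (Q_of p uI r)"
      using T_mono[OF B.Q_pos[OF r], of "Q_of p uI r"] by (cases "Q_of p uB r = Q_of p uI r") auto
    then show False using lt by simp
  qed
qed

theorem theorem1p2:
  fixes uB :: "'a::euclidean_space \<Rightarrow> real" and uI :: "real \<Rightarrow> real" and p R :: real
  assumes "DIM('a) \<ge> 2" and "1 < p" and "0 < R"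
    and "classical_first_eigenfunction p (ball 0 R) uB" and "uB 0 = 1"
    and "classical_first_eigenfunction p {-R<..<R} uI" and "uI 0 = 1"
  shows "(\<forall>x\<in>ball 0 R. \<forall>y\<in>ball 0 R. x \<noteq> y \<longrightarrow>
            (log_flux p uB y - log_flux p uB x) \<bullet> ((y - x) /\<^sub>R norm (y - x))
              \<le> - 2 * Q_of p uB (norm (x - y) / 2) \<and>
            ((log_flux p uB y - log_flux p uB x) \<bullet> ((y - x) /\<^sub>R norm (y - x))
              = - 2 * Q_of p uB (norm (x - y) / 2) \<longleftrightarrow> y = - x))
       \<and> (\<forall>r. 0 < r \<and> r < R \<longrightarrow> Q_of p uB r > Q_of p uI r)"
proof -
  have B: "ball_eigenfunction p R uB"
    using assms by unfold_locales
  have "{-R<..<R} = ball 0 R" by (simp add: ball_eq_greaterThanLessThan)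
  then have I: "ball_eigenfunction p R uI"
    using assms by unfold_locales simp_all
  show ?thesis
    using ball_eigenfunction.two_point[OF B _ _ _ assms(1)] flux_comparison[OF B I assms(1)] by blast
qed

end
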